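(* Let $\sigma:X\to X$ be the shift map and let $\phi\in BV_r(X,\mathbb{R})$ be such that conditions (i)–(v) listed in the context hold. Then there exists a Borel measure $\nu$ on $\overline{X}^{\varrho}$ that is $e^{P(\phi)-\phi}$-conformal (for $\overline{\sigma}:\overline{X}^\varrho\to\overline{X}^\varrho$) and satisfies $\nu(X_{\mathrm{rad}})=1$.
   Context: Let $\Sigma^+=\mathbb{Z}^{\mathbb{N}}$ be the set of sequences $\underline{a}=(a_0a_1\cdots)$ of integers, $\sigma(a_0a_1\cdots)=(a_1a_2\cdots)$, $\underline{0}=(00\cdots)$, and $\Sigma_N^+=\{\underline{a}\in\Sigma^+:a_j\in\{-N,\dots,N\}\ \forall j\}$. Let $X\subset\Sigma^+$ satisfy $\sigma(X)=X=\sigma^{-1}(X)$, and let $\varrho$ be a metric on $X$ (not necessarily compatible with the product topology). Standing assumption: for each $N\ge1$, $\Sigma_N^+\subset X$ and $\Sigma_N^+$ is $\varrho$-compact; and every $\varrho$-compact $\Lambda\subset X$ with $\sigma(\Lambda)\subset\Lambda$ is contained in some $\Sigma_N^+$. Notation: for $c^*=c_0\cdots c_{n-1}\in\mathbb{Z}^n$, $c^*\underline{a}=(c_0\cdots c_{n-1}a_0a_1\cdots)$. For $\underline{a}\in X$, $\eta>0$: $B(\underline{a},\eta)=\{\underline{b}\in X:\varrho(\underline{a},\underline{b})<\eta\}$, $\mathbb{B}_0(\underline{a},\eta)=\{\underline{b}\in B(\underline{a},\eta):b_0=a_0\}$, $\mathbb{B}_n(\underline{a},\eta)=\{\underline{b}\in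 X:\sigma^j\underline{b}\in\mathbb{B}_0(\sigma^j\underline{a},\eta),\ j=0,\dots,n\}$. For $k\in\mathbb{Z}$, $[k]=\{\underline{b}\in X:b_0=k\}$, and for $R>0$, $[k,R]=\{\underline{a}\in[k]:\varrho(\underline{0},\underline{a})>R\}$. Standing assumptions on $\varrho$: there is $\delta_0>0$ such that (Exp) there are $C_{ES}>0$, $\lambda_{ES}>1$ with $\varrho(c^*\underline{a},c^*\underline{b})\le C_{ES}\lambda_{ES}^{-n}\varrho(\underline{a},\underline{b})$ for all $n\in\mathbb{N}$, $c^*\in\mathbb{Z}^n$ and $\underline{a},\underline{b}\in X$ with $\varrho(\underline{a},\underline{b})<\delta_0$; (Con) for every $R>0$ there is $n\ge1$ such that $\sigma^nB(\underline{a},\delta_0)\supset B(\underline{0},R)$ for all $\underline{a}\in B(\underline{0},R)$. Potentials: fix $\delta\in(0,\delta_0]$ and $r\in(0,1)$. A continuous $\phi:X\to\mathbb{R}$ is $(\eta,r)$-weakly H\"older if there is $C\ge0$ with $\sup_{\underline{a}\in X}\sup_{\underline{b},\underline{c}\in\mathbb{B}_n(\underline{a},\eta)}|\phi(\underline{b})-\phi(\underline{c})|\le Cr^n$ for all $n\ge0$; $BV_r(X,\mathbb{R})$ is the set of $(\delta,r)$-weakly H\"older functions. Standing assumption (Delta): with $\delta'=\min\{\delta,\delta/C_{ES}\}$, every $(\delta',r)$-weakly H\"older function is $(\delta,r)$-weakly H\"older. Pressure: $S_n\phi=\sum_{k=0}^{n-1}\phi\circ\sigma^k$, $P_{\mathrm{top}}(\phi|_{\Sigma_N^+})=\lim_{n\to\infty}\frac1n\log\sum_{c^*\in\mathbb{Z}^n,\,c^*\underline{a}\in\Sigma_N^+}e^{S_n\phi(c^*\underline{a})}$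 (with $\underline{a}\in\Sigma_N^+$), and $P(\phi)=\sup_{N\ge1}P_{\mathrm{top}}(\phi|_{\Sigma_N^+})$. Conditions, where $\overline{X}^\varrho$ is the completion of $(X,\varrho)$ and $\overline{B(\underline{0},R)}=\{\underline{b}\in\overline{X}^\varrho:\varrho(\underline{0},\underline{b})\le R\}$: (i) $\sigma:X\to X$ extends continuously to $\overline{\sigma}:\overline{X}^\varrho\to\overline{X}^\varrho$; (ii) for every $R>0$, $\overline{B(\underline{0},R)}$ is compact in $\overline{X}^\varrho$; (iii) for every $R>0$ and $\underline{b}\in\overline{X}^\varrho\setminus X$ there is $N\ge1$ such that $\overline{\sigma}^n(\underline{b})\in\overline{X}^\varrho\setminus\overline{B(\underline{0},R)}$ for all $n\ge N$; (iv) $\sum_{k\in\mathbb{Z}}e^{\sup\phi|_{[k]}}<\infty$ and $\lim_{R\to\infty}\sum_{k\in\mathbb{Z}}e^{\sup\phi|_{[k,R]}}=0$; (v) $\phi$ has a continuous extension to $\overline{X}^\varrho$ (still denoted $\phi$). $X_{\mathrm{rad}}=\{\underline{a}\in\overline{X}^\varrho:\omega_{\overline{\sigma}}(\underline{a})\cap X\ne\emptyset\}$, where $\omega_{\overline{\sigma}}(\underline{a})$ is the $\omega$-limit set. A Borel measure $m$ is $g$-conformal for a map $T$ if $m(T(A))=\int_Ag\,dm$ for every measurable $A$ such that $T(A)$ is measurable and $T|_A$ is injective. *)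

theory Defs
  imports
    "HOL-Analysis.Analysis"
    "HOL-Library.Omega_Words_Fun"
    "HOL-Probability.Discrete_Topology"
begin

text \<open>
  Integer sequences are functions \<open>nat \<Rightarrow> int\<close>. For a finite word \<open>c\<close>, the concatenation
  \<open>c\<^sup>*a\<close> is the library's \<open>c \<frown> a\<close>.
\<close>

definition shift :: "(nat \<Rightarrow> int) \<Rightarrow> nat \<Rightarrow> int" where
  "shift a = (\<lambda>j. a (Suc j))"

definition zero_seq :: "nat \<Rightarrow> int" where
  "zero_seq = (\<lambda>_. 0)"

definition full_shift :: "nat \<Rightarrow> (nat \<Rightarrow> int) set" where
  "full_shift N = {a. \<forall>j. a j \<in> {- int N..int N}}"

subsection \<open>The shift space and its metric\<close>

text \<open>
  Compactness and balls refer to the metric \<open>\<rho>\<close> on \<open>X\<close>, not to the product topology of the type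
  \<open>nat \<Rightarrow> int\<close>. In \<open>expansion\<close> the word \<open>c\<close> may be empty.
\<close>

locale expanding_shift = Metric_space X \<rho>
  for X :: "(nat \<Rightarrow> int) set" and \<rho> :: "(nat \<Rightarrow> int) \<Rightarrow> (nat \<Rightarrow> int) \<Rightarrow> real" +
  fixes \<delta>\<^sub>0 C\<^sub>E\<^sub>S L\<^sub>E\<^sub>S :: real
  assumes shift_image: "shift ` X = X"
    and shift_vimage: "shift -` X = X"
    and full_shift_compact: "\<And>N. N \<ge> 1 \<Longrightarrow> full_shift N \<subseteq> X \<and> compactin mtopology (full_shift N)"
    and compact_invariant_subset:
      "\<And>\<Lambda>. \<lbrakk>\<Lambda> \<subseteq> X; compactin mtopology \<Lambda>; shift ` \<Lambda> \<subseteq> \<Lambda>\<rbrakk> \<Longrightarrow> \<exists>N\<ge>1. \<Lambda> \<subseteq> full_shift N"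
    and delta0_pos: "\<delta>\<^sub>0 > 0"
    and C_ES_pos: "C\<^sub>E\<^sub>S > 0"
    and L_ES_gt_1: "L\<^sub>E\<^sub>S > 1"
    and expansion:
      "\<And>c a b. \<lbrakk>a \<in> X; b \<in> X; \<rho> a b < \<delta>\<^sub>0\<rbrakk>
         \<Longrightarrow> \<rho> (c \<frown> a) (c \<frown> b) \<le> C\<^sub>E\<^sub>S * L\<^sub>E\<^sub>S powi (- int (length c)) * \<rho> a b"
    and connection:
      "\<And>R. R > 0 \<Longrightarrow>
         \<exists>n\<ge>1. \<forall>a\<in>mball zero_seq R. mball zero_seq R \<subseteq> (shift ^^ n) ` mball a \<delta>\<^sub>0"

subsection \<open>Potentials\<close>

definition cyl_ball ::
    "(nat \<Rightarrow> int) set \<Rightarrow> ((nat \<Rightarrow> int) \<Rightarrow> (nat \<Rightarrow> int) \<Rightarrow> real) \<Rightarrow> (nat \<Rightarrow> int) \<Rightarrow> real \<Rightarrow> (nat \<Rightarrow> int) set" where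
  "cyl_ball X \<rho> a \<eta> = {b \<in> Metric_space.mball X \<rho> a \<eta>. b 0 = a 0}"

definition bowen_ball ::
    "(nat \<Rightarrow> int) set \<Rightarrow> ((nat \<Rightarrow> int) \<Rightarrow> (nat \<Rightarrow> int) \<Rightarrow> real) \<Rightarrow> nat \<Rightarrow> (nat \<Rightarrow> int) \<Rightarrow> real \<Rightarrow> (nat \<Rightarrow> int) set" where
  "bowen_ball X \<rho> n a \<eta> = {b \<in> X. \<forall>j\<le>n. (shift ^^ j) b \<in> cyl_ball X \<rho> ((shift ^^ j) a) \<eta>}"

definition weakly_Hoelder ::
    "(nat \<Rightarrow> int) set \<Rightarrow> ((nat \<Rightarrow> int) \<Rightarrow> (nat \<Rightarrow> int) \<Rightarrow> real) \<Rightarrow> real \<Rightarrow> real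
      \<Rightarrow> ((nat \<Rightarrow> int) \<Rightarrow> real) \<Rightarrow> bool" where
  "weakly_Hoelder X \<rho> \<eta> r \<phi> \<longleftrightarrow>
     continuous_map (Metric_space.mtopology X \<rho>) euclideanreal \<phi> \<and>
     (\<exists>C\<ge>0. \<forall>n. \<forall>a\<in>X. \<forall>b\<in>bowen_ball X \<rho> n a \<eta>. \<forall>c\<in>bowen_ball X \<rho> n a \<eta>.
        \<bar>\<phi> b - \<phi> c\<bar> \<le> C * r ^ n)"

definition BV ::
    "(nat \<Rightarrow> int) set \<Rightarrow> ((nat \<Rightarrow> int) \<Rightarrow> (nat \<Rightarrow> int) \<Rightarrow> real) \<Rightarrow> real \<Rightarrow> real
      \<Rightarrow> ((nat \<Rightarrow> int) \<Rightarrow> real) set" where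
  "BV X \<rho> \<delta> r = {\<phi>. weakly_Hoelder X \<rho> \<delta> r \<phi>}"

definition birkhoff_sum :: "((nat \<Rightarrow> int) \<Rightarrow> real) \<Rightarrow> nat \<Rightarrow> (nat \<Rightarrow> int) \<Rightarrow> real" where
  "birkhoff_sum \<phi> n a = (\<Sum>k<n. \<phi> ((shift ^^ k) a))"

definition partition_sum :: "((nat \<Rightarrow> int) \<Rightarrow> real) \<Rightarrow> nat \<Rightarrow> nat \<Rightarrow> (nat \<Rightarrow> int) \<Rightarrow> real" where
  "partition_sum \<phi> N n a =
     (\<Sum>c | length c = n \<and> c \<frown> a \<in> full_shift N. exp (birkhoff_sum \<phi> n (c \<frown> a)))"

text \<open>The pressure on a full shift is the common value of the limits for all base points \<open>a\<close>.\<close>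

definition top_pressure :: "((nat \<Rightarrow> int) \<Rightarrow> real) \<Rightarrow> nat \<Rightarrow> real" where
  "top_pressure \<phi> N =
     (THE p. \<forall>a\<in>full_shift N. (\<lambda>n. ln (partition_sum \<phi> N n a) / real n) \<longlonglongrightarrow> p)"

text \<open>
  This supremum is a real one. It is only used for potentials with
  \<open>(\<Sum>k. exp (sup \<phi> on [k])) < \<infinity>\<close>, and the logarithm of that sum is an upper bound.
\<close>

definition pressure :: "((nat \<Rightarrow> int) \<Rightarrow> real) \<Rightarrow> real" where
  "pressure \<phi> = (SUP N\<in>{1..}. top_pressure \<phi> N)"

subsection \<open>Summability\<close>

definition cylinder :: "(nat \<Rightarrow> int) set \<Rightarrow> int \<Rightarrow> (nat \<Rightarrow> int) set" where
  "cylinder X k = {b \<in> X. b 0 = k}"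

definition cylinder_outside ::
    "(nat \<Rightarrow> int) set \<Rightarrow> ((nat \<Rightarrow> int) \<Rightarrow> (nat \<Rightarrow> int) \<Rightarrow> real) \<Rightarrow> int \<Rightarrow> real \<Rightarrow> (nat \<Rightarrow> int) set" where
  "cylinder_outside X \<rho> k R = {a \<in> cylinder X k. \<rho> zero_seq a > R}"

primrec exp_ereal :: "ereal \<Rightarrow> ennreal" where
  "exp_ereal (ereal x) = ennreal (exp x)"
| "exp_ereal PInfty = \<infinity>"
| "exp_ereal MInfty = 0"

text \<open>
  \<open>e\<close> to the supremum of \<open>\<phi>\<close> on \<open>A\<close>, the supremum being taken in the extended reals:
  \<open>0\<close> if \<open>A\<close> is empty and \<open>\<infinity>\<close> if \<open>\<phi>\<close> is unbounded above on \<open>A\<close>.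
\<close>

definition exp_sup :: "((nat \<Rightarrow> int) \<Rightarrow> real) \<Rightarrow> (nat \<Rightarrow> int) set \<Rightarrow> ennreal" where
  "exp_sup \<phi> A = exp_ereal (SUP a\<in>A. ereal (\<phi> a))"

subsection \<open>The completion\<close>

text \<open>
  The completion is realized, up to isometry, as the closure of an isometric image
  \<open>\<iota> ` X\<close> in a complete metric space; \<open>X\<close> is identified with \<open>\<iota> ` X\<close>.
\<close>

definition completion_of ::
    "(nat \<Rightarrow> int) set \<Rightarrow> ((nat \<Rightarrow> int) \<Rightarrow> (nat \<Rightarrow> int) \<Rightarrow> real)
      \<Rightarrow> ((nat \<Rightarrow> int) \<Rightarrow> 'c::complete_space) \<Rightarrow> 'c set \<Rightarrow> bool" where
  "completion_of X \<rho> \<iota> Xc \<longleftrightarrow>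
     (\<forall>a\<in>X. \<forall>b\<in>X. dist (\<iota> a) (\<iota> b) = \<rho> a b) \<and> Xc = closure (\<iota> ` X)"

text \<open>Such a realization always exists, by the Kuratowski embedding.\<close>

lemma completion_exists:
  assumes "Metric_space X \<rho>"
  shows "\<exists>(\<iota> :: (nat \<Rightarrow> int) \<Rightarrow> ((nat \<Rightarrow> int) discrete \<Rightarrow>\<^sub>C real)) Xc. completion_of X \<rho> \<iota> Xc"
proof (cases "X = {}")
  case True
  then show ?thesis by (auto simp: completion_of_def)
next
  case False
  interpret Metric_space X \<rho> by fact
  obtain z where z: "z \<in> X" using False by blast
  define f where "f a = (\<lambda>x. let y = of_discrete x in if a \<in> X \<and> y \<in> X then \<rho> a y - \<rho> z y else 0)" for a
  have f: "f a \<in> bcontfun" for a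
  proof (rule bcontfun_normI[where b = "\<rho> a z"])
    show "continuous_on UNIV (f a)"
      by (auto simp: continuous_on_open_vimage open_discrete)
    show "norm (f a x) \<le> \<rho> a z" for x
      using z triangle[of a z "of_discrete x"] triangle[of z a "of_discrete x"]
      by (auto simp: f_def Let_def commute)
  qed
  have "dist (Bcontfun (f a)) (Bcontfun (f b)) = \<rho> a b" if ab: "a \<in> X" "b \<in> X" for a b
  proof (rule antisym)
    show "dist (Bcontfun (f a)) (Bcontfun (f b)) \<le> \<rho> a b"
    proof (rule dist_bound)
      show "dist (Bcontfun (f a) x) (Bcontfun (f b) x) \<le> \<rho> a b" for x
        using ab triangle[of a b "of_discrete x"] triangle[of b a "of_discrete x"]
        unfolding Bcontfun_inverse[OF f] dist_real_def by (auto simp: f_def Let_def commute)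
    qed
    have "\<rho> b b = 0" using ab zero by blast
    then have "\<rho> a b = dist (Bcontfun (f a) (discrete b)) (Bcontfun (f b) (discrete b))"
      using ab unfolding Bcontfun_inverse[OF f] dist_real_def by (simp add: f_def discrete_inverse)
    also have "\<dots> \<le> dist (Bcontfun (f a)) (Bcontfun (f b))"
      by (rule dist_bounded)
    finally show "\<rho> a b \<le> dist (Bcontfun (f a)) (Bcontfun (f b))" .
  qed
  then have "completion_of X \<rho> (\<lambda>a. Bcontfun (f a)) (closure ((\<lambda>a. Bcontfun (f a)) ` X))"
    by (simp add: completion_of_def)
  then show ?thesis by blast
qed

definition omega_limit_set :: "('c::topological_space \<Rightarrow> 'c) \<Rightarrow> 'c \<Rightarrow> 'c set" where
  "omega_limit_set T x = (\<Inter>n. closure {(T ^^ k) x |k. k \<ge> n})"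

text \<open>
  As \<open>X\<close> is an arbitrary completely invariant set of sequences, the radial set need not be Borel.
  Its mass with respect to a Borel measure \<open>\<nu>\<close> is to be read as its mass with respect to
  \<open>completion \<nu>\<close>, which agrees with \<open>\<nu>\<close> on Borel sets.
\<close>

definition radial_set ::
    "(nat \<Rightarrow> int) set \<Rightarrow> ((nat \<Rightarrow> int) \<Rightarrow> 'c::complete_space) \<Rightarrow> 'c set \<Rightarrow> ('c \<Rightarrow> 'c) \<Rightarrow> 'c set" where
  "radial_set X \<iota> Xc T = {x \<in> Xc. omega_limit_set T x \<inter> \<iota> ` X \<noteq> {}}"

definition conformal_measure :: "'c measure \<Rightarrow> ('c \<Rightarrow> 'c) \<Rightarrow> ('c \<Rightarrow> real) \<Rightarrow> bool" where
  "conformal_measure m T g \<longleftrightarrow>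
     (\<forall>A\<in>sets m. T ` A \<in> sets m \<and> inj_on T A \<longrightarrow>
        emeasure m (T ` A) = (\<integral>\<^sup>+x\<in>A. ennreal (g x) \<partial>m))"

end

theory Submission
  imports Defs "HOL-Probability.Helly_Selection" "HOL-Probability.Probability_Mass_Function"
begin

text \<open>
  On each full shift \<open>full_shift N\<close>, compactness and bounded distortion make the partition
  sums almost multiplicative, so Cesaro averages of the iterates of the dual transfer operator give
  finitely supported measures that are almost eigenmeasures for the eigenvalue
  \<open>exp (top_pressure \<phi> N)\<close>. By (iv) these are uniformly tight on the completion, and since the
  inverse branches of the shift extend to the completion, a weak limit is an eigenmeasure \<open>\<nu>\<close> of the
  full dual transfer operator for the eigenvalue \<open>exp (pressure \<phi>)\<close>.

  The connection property bounds the normalised iterates of the transfer operator, so that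
  \<open>\<nu>\<close>-almost every orbit visits some ball with positive upper frequency. A density argument then
  yields an accumulation point of the orbit that itself visits this ball infinitely often; by (iii)
  it lies in \<open>X\<close>, so \<open>\<nu>\<close>-almost every point is radial. Radial points have no preimages
  outside \<open>X\<close>, on which the branches are disjoint, and the eigenmeasure equation becomes conformality.
\<close>

text \<open>Three obstacles shape the argument. In the completion the closures of different
  cylinders may meet, so the first letter does not extend, and a point outside \<open>X\<close> may
  lie on several branches or on none. The operator therefore sums over branches, which do extend,
  and multiplicities are removed only almost everywhere, at the very end. Secondly, the eigenmeasure
  is not known to be invariant, so Poincare recurrence is not at hand; its substitute is a bound for
  the mass of points that are far away at time \<open>n\<close>, by a constant times the mass of
  points that are far away at time 0, the constant being independent of \<open>n\<close>. Thirdly,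
  infinitely many visits to a compact ball of the completion would only give an accumulation point
  there, which may lie outside \<open>X\<close>. Positive upper frequency is stronger: it provides
  ever longer windows in which the visits are dense, and a limit of the starting points of such
  windows cannot escape.\<close>

section \<open>Coding points by reals and almost surely convergent representations\<close>

definition ternary :: "(nat \<Rightarrow> bool) \<Rightarrow> real" where
  "ternary \<beta> = (\<Sum>m. of_bool (\<beta> m) * (1/3) ^ m)"

lemma summable_ternary: "summable (\<lambda>m. of_bool (\<beta> m) * (1/3::real) ^ m)"
  by (rule summable_comparison_test'[where g = "\<lambda>m. (1/3::real)^m" and N = 0]) auto

text \<open>At the first place \<open>k\<close> where the digits differ they contribute a difference
  of \<open>(1/3) ^ k\<close>, while all later digits together contribute at most half of that. Base
  3 with digits 0 and 1 leaves this gap; in base 2 the tail could cancel a digit. Each digit is thus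
  a locally constant function of the code.\<close>

lemma ternary_close_imp_eq:
  assumes "\<bar>ternary \<beta> - ternary \<gamma>\<bar> < (1/3) ^ m / 2"
  shows "\<beta> m = \<gamma> m"
proof (rule ccontr)
  assume neq: "\<beta> m \<noteq> \<gamma> m"
  define k where "k = (LEAST k. \<beta> k \<noteq> \<gamma> k)"
  have k: "\<beta> k \<noteq> \<gamma> k" "k \<le> m"
    unfolding k_def using LeastI[of "\<lambda>k. \<beta> k \<noteq> \<gamma> k", OF neq] Least_le[of "\<lambda>k. \<beta> k \<noteq> \<gamma> k", OF neq]
    by blast+
  have below: "\<beta> i = \<gamma> i" if "i < k" for i
    using not_less_Least[of i "\<lambda>k. \<beta> k \<noteq> \<gamma> k"] that unfolding k_def by blast
  define d where "d i = (of_bool (\<beta> i) - of_bool (\<gamma> i)) * (1/3::real) ^ i" for i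
  have d_le: "\<bar>d i\<bar> \<le> (1/3) ^ i" for i by (auto simp: d_def of_bool_def)
  have sd: "summable d"
    unfolding d_def left_diff_distrib by (intro summable_diff summable_ternary)
  have "ternary \<beta> - ternary \<gamma> = suminf d"
    unfolding ternary_def d_def left_diff_distrib by (intro suminf_diff summable_ternary)
  also have "\<dots> = (\<Sum>i. d (i + Suc k)) + sum d {..<Suc k}"
    by (rule suminf_split_initial_segment[OF sd])
  also have "sum d {..<Suc k} = d k"
    using below by (auto simp: d_def)
  finally have eq: "ternary \<beta> - ternary \<gamma> = (\<Sum>i. d (i + Suc k)) + d k" .
  have sg: "(\<lambda>i. (1/3::real) ^ i * (1/3) ^ Suc k) sums (1 / (1 - 1/3) * (1/3) ^ Suc k)"
    by (intro sums_mult2 geometric_sums) auto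
  have geo: "(\<lambda>i. (1/3::real) ^ (i + Suc k)) sums ((1/3) ^ k / 2)"
    using sg by (simp add: power_add)
  have "\<bar>\<Sum>i. d (i + Suc k)\<bar> \<le> (\<Sum>i. (1/3::real) ^ (i + Suc k))"
    using norm_suminf_le[of "\<lambda>i. d (i + Suc k)" "\<lambda>i. (1/3::real) ^ (i + Suc k)"]
      d_le[of "_ + Suc k"] sums_summable[OF geo] by (simp del: power_Suc add_Suc_right)
  then have "\<bar>\<Sum>i. d (i + Suc k)\<bar> \<le> (1/3) ^ k / 2"
    using geo by (simp add: sums_iff)
  moreover have "\<bar>d k\<bar> = (1/3) ^ k" using k(1) by (cases "\<beta> k"; cases "\<gamma> k") (auto simp: d_def)
  ultimately have "\<bar>ternary \<beta> - ternary \<gamma>\<bar> \<ge> (1/3) ^ k / 2" unfolding eq by linarith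
  moreover have "(1/3::real) ^ k \<ge> (1/3) ^ m" using k(2) by (intro power_decreasing) auto
  ultimately show False using assms by linarith
qed

lemma ternary_bounds: "0 \<le> ternary \<beta>" "ternary \<beta> \<le> 3/2"
proof -
  show "0 \<le> ternary \<beta>" unfolding ternary_def by (intro suminf_nonneg summable_ternary) auto
  have "ternary \<beta> \<le> (\<Sum>m. (1/3::real)^m)"
    unfolding ternary_def by (intro suminf_le summable_ternary) auto
  then show "ternary \<beta> \<le> 3/2" by (simp add: suminf_geometric)
qed

text \<open>Continuity from above along the tail unions: infinitely many hits in row
  \<open>k\<close> are at least as likely as the infimum of that row. It is used for visits to large
  compact sets, and again with rows constant in \<open>n\<close>, where it turns probabilities
  arbitrarily close to 1 into an almost sure existence statement.\<close>

lemma (in prob_space) AE_infinitely_often: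
  fixes A :: "nat \<Rightarrow> nat \<Rightarrow> 'a set"
  assumes A: "\<And>k n. A k n \<in> events"
    and *: "\<And>e. e > 0 \<Longrightarrow> \<exists>k. \<forall>n. prob (A k n) \<ge> 1 - e"
  shows "AE \<omega> in M. \<exists>k. \<exists>\<^sub>\<infinity>n. \<omega> \<in> A k n"
proof -
  define E where "E k = (\<Inter>m. \<Union>n\<in>{m..}. A k n)" for k
  have E: "E k \<in> events" for k unfolding E_def using A by auto
  have pE: "prob (E k) \<ge> 1 - e" if "\<forall>n. prob (A k n) \<ge> 1 - e" for k e
  proof -
    have "(\<lambda>m. prob (\<Union>n\<in>{m..}. A k n)) \<longlonglongrightarrow> prob (E k)"
      unfolding E_def
    proof (rule finite_Lim_measure_decseq)
      show "range (\<lambda>m. \<Union>n\<in>{m..}. A k n) \<subseteq> events" using A by auto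
      show "decseq (\<lambda>m. \<Union>n\<in>{m..}. A k n)" by (auto simp: decseq_def; force)
    qed
    moreover have "prob (\<Union>n\<in>{m..}. A k n) \<ge> 1 - e" for m
    proof -
      have "prob (A k m) \<le> prob (\<Union>n\<in>{m..}. A k n)" using A by (intro finite_measure_mono) auto
      then show ?thesis using that order_trans by blast
    qed
    ultimately show ?thesis by (intro LIMSEQ_le_const) auto
  qed
  have "prob (\<Union>k. E k) \<ge> 1 - e" if e: "e > 0" for e
  proof -
    obtain k where "\<forall>n. prob (A k n) \<ge> 1 - e" using *[OF e] by blast
    then have "1 - e \<le> prob (E k)" by (rule pE)
    also have "\<dots> \<le> prob (\<Union>k. E k)" using E by (intro finite_measure_mono) auto
    finally show ?thesis .
  qed
  then have "prob (\<Union>k. E k) \<ge> 1" by (metis add.commute diff_le_eq field_le_epsilon)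
  then have "prob (\<Union>k. E k) = 1" by (simp add: antisym)
  then have "AE \<omega> in M. \<omega> \<in> (\<Union>k. E k)" using E by (subst AE_in_set_eq_1) auto
  then show ?thesis
    by eventually_elim (fastforce simp: E_def INFM_nat_le)
qed

text \<open>
  Membership in a countable family of balls encodes points as reals in such a way that convergence
  of the codes fixes, in the limit, the balls containing the points; the real line versions of Helly
  and Skorohod then apply, and tightness supplies the missing accumulation point.
\<close>

theorem tight_pmf_imp_convergent_representation:
  fixes p :: "nat \<Rightarrow> 'c::complete_space pmf"
  assumes tight: "\<And>e. e > 0 \<Longrightarrow> \<exists>K. compact K \<and> (\<forall>n. measure (p n) K \<ge> 1 - e)"
  obtains s and \<Omega> :: "real measure" and Y Z
  where "strict_mono (s :: nat \<Rightarrow> nat)" "prob_space \<Omega>"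
    "\<And>n. Y n \<in> measurable \<Omega> (count_space UNIV)"
    "\<And>n. distr \<Omega> (count_space UNIV) (Y n) = measure_pmf (p (s n))"
    "Z \<in> borel_measurable \<Omega>" "AE \<omega> in \<Omega>. (\<lambda>n. Y n \<omega>) \<longlonglongrightarrow> Z \<omega>"
proof -
  \<comment> \<open>Only the countably many atoms are coded. Every subset of a countable set of
    reals is Borel, so the decoding map is measurable into the discrete sigma-algebra without any
    continuity of \<open>h\<close>.\<close>
  define Q where "Q = (\<Union>n. set_pmf (p n))"
  have Q: "countable Q" "Q \<noteq> {}" by (auto simp: Q_def set_pmf_not_empty)
  define d where "d = from_nat_into Q"
  have d: "range d = Q" using Q by (simp add: d_def range_from_nat_into)
  define \<beta> where "\<beta> q m = (case prod_decode m of (i, j) \<Rightarrow> dist q (d i) < inverse (real (Suc j)))" for q m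
  have \<beta>: "\<beta> q (prod_encode (i, j)) = (dist q (d i) < inverse (real (Suc j)))" for q i j
    by (simp add: \<beta>_def)
  define h where "h q = ternary (\<beta> q)" for q
  have inj: "inj_on h Q"
  proof (rule inj_onI, rule ccontr)
    fix q q' assume q: "q \<in> Q" "q' \<in> Q" "h q = h q'" "q \<noteq> q'"
    obtain i where i: "q = d i" using q(1) d by auto
    obtain j where j: "inverse (real (Suc j)) < dist q q'"
      using reals_Archimedean q(4) zero_less_dist_iff by metis
    have "\<beta> q (prod_encode (i,j)) = \<beta> q' (prod_encode (i,j))"
      using q(3) by (intro ternary_close_imp_eq) (auto simp: h_def)
    then show False using i j by (simp add: \<beta> dist_commute del: of_nat_Suc)
  qed
  have hQ: "A \<in> sets borel" if "A \<subseteq> h ` Q" for A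
    using countable_subset[OF that countable_image[OF Q(1)]] by (rule sets.countable[rotated]) auto
  define \<mu> where "\<mu> n = distr (measure_pmf (p n)) borel h" for n
  have \<mu>: "real_distribution (\<mu> n)" for n
    unfolding \<mu>_def by (rule prob_space.real_distribution_distr) (auto intro: measure_pmf.prob_space_axioms)
  have "tight \<mu>"
    unfolding tight_def
  proof (intro conjI allI impI \<mu>)
    fix e :: real assume "e > 0"
    have "measure (\<mu> n) {-1<..2} = 1" for n
    proof -
      have range: "-1 < h q \<and> h q \<le> 2" for q
        using ternary_bounds[of "\<beta> q"] by (simp add: h_def)
      have "h -` {-1<..2} = UNIV"
        by (rule set_eqI) (use range in simp)
      then show ?thesis
        unfolding \<mu>_def by (subst measure_distr) auto
    qed
    then show "\<exists>a b. a < b \<and> (\<forall>n. 1 - e < measure (\<mu> n) {a<..b})"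
      using \<open>e > 0\<close> by (intro exI[of _ "-1"] exI[of _ 2]) auto
  qed
  from tight_imp_convergent_subsubsequence[OF this strict_mono_id]
  obtain s M where s: "strict_mono s" and M: "real_distribution M" "weak_conv_m (\<mu> \<circ> s) M"
    by (auto simp: comp_def)
  have "\<And>n. real_distribution ((\<mu> \<circ> s) n)" using \<mu> by simp
  from Skorohod[OF this M] obtain \<Omega> V U where \<Omega>: "prob_space (\<Omega>::real measure)"
    and V: "\<And>n. V n \<in> borel_measurable \<Omega>" "\<And>n. distr \<Omega> borel (V n) = \<mu> (s n)"
    and U: "\<And>\<omega>. \<omega> \<in> space \<Omega> \<Longrightarrow> (\<lambda>n. V n \<omega>) \<longlonglongrightarrow> U \<omega>"
    unfolding comp_def by metis
  interpret prob_space \<Omega> by fact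
  \<comment> \<open>Decoding; the value \<open>d 0\<close> off the codes is taken on a null set
    only, by \<open>AE_V\<close>.\<close>
  define k where "k y = (if y \<in> h ` Q then inv_into Q h y else d 0)" for y
  have k: "k \<in> borel \<rightarrow>\<^sub>M count_space UNIV"
  proof (rule measurableI)
    fix A :: "'c set"
    have "k y \<in> A \<longleftrightarrow> (if y \<in> h ` Q then inv_into Q h y \<in> A else d 0 \<in> A)" for y
      unfolding k_def by presburger
    then have eq: "k -` A \<inter> space borel = (h ` Q \<inter> k -` A) \<union> (if d 0 \<in> A then - (h ` Q) else {})"
      unfolding set_eq_iff by simp
    show "k -` A \<inter> space borel \<in> sets borel"
      unfolding eq using borel_comp[OF hQ[OF order_refl]] hQ[of "h ` Q \<inter> k -` A"] by auto
  qed simp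
  have kh: "k (h q) = q" if "q \<in> Q" for q using that inj by (simp add: k_def)
  define Y where "Y n = k \<circ> V n" for n
  have Ym: "Y n \<in> measurable \<Omega> (count_space UNIV)" for n
    unfolding Y_def by (rule measurable_comp[OF V(1) k])
  have Yd: "distr \<Omega> (count_space UNIV) (Y n) = measure_pmf (p (s n))" for n
  proof -
    have "distr \<Omega> (count_space UNIV) (Y n) = distr (distr \<Omega> borel (V n)) (count_space UNIV) k"
      unfolding Y_def by (rule distr_distr[symmetric, OF k V(1)])
    also have "\<dots> = distr (measure_pmf (p (s n))) (count_space UNIV) (k \<circ> h)"
      unfolding V(2) \<mu>_def by (rule distr_distr[OF k]) auto
    also have "\<dots> = distr (measure_pmf (p (s n))) (count_space UNIV) (\<lambda>x. x)"
      by (rule distr_cong_AE) (auto simp: AE_measure_pmf_iff Q_def intro!: kh)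
    also have "\<dots> = measure_pmf (p (s n))"
      by (rule distr_id2) simp
    finally show ?thesis .
  qed
  have AE_V: "AE \<omega> in \<Omega>. \<forall>n. V n \<omega> \<in> h ` Q"
    unfolding AE_all_countable
  proof
    fix n
    have "AE y in distr \<Omega> borel (V n). y \<in> h ` Q"
      unfolding V(2) \<mu>_def using hQ[OF order_refl]
      by (subst AE_distr_iff) (auto simp: AE_measure_pmf_iff Q_def)
    then show "AE \<omega> in \<Omega>. V n \<omega> \<in> h ` Q"
      by (subst (asm) AE_distr_iff) (use V(1) hQ[OF order_refl] in auto)
  qed
  obtain K where K: "\<And>i. compact (K i)" "\<And>i n. measure (p n) (K i) \<ge> 1 - inverse (real (Suc i))"
    using tight[of "inverse (real (Suc _))"] by (metis inverse_positive_iff_positive of_nat_0_less_iff zero_less_Suc)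
  have "AE \<omega> in \<Omega>. \<exists>i. \<exists>\<^sub>\<infinity>n. \<omega> \<in> Y n -` K i \<inter> space \<Omega>"
  proof (rule AE_infinitely_often)
    show "Y n -` K i \<inter> space \<Omega> \<in> events" for i n by (rule measurable_sets[OF Ym]) simp
    fix e :: real assume "e > 0"
    then obtain i where i: "inverse (real (Suc i)) < e" using reals_Archimedean by blast
    have "prob (Y n -` K i \<inter> space \<Omega>) = measure (p (s n)) (K i)" for n
      using measure_distr[OF Ym, of "K i" n] Yd[of n] by simp
    moreover have "1 - inverse (real (Suc i)) \<le> measure (p (s n)) (K i)" for n
      by (rule K(2))
    ultimately have "1 - e \<le> prob (Y n -` K i \<inter> space \<Omega>)" for n
      using i by (smt (verit))
    then show "\<exists>i. \<forall>n. 1 - e \<le> prob (Y n -` K i \<inter> space \<Omega>)"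
      by blast
  qed
  with AE_V AE_space have conv: "AE \<omega> in \<Omega>. \<exists>z. (\<lambda>n. Y n \<omega>) \<longlonglongrightarrow> z"
  proof eventually_elim
    case (elim \<omega>)
    then obtain i where i: "\<exists>\<^sub>\<infinity>n. Y n \<omega> \<in> K i" by (auto elim: INFM_mono)
    have YQ: "Y n \<omega> \<in> Q" and hY: "h (Y n \<omega>) = V n \<omega>" for n
      using elim(1) by (simp_all add: Y_def k_def inv_into_into f_inv_into_f)
    define t where "t = enumerate {n. Y n \<omega> \<in> K i}"
    have inf: "infinite {n. Y n \<omega> \<in> K i}" using i by (simp add: INFM_iff_infinite)
    have t: "strict_mono t" "\<And>n. Y (t n) \<omega> \<in> K i"
      using strict_mono_enumerate[OF inf] enumerate_in_set[OF inf] by (auto simp: t_def)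
    obtain z u where zu: "strict_mono u" "((\<lambda>n. Y (t n) \<omega>) \<circ> u) \<longlonglongrightarrow> z"
      using seq_compactE[OF compact_imp_seq_compact[OF K(1)[of i]], of "\<lambda>n. Y (t n) \<omega>"] t(2) by blast
    then have sub: "(\<lambda>n. Y (t (u n)) \<omega>) \<longlonglongrightarrow> z" "strict_mono (\<lambda>n. t (u n))"
      using t(1) by (auto simp: comp_def strict_mono_def)
    have "(\<lambda>n. Y n \<omega>) \<longlonglongrightarrow> z"
    proof (rule tendstoI)
      fix e :: real assume "e > 0"
      then obtain j where j: "inverse (real (Suc j)) < e / 2" using reals_Archimedean[of "e/2"] by auto
      have j0: "inverse (real (Suc j)) > 0" by simp
      then obtain n0 where "dist (Y (t (u n0)) \<omega>) z < inverse (real (Suc j))"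
        using eventually_happens'[OF sequentially_bot tendstoD[OF sub(1) j0]] by blast
      moreover obtain l where "Y (t (u n0)) \<omega> = d l" using YQ[of "t (u n0)"] unfolding d[symmetric] by blast
      ultimately have l: "dist z (d l) < inverse (real (Suc j))" by (simp add: dist_commute)
      define m where "m = prod_encode (l, j)"
      \<comment> \<open>The digit for the ball about \<open>d l\<close> is eventually constant along
        the whole sequence, and the subsequence converging to \<open>z\<close> shows that this
        constant is true. So all late terms lie within \<open>2 / (j + 1) < e\<close> of
        \<open>z\<close>.\<close>
      have "Cauchy (\<lambda>n. V n \<omega>)" using U elim(2) LIMSEQ_imp_Cauchy by blast
      moreover have "(1/3::real)^m / 2 > 0" by simp
      ultimately obtain n1 where n1: "\<And>n n'. n \<ge> n1 \<Longrightarrow> n' \<ge> n1 \<Longrightarrow> dist (V n \<omega>) (V n' \<omega>) < (1/3)^m / 2"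
        using metric_CauchyD by blast
      have const: "\<beta> (Y n \<omega>) m = \<beta> (Y n' \<omega>) m" if "n \<ge> n1" "n' \<ge> n1" for n n'
        by (rule ternary_close_imp_eq) (use n1[OF that] hY in \<open>auto simp: h_def dist_real_def\<close>)
      have "\<forall>\<^sub>F n in sequentially. dist (Y (t (u n)) \<omega>) (d l) < inverse (real (Suc j))"
        using tendsto_dist[OF sub(1) tendsto_const[of "d l"]] l by (rule order_tendstoD(2))
      moreover have "\<forall>\<^sub>F n in sequentially. t (u n) \<ge> n1"
        using filterlim_subseq[OF sub(2)] by (auto simp: filterlim_at_top)
      ultimately have "\<forall>\<^sub>F n in sequentially. dist (Y (t (u n)) \<omega>) (d l) < inverse (real (Suc j)) \<and> t (u n) \<ge> n1"
        by eventually_elim simp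
      from eventually_happens'[OF sequentially_bot this]
      obtain n2 where n2: "dist (Y (t (u n2)) \<omega>) (d l) < inverse (real (Suc j))" "t (u n2) \<ge> n1"
        by blast
      have near: "dist (Y n \<omega>) (d l) < inverse (real (Suc j))" if "n \<ge> n1" for n
        using const[OF that n2(2)] n2(1) by (simp add: m_def \<beta>)
      have "dist (Y n \<omega>) z < e" if "n \<ge> n1" for n
        using l j near[OF that] dist_triangle2[of "Y n \<omega>" z "d l"] by linarith
      then show "\<forall>\<^sub>F n in sequentially. dist (Y n \<omega>) z < e"
        by (rule eventually_sequentiallyI)
    qed
    then show ?case by blast
  qed
  then obtain N where N: "N \<in> null_sets \<Omega>" "{\<omega>\<in>space \<Omega>. \<not> (\<exists>z. (\<lambda>n. Y n \<omega>) \<longlonglongrightarrow> z)} \<subseteq> N"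
    by (auto simp: eventually_ae_filter)
  \<comment> \<open>Made constant on a null set that contains all points of divergence, so that the
    limit exists everywhere and is measurable.\<close>
  define Y' where "Y' n \<omega> = (if \<omega> \<in> N then d 0 else Y n \<omega>)" for n \<omega>
  define Z where "Z \<omega> = lim (\<lambda>n. Y' n \<omega>)" for \<omega>
  have lim: "(\<lambda>n. Y' n \<omega>) \<longlonglongrightarrow> Z \<omega>" if "\<omega> \<in> space \<Omega>" for \<omega>
  proof -
    have "\<exists>z. (\<lambda>n. Y' n \<omega>) \<longlonglongrightarrow> z" using N(2) that by (cases "\<omega> \<in> N") (auto simp: Y'_def)
    then show ?thesis unfolding Z_def by (auto dest: limI)
  qed
  have "Z \<in> borel_measurable \<Omega>"
  proof (rule borel_measurable_LIMSEQ_metric)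
    have "Y n \<in> borel_measurable \<Omega>" for n
      using measurable_comp[OF Ym[of n], of id borel] by simp
    then show "Y' n \<in> borel_measurable \<Omega>" for n
      unfolding Y'_def using N(1) by (intro measurable_If_set) auto
  qed (rule lim)
  moreover have "AE \<omega> in \<Omega>. (\<lambda>n. Y n \<omega>) \<longlonglongrightarrow> Z \<omega>"
    using AE_space AE_not_in[OF N(1)]
  proof eventually_elim
    case (elim \<omega>)
    then show ?case using lim[of \<omega>] by (simp add: Y'_def)
  qed
  ultimately show thesis by (rule that[OF s \<Omega> Ym Yd])
qed

section \<open>Almost additive sequences, upper density and sums over letters\<close>

text \<open>Both \<open>m * u n\<close> and \<open>n * u m\<close> are close to
  \<open>u (m * n)\<close>, which makes the quotients Cauchy; dividing the estimate for
  \<open>u (m * n)\<close> by \<open>m\<close> and letting \<open>m\<close> grow gives the second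
  claim. Unlike subadditivity alone, this bounds \<open>u n - n * p\<close> from both sides
  uniformly in \<open>n\<close>, which is what normalising the partition sums requires.\<close>

lemma almost_additive_convergent:
  fixes u :: "nat \<Rightarrow> real"
  assumes u: "\<And>m n. \<bar>u (m + n) - u m - u n\<bar> \<le> K"
  obtains p where "(\<lambda>n. u n / real n) \<longlonglongrightarrow> p" "\<And>n. \<bar>u n - real n * p\<bar> \<le> K"
proof -
  have K: "K \<ge> 0" using u[of 0 0] by linarith
  have mult: "\<bar>u (m * n) - real m * u n\<bar> \<le> (real m + 1) * K" for m n
  proof (induction m)
    case 0
    then show ?case using u[of 0 0] by simp
  next
    case (Suc m)
    then show ?case using u[of n "m * n"] by (simp add: algebra_simps)
  qed
  have near: "\<bar>u m / real m - u n / real n\<bar> \<le> 2 * K / real m + 2 * K / real n"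
    if "m > 0" "n > 0" for m n
  proof -
    have "real m * u n - real n * u m \<le> (real m + 1) * K + (real n + 1) * K"
      "real n * u m - real m * u n \<le> (real m + 1) * K + (real n + 1) * K"
      using mult[of m n] mult[of n m] by (auto simp: mult.commute abs_le_iff)
    moreover have "(real m + 1) * K + (real n + 1) * K \<le> 2 * K * real n + 2 * K * real m"
      using that K mult_left_mono[of 1 "real m" K] mult_left_mono[of 1 "real n" K]
      by (simp add: algebra_simps)
    ultimately have "\<bar>real n * u m - real m * u n\<bar> \<le> 2 * K * real n + 2 * K * real m" by linarith
    moreover have "u m / real m - u n / real n = (real n * u m - real m * u n) / (real m * real n)"
      "2 * K / real m + 2 * K / real n = (2 * K * real n + 2 * K * real m) / (real m * real n)"
      using that by (auto simp: field_simps)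
    ultimately show ?thesis using that by (simp add: divide_right_mono abs_divide)
  qed
  have "Cauchy (\<lambda>n. u n / real n)"
  proof (rule metric_CauchyI)
    fix e :: real assume "e > 0"
    then obtain N where N: "4 * K / e < real N" using reals_Archimedean2 by blast
    have "dist (u m / real m) (u n / real n) < e" if "m \<ge> Suc N" "n \<ge> Suc N" for m n
    proof -
      have "2 * K / real k < e / 2" if "k \<ge> Suc N" for k
      proof -
        have "4 * K / e < real k" using that N by linarith
        then show ?thesis using \<open>e > 0\<close> that by (simp add: field_simps)
      qed
      from this[OF that(1)] this[OF that(2)] show ?thesis
        using near[of m n] that by (auto simp: dist_real_def)
    qed
    then show "\<exists>M. \<forall>m\<ge>M. \<forall>n\<ge>M. dist (u m / real m) (u n / real n) < e" by blast
  qed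
  then obtain p where p: "(\<lambda>n. u n / real n) \<longlonglongrightarrow> p"
    using Cauchy_convergent convergent_def by blast
  moreover have "\<bar>u n - real n * p\<bar> \<le> K" for n
  proof -
    have "(\<lambda>m. \<bar>u n - real n * (u m / real m)\<bar>) \<longlonglongrightarrow> \<bar>u n - real n * p\<bar>"
      by (intro tendsto_rabs tendsto_diff tendsto_mult tendsto_const p)
    then have "(\<lambda>m. \<bar>u n - u (m * n) / real m\<bar>) \<longlonglongrightarrow> \<bar>u n - real n * p\<bar>" if "n > 0"
    proof -
      have "strict_mono (\<lambda>m. m * n)" using that by (auto simp: strict_mono_def)
      from LIMSEQ_subseq_LIMSEQ[OF p this]
      have "(\<lambda>m. \<bar>u n - real n * (u (m * n) / real (m * n))\<bar>) \<longlonglongrightarrow> \<bar>u n - real n * p\<bar>"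
        by (intro tendsto_rabs tendsto_diff tendsto_mult tendsto_const) (simp add: comp_def)
      then show ?thesis using that by simp
    qed
    moreover have "(\<lambda>m. K + K / real m) \<longlonglongrightarrow> K + 0" by (intro tendsto_add tendsto_const lim_const_over_n)
    moreover have "\<forall>m\<ge>1. \<bar>u n - u (m * n) / real m\<bar> \<le> K + K / real m"
    proof (intro allI impI)
      fix m :: nat assume "m \<ge> 1"
      then have "u n - u (m * n) / real m = (real m * u n - u (m * n)) / real m"
        "K + K / real m = ((real m + 1) * K) / real m" by (auto simp: field_simps)
      then show "\<bar>u n - u (m * n) / real m\<bar> \<le> K + K / real m"
        using mult[of m n] \<open>m \<ge> 1\<close> by (simp add: divide_right_mono abs_divide abs_minus_commute)
    qed
    ultimately have "\<bar>u n - real n * p\<bar> \<le> K + 0" if "n > 0"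
      using that by (blast intro: LIMSEQ_le)
    then show ?thesis using u[of 0 0] by (cases "n = 0") simp_all
  qed
  ultimately show thesis using that by blast
qed

text \<open>
  If the claim fails, then \<open>{J..<n}\<close> is covered greedily by blocks of length at most \<open>M\<close>, each
  meeting \<open>T\<close> in a proportion below \<open>c\<close>, up to one final block.
\<close>

lemma positive_frequency_imp_dense_windows:
  fixes T :: "nat set" and c :: real
  assumes c: "0 < c" and freq: "\<exists>\<^sub>\<infinity>n. real (card (T \<inter> {..<n})) > 2 * c * real n"
  shows "\<exists>j\<ge>J. j \<in> T \<and> (\<forall>L. 1 \<le> L \<longrightarrow> L \<le> M \<longrightarrow> real (card (T \<inter> {j..<j + L})) \<ge> c * real L)"
proof (rule ccontr)
  assume neg: "\<not> ?thesis"
  have *: "\<exists>L. 1 \<le> L \<and> L \<le> M \<and> real (card (T \<inter> {j..<j + L})) < c * real L"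
    if "j \<ge> J" "j \<in> T" for j
  proof (rule ccontr)
    assume "\<not> ?thesis"
    then have "\<forall>L. 1 \<le> L \<longrightarrow> L \<le> M \<longrightarrow> c * real L \<le> real (card (T \<inter> {j..<j + L}))"
      by (simp add: not_less)
    then show False using that neg by blast
  qed
  have bound: "real (card (T \<inter> {j..<n})) \<le> c * real (n - j) + real M" if "j \<ge> J" for j n
    using that
  proof (induction "n - j" arbitrary: j rule: less_induct)
    case less
    show ?case
    proof (cases "j < n")
      case False
      then show ?thesis using c by simp
    next
      case jn: True
      \<comment> \<open>The next block: a sparse one if it starts in \<open>T\<close>, otherwise the
        single point \<open>j\<close>, which does not meet \<open>T\<close>.\<close>
      define L where "L = (if j \<in> T then (SOME L. 1 \<le> L \<and> L \<le> M \<and> real (card (T \<inter> {j..<j + L})) < c * real L) else 1)"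
      have L: "1 \<le> L" "real (card (T \<inter> {j..<j + L})) \<le> c * real L" "L \<le> max 1 M"
        using someI_ex[OF *[OF less.prems]] c by (auto simp: L_def)
      have LM: "L \<le> M" if "j \<in> T"
        using someI_ex[OF *[OF less.prems that]] that by (auto simp: L_def)
      show ?thesis
      proof (cases "j + L \<le> n")
        case True
        have "T \<inter> {j..<n} = (T \<inter> {j..<j+L}) \<union> (T \<inter> {j+L..<n})" using True by auto
        then have "card (T \<inter> {j..<n}) \<le> card (T \<inter> {j..<j+L}) + card (T \<inter> {j+L..<n})"
          by (metis card_Un_le)
        moreover have "real (card (T \<inter> {j+L..<n})) \<le> c * real (n - (j + L)) + real M"
          using less.hyps[of "j + L"] L(1) True less.prems jn by simp
        moreover have "c * real (n - j) = c * real L + c * real (n - (j + L))"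
          using True by (simp add: algebra_simps of_nat_diff)
        ultimately show ?thesis using L(2) by linarith
      next
        case False
        \<comment> \<open>A block of length 1 cannot overrun \<open>n\<close>, so only a sparse
          block is cut off; its length is at most \<open>M\<close>, which is the additive
          error.\<close>
        then have "j \<in> T" using jn by (auto simp: L_def split: if_splits)
        have "card (T \<inter> {j..<n}) \<le> card {j..<j+L}" using False by (intro card_mono) auto
        then show ?thesis using LM[OF \<open>j \<in> T\<close>] c by (simp add: add_increasing)
      qed
    qed
  qed
  \<comment> \<open>From \<open>n0\<close> on, \<open>J + M\<close> is below \<open>c * n\<close>;
    added to the share \<open>c * n\<close> of the sparse blocks this stays below
    \<open>2 * c * n\<close>, hence the factor 2 in the hypothesis.\<close>
  obtain n0 where n0: "real (J + M) / c < real n0" using reals_Archimedean2 by blast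
  obtain n where n: "n \<ge> n0" "real (card (T \<inter> {..<n})) > 2 * c * real n"
    using freq by (auto simp: INFM_nat_le)
  have "T \<inter> {..<n} \<subseteq> {..<J} \<union> (T \<inter> {J..<n})" by auto
  then have "card (T \<inter> {..<n}) \<le> card ({..<J} \<union> (T \<inter> {J..<n}))" by (intro card_mono) auto
  also have "\<dots> \<le> J + card (T \<inter> {J..<n})" using card_Un_le[of "{..<J}"] by simp
  finally have "real (card (T \<inter> {..<n})) \<le> real J + c * real (n - J) + real M"
    using bound[of J n] by simp
  also have "c * real (n - J) \<le> c * real n" using c by simp
  also have "real (J + M) < c * real n0" using n0 c by (simp add: field_simps)
  moreover have "c * real n0 \<le> c * real n" using n(1) c by simp
  ultimately show False using n(2) by simp
qed

text \<open>Condition (iv) is stated with \<open>infsum\<close>, while the transfer operator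
  integrates over counting measure so that monotone and dominated convergence apply. Finiteness and
  smallness have to pass in this direction.\<close>

lemma nn_integral_count_space_le_infsum:
  fixes f :: "'a::countable \<Rightarrow> ennreal"
  shows "(\<integral>\<^sup>+k. f k \<partial>count_space UNIV) \<le> infsum f UNIV"
proof -
  have "(\<integral>\<^sup>+k. f k \<partial>count_space UNIV) = (\<integral>\<^sup>+k\<in>range (to_nat :: 'a \<Rightarrow> nat). f (from_nat k) \<partial>count_space UNIV)"
    by (subst nn_integral_count_compose_inj[symmetric, where g = "to_nat :: 'a \<Rightarrow> nat" and A = UNIV]) auto
  also have "\<dots> = (\<Sum>i. f (from_nat i) * indicator (range (to_nat :: 'a \<Rightarrow> nat)) i)"
    by (rule nn_integral_count_space_nat)
  also have "\<dots> \<le> infsum f UNIV"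
  proof (rule suminf_le_const[OF summableI])
    fix n
    let ?R = "range (to_nat :: 'a \<Rightarrow> nat)"
    have "(\<Sum>i<n. f (from_nat i) * indicator ?R i) = (\<Sum>i\<in>{..<n} \<inter> ?R. f (from_nat i))"
      by (simp add: indicator_def sum.inter_restrict if_distrib cong: if_cong)
    also have "\<dots> = sum f (from_nat ` ({..<n} \<inter> ?R))"
      by (subst sum.reindex) (auto intro!: inj_onI)
    also have "\<dots> \<le> infsum f UNIV"
      by (subst nonneg_infsum_complete) (auto intro!: SUP_upper)
    finally show "(\<Sum>i<n. f (from_nat i) * indicator ?R i) \<le> infsum f UNIV" .
  qed
  finally show ?thesis .
qed

lemmas exp_ereal_infinity [simp] =
  exp_ereal.simps(2)[unfolded PInfty_eq_infinity] exp_ereal.simps(3)[unfolded MInfty_eq_minfinity]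

lemma nn_integral_count_space_UNIV_ge:
  "(\<integral>\<^sup>+k. f k \<partial>count_space A) \<le> (\<integral>\<^sup>+k. f k \<partial>count_space UNIV)"
proof -
  have "(\<integral>\<^sup>+k. f k \<partial>count_space A) = (\<integral>\<^sup>+k. f k * indicator A k \<partial>count_space UNIV)"
    by (rule nn_integral_count_space_indicator) simp
  also have "\<dots> \<le> (\<integral>\<^sup>+k. f k \<partial>count_space UNIV)"
    by (intro nn_integral_mono) (auto split: split_indicator)
  finally show ?thesis .
qed

lemma exp_ereal_mono: "x \<le> y \<Longrightarrow> exp_ereal x \<le> exp_ereal y"
  by (cases x; cases y) (auto intro: ennreal_leI)

lemma exp_le_exp_sup: "a \<in> A \<Longrightarrow> ennreal (exp (\<phi> a)) \<le> exp_sup \<phi> A"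
  unfolding exp_sup_def using exp_ereal_mono[OF SUP_upper, of a A "\<lambda>a. ereal (\<phi> a)"] by simp

section \<open>Shift arithmetic and the standing setting\<close>

lemma shift_funpow: "(shift ^^ n) a = suffix n a"
  by (induction n) (auto simp: shift_def fun_eq_iff)

lemma shift_build [simp]: "shift (k ## a) = a"
  by (simp add: shift_def)

lemma build_shift: "a 0 ## shift a = a"
  using build_first[of a] by (simp add: shift_def suffix_def)

lemma full_shift_range: "a \<in> full_shift N \<longleftrightarrow> range a \<subseteq> {- int N..int N}"
  unfolding full_shift_def by blast

lemma full_shift_conc: "c \<frown> a \<in> full_shift N \<longleftrightarrow> set c \<subseteq> {- int N..int N} \<and> a \<in> full_shift N"
  unfolding full_shift_range range_conc by blast

lemma shift_full_shift: "a \<in> full_shift N \<Longrightarrow> shift a \<in> full_shift N"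
  by (auto simp: full_shift_def shift_def)

lemma zero_full_shift: "zero_seq \<in> full_shift N"
  by (auto simp: full_shift_def zero_seq_def)

locale conformal_setting = expanding_shift X \<rho> \<delta>\<^sub>0 C\<^sub>E\<^sub>S L\<^sub>E\<^sub>S
  for X \<rho> \<delta>\<^sub>0 C\<^sub>E\<^sub>S L\<^sub>E\<^sub>S +
  fixes \<delta> r :: real and \<phi> :: "(nat \<Rightarrow> int) \<Rightarrow> real"
    and \<iota> :: "(nat \<Rightarrow> int) \<Rightarrow> 'c::complete_space" and Xc :: "'c set"
    and \<sigma>c :: "'c \<Rightarrow> 'c" and \<phi>c :: "'c \<Rightarrow> real"
  assumes delta: "0 < \<delta>" "\<delta> \<le> \<delta>\<^sub>0" and r: "0 < r" "r < 1"
    and phi: "\<phi> \<in> BV X \<rho> \<delta> r"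
    and completion: "completion_of X \<rho> \<iota> Xc"
    and sigma: "\<sigma>c \<in> Xc \<rightarrow> Xc" "continuous_on Xc \<sigma>c" "\<And>a. a \<in> X \<Longrightarrow> \<sigma>c (\<iota> a) = \<iota> (shift a)"
    and proper: "\<And>R. R > 0 \<Longrightarrow> compact {b \<in> Xc. dist (\<iota> zero_seq) b \<le> R}"
    and escape: "\<And>R b. \<lbrakk>R > 0; b \<in> Xc - \<iota> ` X\<rbrakk> \<Longrightarrow>
                \<exists>N\<ge>1. \<forall>n\<ge>N. (\<sigma>c ^^ n) b \<in> Xc - {b \<in> Xc. dist (\<iota> zero_seq) b \<le> R}"
    and summ: "(\<Sum>\<^sub>\<infinity>k::int. exp_sup \<phi> (cylinder X k)) < \<infinity>"
    and tail: "((\<lambda>R. \<Sum>\<^sub>\<infinity>k::int. exp_sup \<phi> (cylinder_outside X \<rho> k R)) \<longlongrightarrow> 0) at_top"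
    and phic: "continuous_on Xc \<phi>c" "\<And>a. a \<in> X \<Longrightarrow> \<phi>c (\<iota> a) = \<phi> a"
begin

subsection \<open>Inverse branches\<close>

lemma shift_mem_X [simp]: "shift a \<in> X \<longleftrightarrow> a \<in> X"
  using shift_vimage by auto

lemma conc_mem_X [simp]: "c \<frown> a \<in> X \<longleftrightarrow> a \<in> X"
proof (induction c)
  case (Cons k c)
  have "(k # c) \<frown> a \<in> X \<longleftrightarrow> shift ((k # c) \<frown> a) \<in> X" by (rule shift_mem_X[symmetric])
  then show ?case using Cons by simp
qed simp

lemma build_mem_X [simp]: "k ## a \<in> X \<longleftrightarrow> a \<in> X"
  using conc_mem_X[of "[k]" a] by simp

lemma full_shift_subset: "N \<ge> 1 \<Longrightarrow> full_shift N \<subseteq> X"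
  using full_shift_compact by blast

lemma zero_mem_X [simp]: "zero_seq \<in> X"
  using full_shift_subset[of 1] zero_full_shift by auto

lemma suffix_mem_X [simp]: "suffix n a \<in> X \<longleftrightarrow> a \<in> X"
  by (metis conc_mem_X prefix_suffix)

lemma iota_dist: "a \<in> X \<Longrightarrow> b \<in> X \<Longrightarrow> dist (\<iota> a) (\<iota> b) = \<rho> a b"
  and Xc_eq: "Xc = closure (\<iota> ` X)"
  using completion by (auto simp: completion_of_def)

lemma iota_mem [simp]: "a \<in> X \<Longrightarrow> \<iota> a \<in> Xc"
  using closure_subset[of "\<iota> ` X"] by (auto simp: Xc_eq)

lemma closed_Xc [simp]: "closed Xc" by (simp add: Xc_eq)

lemma iota_eq_iff: "a \<in> X \<Longrightarrow> b \<in> X \<Longrightarrow> \<iota> a = \<iota> b \<longleftrightarrow> a = b"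
  using iota_dist[of a b] zero[of a b] by (metis dist_eq_0_iff)

lemma Xc_seq:
  assumes "x \<in> Xc" obtains a where "\<And>n. a n \<in> X" "(\<lambda>n. \<iota> (a n)) \<longlonglongrightarrow> x"
proof -
  obtain y where y: "\<And>n. y n \<in> \<iota> ` X" "y \<longlonglongrightarrow> x"
    using assms by (auto simp: Xc_eq closure_sequential)
  then have "\<forall>n. \<exists>a. a \<in> X \<and> y n = \<iota> a" by blast
  then obtain a where "\<And>n. a n \<in> X \<and> y n = \<iota> (a n)" by metis
  moreover from this have "y = (\<lambda>n. \<iota> (a n))" by auto
  ultimately show thesis using that[of a] y(2) by auto
qed

lemma tendsto_on_Xc:
  assumes "continuous_on Xc f" "(\<lambda>n. x n) \<longlonglongrightarrow> y" "\<And>n. x n \<in> Xc" "y \<in> Xc"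
  shows "(\<lambda>n. f (x n)) \<longlonglongrightarrow> f y"
  using assms by (intro continuous_on_tendsto_compose[of Xc f]) auto

lemma expansion_le:
  assumes "a \<in> X" "b \<in> X" "\<rho> a b < \<delta>\<^sub>0"
  shows "\<rho> (c \<frown> a) (c \<frown> b) \<le> C\<^sub>E\<^sub>S * (1 / L\<^sub>E\<^sub>S) ^ length c * \<rho> a b"
    "\<rho> (c \<frown> a) (c \<frown> b) \<le> C\<^sub>E\<^sub>S * \<rho> a b"
proof -
  show *: "\<rho> (c \<frown> a) (c \<frown> b) \<le> C\<^sub>E\<^sub>S * (1 / L\<^sub>E\<^sub>S) ^ length c * \<rho> a b"
    using expansion[OF assms, of c] by (simp add: power_int_minus field_simps)
  have "(1 / L\<^sub>E\<^sub>S) ^ length c \<le> 1" using L_ES_gt_1 by (intro power_le_one) auto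
  then have "C\<^sub>E\<^sub>S * (1 / L\<^sub>E\<^sub>S) ^ length c * \<rho> a b \<le> C\<^sub>E\<^sub>S * 1 * \<rho> a b"
    using C_ES_pos by (intro mult_right_mono mult_left_mono) auto
  then show "\<rho> (c \<frown> a) (c \<frown> b) \<le> C\<^sub>E\<^sub>S * \<rho> a b" using * by simp
qed

text \<open>By the expansion property for a word of length 1, prepending a letter is Lipschitz with
  constant \<open>C\<^sub>E\<^sub>S\<close> at distances below \<open>\<delta>\<^sub>0\<close>. This
  is uniform continuity, so the map extends to the closure; mere continuity on \<open>X\<close>
  would not do.\<close>

lemma branch_exists:
  "\<exists>g. uniformly_continuous_on Xc g \<and> (\<forall>a\<in>X. g (\<iota> a) = \<iota> (k ## a))"
proof -
  define f where "f x = \<iota> (k ## inv_into X \<iota> x)" for x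
  have inj: "inj_on \<iota> X" by (auto simp: inj_on_def iota_eq_iff)
  have f: "f (\<iota> a) = \<iota> (k ## a)" if "a \<in> X" for a
    using that inj by (simp add: f_def)
  have "uniformly_continuous_on (\<iota> ` X) f"
    unfolding uniformly_continuous_on_def
  proof (intro allI impI)
    fix e :: real assume e: "e > 0"
    define d where "d = min \<delta>\<^sub>0 (e / C\<^sub>E\<^sub>S)"
    have d: "d > 0" using e delta0_pos C_ES_pos by (simp add: d_def)
    moreover have "dist (f x') (f x) < e" if x: "x \<in> \<iota> ` X" "x' \<in> \<iota> ` X" "dist x' x < d" for x x'
    proof -
      obtain a b where ab: "a \<in> X" "b \<in> X" "x = \<iota> a" "x' = \<iota> b" using x by blast
      have "\<rho> b a < \<delta>\<^sub>0" "C\<^sub>E\<^sub>S * \<rho> b a < e"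
        using x ab iota_dist[of b a] C_ES_pos by (auto simp: d_def field_simps)
      then have "\<rho> (k ## b) (k ## a) < e"
        using expansion_le(2)[of b a "[k]"] ab by simp
      then show ?thesis using ab by (simp add: f iota_dist)
    qed
    ultimately show "\<exists>d>0. \<forall>x\<in>\<iota> ` X. \<forall>x'\<in>\<iota> ` X. dist x' x < d \<longrightarrow> dist (f x') (f x) < e" by blast
  qed
  from uniformly_continuous_on_extension_on_closure[OF this]
  obtain g where "uniformly_continuous_on (closure (\<iota> ` X)) g" "\<And>x. x \<in> \<iota> ` X \<Longrightarrow> f x = g x"
    by metis
  then show ?thesis using f by (auto simp: Xc_eq intro!: exI[of _ g])
qed

definition branch :: "int \<Rightarrow> 'c \<Rightarrow> 'c" where
  "branch k = (SOME g. uniformly_continuous_on Xc g \<and> (\<forall>a\<in>X. g (\<iota> a) = \<iota> (k ## a)))"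

lemma branch_uniformly_continuous: "uniformly_continuous_on Xc (branch k)"
  and branch_iota [simp]: "a \<in> X \<Longrightarrow> branch k (\<iota> a) = \<iota> (k ## a)"
  using someI_ex[OF branch_exists[of k]] by (auto simp: branch_def)

lemma branch_continuous: "continuous_on Xc (branch k)"
  by (rule uniformly_continuous_imp_continuous[OF branch_uniformly_continuous])

lemma branch_mem [simp]: "x \<in> Xc \<Longrightarrow> branch k x \<in> Xc"
proof -
  have "branch k ` closure (\<iota> ` X) \<subseteq> Xc"
    using branch_continuous[of k] by (intro image_closure_subset) (auto simp: Xc_eq[symmetric])
  then show "x \<in> Xc \<Longrightarrow> branch k x \<in> Xc" by (auto simp: Xc_eq[symmetric])
qed

lemma sigma_mem [simp]: "x \<in> Xc \<Longrightarrow> \<sigma>c x \<in> Xc"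
  using sigma(1) by auto

text \<open>The identity on \<open>X\<close> passes to the closure by continuity of both maps. A
  converse would need a first letter, which a point outside the image of \<open>X\<close> may
  lack.\<close>

lemma sigma_branch [simp]:
  assumes x: "x \<in> Xc" shows "\<sigma>c (branch k x) = x"
proof -
  obtain a where a: "\<And>n. a n \<in> X" "(\<lambda>n. \<iota> (a n)) \<longlonglongrightarrow> x" using Xc_seq[OF x] by blast
  have "(\<lambda>n. branch k (\<iota> (a n))) \<longlonglongrightarrow> branch k x"
    using a x by (intro tendsto_on_Xc[OF branch_continuous]) auto
  then have "(\<lambda>n. \<sigma>c (branch k (\<iota> (a n)))) \<longlonglongrightarrow> \<sigma>c (branch k x)"
    using a x by (intro tendsto_on_Xc[OF sigma(2)]) auto
  then have "(\<lambda>n. \<iota> (a n)) \<longlonglongrightarrow> \<sigma>c (branch k x)" using a by (simp add: sigma(3))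
  then show ?thesis using a(2) LIMSEQ_unique by blast
qed

lemma sigma_funpow_mem [simp]: "x \<in> Xc \<Longrightarrow> (\<sigma>c ^^ n) x \<in> Xc"
  by (induction n) auto

lemma sigma_funpow_continuous: "continuous_on Xc (\<sigma>c ^^ n)"
proof (induction n)
  case (Suc n)
  have "continuous_on Xc (\<sigma>c \<circ> (\<sigma>c ^^ n))"
    by (rule continuous_on_compose[OF Suc]) (rule continuous_on_subset[OF sigma(2)], auto)
  then show ?case by simp
qed (simp add: id_def)

lemma sigma_funpow_iota: "a \<in> X \<Longrightarrow> (\<sigma>c ^^ n) (\<iota> a) = \<iota> (suffix n a)"
proof (induction n)
  case (Suc n)
  have "shift (suffix n a) = suffix (Suc n) a" by (simp add: shift_def suffix_def)
  then show ?case using sigma(3)[of "suffix n a"] Suc by (metis funpow.simps(2) comp_apply suffix_mem_X)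
qed simp

subsection \<open>The full shifts\<close>

lemma compact_full_shift:
  assumes N: "N \<ge> 1" shows "compact (\<iota> ` full_shift N)"
  unfolding compact_eq_seq_compact_metric seq_compact_def
proof (intro allI impI)
  fix f :: "nat \<Rightarrow> 'c" assume "\<forall>n. f n \<in> \<iota> ` full_shift N"
  then have "\<forall>n. \<exists>a. a \<in> full_shift N \<and> f n = \<iota> a" by blast
  then obtain a where a: "\<And>n. a n \<in> full_shift N \<and> f n = \<iota> (a n)" by metis
  have aX: "a n \<in> X" for n using a full_shift_subset[OF N] by blast
  have "compactin mtopology (full_shift N)" using full_shift_compact[OF N] by blast
  then obtain l s where l: "l \<in> full_shift N" "strict_mono s" "limitin mtopology (a \<circ> s) l sequentially"
    unfolding compactin_sequentially using a by (metis image_subsetI)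
  have "(f \<circ> s) \<longlonglongrightarrow> \<iota> l"
  proof (rule tendstoI)
    fix e :: real assume "e > 0"
    then have "\<forall>\<^sub>F n in sequentially. (a \<circ> s) n \<in> X \<and> \<rho> ((a \<circ> s) n) l < e"
      using l(3) by (auto simp: limitin_metric)
    then show "\<forall>\<^sub>F n in sequentially. dist ((f \<circ> s) n) (\<iota> l) < e"
      by eventually_elim (use a l(1) full_shift_subset[OF N] iota_dist in auto)
  qed
  then show "\<exists>l\<in>\<iota> ` full_shift N. \<exists>s. strict_mono s \<and> (f \<circ> s) \<longlonglongrightarrow> l"
    using l by blast
qed

text \<open>
  The first-letter cylinders of a full shift are disjoint compact sets, hence relatively open;
  so \<open>\<rho>\<close> induces the product topology on it.
\<close>

lemma full_shift_coordinates:
  assumes N: "N \<ge> 1" and a: "\<And>n. a n \<in> full_shift N" "u \<in> full_shift N"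
    and lim: "(\<lambda>n. \<iota> (a n)) \<longlonglongrightarrow> \<iota> u"
  shows "\<forall>\<^sub>F n in sequentially. a n i = u i"
  using a lim
proof (induction i arbitrary: a u)
  case 0
  define W where "W = (\<Union>k\<in>{- int N..int N} - {u 0}. branch k ` \<iota> ` full_shift N)"
  have sub: "full_shift N \<subseteq> X" by (rule full_shift_subset[OF N])
  then have sub': "\<iota> ` full_shift N \<subseteq> Xc" by auto
  have "compact W" unfolding W_def
    by (intro compact_UN compact_continuous_image compact_full_shift N
        continuous_on_subset[OF branch_continuous sub']) auto
  moreover have "\<iota> u \<notin> W"
  proof
    assume "\<iota> u \<in> W"
    then obtain k b where kb: "k \<noteq> u 0" "b \<in> full_shift N" "\<iota> u = branch k (\<iota> b)" by (auto simp: W_def)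
    then have "\<iota> u = \<iota> (k ## b)" using sub by auto
    then have "u = k ## b" using kb(2) 0(2) sub by (subst (asm) iota_eq_iff) auto
    then show False using kb(1) by simp
  qed
  ultimately have "\<forall>\<^sub>F n in sequentially. \<iota> (a n) \<in> - W"
    using 0(3) by (intro topological_tendstoD) (auto simp: open_Compl compact_imp_closed)
  then show ?case
  proof eventually_elim
    case (elim n)
    show ?case
    proof (rule ccontr)
      assume "a n 0 \<noteq> u 0"
      moreover have "\<iota> (a n) = branch (a n 0) (\<iota> (shift (a n)))"
        using 0(1)[of n] sub by (subst branch_iota) (auto simp: build_shift)
      moreover have "shift (a n) \<in> full_shift N" "a n 0 \<in> {- int N..int N}"
        using 0(1)[of n] shift_full_shift by (auto simp: full_shift_def)
      ultimately have "\<iota> (a n) \<in> W" unfolding W_def by blast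
      then show False using elim by simp
    qed
  qed
next
  case (Suc i)
  have sub: "full_shift N \<subseteq> X" by (rule full_shift_subset[OF N])
  have "(\<lambda>n. \<sigma>c (\<iota> (a n))) \<longlonglongrightarrow> \<sigma>c (\<iota> u)"
    using Suc.prems sub by (intro tendsto_on_Xc[OF sigma(2)]) (auto simp: subset_iff)
  then have "(\<lambda>n. \<iota> (shift (a n))) \<longlonglongrightarrow> \<iota> (shift u)"
    using Suc.prems sub by (simp add: sigma(3) subset_iff)
  then have "\<forall>\<^sub>F n in sequentially. shift (a n) i = shift u i"
    using Suc.prems shift_full_shift by (intro Suc.IH) auto
  then show ?case by (simp add: shift_def)
qed

text \<open>A counterexample for every prefix length would, by compactness, give two limits that
  agree in all coordinates by \<open>full_shift_coordinates\<close> and yet are at least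
  \<open>e\<close> apart. The lemma supplies a prefix length that brings points of a full shift
  within the scale of the distortion estimates.\<close>

lemma full_shift_close:
  assumes N: "N \<ge> 1" and e: "e > 0"
  obtains m where "\<And>a b. a \<in> full_shift N \<Longrightarrow> b \<in> full_shift N \<Longrightarrow> (\<And>i. i < m \<Longrightarrow> a i = b i) \<Longrightarrow> \<rho> a b < e"
proof (rule ccontr)
  assume "\<not> thesis"
  then have "\<forall>m. \<exists>a b. a \<in> full_shift N \<and> b \<in> full_shift N \<and> (\<forall>i<m. a i = b i) \<and> \<not> \<rho> a b < e"
    using that by blast
  then obtain a b where ab: "\<And>m. a m \<in> full_shift N" "\<And>m. b m \<in> full_shift N"
      "\<And>m i. i < m \<Longrightarrow> a m i = b m i" "\<And>m. \<rho> (a m) (b m) \<ge> e"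
    by (metis not_less)
  have sub: "full_shift N \<subseteq> X" by (rule full_shift_subset[OF N])
  have cpt: "seq_compact (\<iota> ` full_shift N)"
    by (rule compact_imp_seq_compact[OF compact_full_shift[OF N]])
  obtain u' s where u': "u' \<in> \<iota> ` full_shift N" "strict_mono s" "((\<lambda>m. \<iota> (a m)) \<circ> s) \<longlonglongrightarrow> u'"
    using seq_compactE[OF cpt, of "\<lambda>m. \<iota> (a m)"] ab(1) by blast
  obtain v' t where v': "v' \<in> \<iota> ` full_shift N" "strict_mono t" "((\<lambda>m. \<iota> (b (s m))) \<circ> t) \<longlonglongrightarrow> v'"
    using seq_compactE[OF cpt, of "\<lambda>m. \<iota> (b (s m))"] ab(2) by blast
  obtain u v where uv: "u \<in> full_shift N" "u' = \<iota> u" "v \<in> full_shift N" "v' = \<iota> v" using u' v' by blast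
  have st: "strict_mono (\<lambda>m. s (t m))" using u'(2) v'(2) by (auto simp: strict_mono_def)
  have la: "(\<lambda>m. \<iota> (a (s (t m)))) \<longlonglongrightarrow> \<iota> u"
    using LIMSEQ_subseq_LIMSEQ[OF u'(3) v'(2)] uv by (simp add: comp_def)
  have lb: "(\<lambda>m. \<iota> (b (s (t m)))) \<longlonglongrightarrow> \<iota> v" using v'(3) uv by (simp add: comp_def)
  have "u i = v i" for i
  proof -
    have "\<forall>\<^sub>F m in sequentially. m > i" by (rule eventually_gt_at_top)
    moreover have "\<forall>\<^sub>F m in sequentially. a (s (t m)) i = u i" "\<forall>\<^sub>F m in sequentially. b (s (t m)) i = v i"
      using ab(1,2) full_shift_coordinates[OF N _ uv(1) la, of i] full_shift_coordinates[OF N _ uv(3) lb, of i]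
      by auto
    ultimately have "\<forall>\<^sub>F m in sequentially. u i = v i"
    proof eventually_elim
      case (elim m)
      then show ?case using ab(3)[of i "s (t m)"] seq_suble[OF st, of m] by simp
    qed
    then show ?thesis by simp
  qed
  then have "u = v" by blast
  have "(\<lambda>m. dist (\<iota> (a (s (t m)))) (\<iota> (b (s (t m))))) \<longlonglongrightarrow> dist (\<iota> u) (\<iota> v)"
    by (intro tendsto_dist la lb)
  moreover have "dist (\<iota> (a (s (t m)))) (\<iota> (b (s (t m)))) \<ge> e" for m
    using ab sub by (subst iota_dist) auto
  ultimately have "e \<le> dist (\<iota> u) (\<iota> v)" by (intro LIMSEQ_le_const) auto
  then show False using \<open>u = v\<close> e by simp
qed

subsection \<open>Distortion\<close>

definition \<delta>\<^sub>1 :: real where "\<delta>\<^sub>1 = min \<delta> (\<delta> / C\<^sub>E\<^sub>S)"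

lemma delta1_pos: "\<delta>\<^sub>1 > 0" using delta C_ES_pos by (simp add: \<delta>\<^sub>1_def)

text \<open>\<open>\<delta>\<^sub>1\<close> is chosen so that two points closer than this stay
  closer than \<open>\<delta>\<close> under any common prefix. Prefixing \<open>c\<close> then puts
  both into one Bowen ball of order \<open>length c - 1\<close>, the last index at which the letters
  are forced to agree, and weak Hoelder continuity applies.\<close>

lemma variation_exists:
  "\<exists>V\<ge>0. \<forall>c a b. c \<noteq> [] \<longrightarrow> a \<in> X \<longrightarrow> b \<in> X \<longrightarrow> \<rho> a b < \<delta>\<^sub>1 \<longrightarrow>
     \<bar>\<phi> (c \<frown> a) - \<phi> (c \<frown> b)\<bar> \<le> V * r ^ (length c - 1)"
proof -
  obtain V where V: "V \<ge> 0" "\<And>n a b c. a \<in> X \<Longrightarrow> b \<in> bowen_ball X \<rho> n a \<delta> \<Longrightarrow> c \<in> bowen_ball X \<rho> n a \<delta>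
       \<Longrightarrow> \<bar>\<phi> b - \<phi> c\<bar> \<le> V * r ^ n"
    using phi unfolding BV_def weakly_Hoelder_def by blast
  have "\<bar>\<phi> (c \<frown> a) - \<phi> (c \<frown> b)\<bar> \<le> V * r ^ (length c - 1)"
    if c: "c \<noteq> []" and ab: "a \<in> X" "b \<in> X" "\<rho> a b < \<delta>\<^sub>1" for c a b
  proof (rule V(2))
    have less: "\<rho> (drop j c \<frown> a) (drop j c \<frown> b) < \<delta>" for j
    proof -
      have "\<rho> a b < \<delta>\<^sub>0" "C\<^sub>E\<^sub>S * \<rho> a b < \<delta>"
        using ab(3) delta C_ES_pos by (auto simp: \<delta>\<^sub>1_def field_simps)
      then show ?thesis using expansion_le(2)[OF ab(1,2), of "drop j c"] by linarith
    qed
    have hd: "(drop j c \<frown> b) 0 = (drop j c \<frown> a) 0" if "j \<le> length c - 1" for j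
    proof -
      have "j < length c" using that c by (cases c) auto
      then show ?thesis by (simp add: conc_def)
    qed
    show "c \<frown> a \<in> X" using ab by simp
    have center: "d \<in> cyl_ball X \<rho> d \<delta>" if "d \<in> X" for d
      using that delta by (simp add: cyl_ball_def)
    show "c \<frown> a \<in> bowen_ball X \<rho> (length c - 1) (c \<frown> a) \<delta>"
      unfolding bowen_ball_def shift_funpow using ab center by simp
    have "suffix j (c \<frown> b) \<in> cyl_ball X \<rho> (suffix j (c \<frown> a)) \<delta>" if j: "j \<le> length c - 1" for j
    proof -
      have j': "j \<le> length c" using j by simp
      show ?thesis
        unfolding suffix_conc_fst[OF j'] cyl_ball_def using ab less[of j] hd[OF j] by simp
    qed
    then show "c \<frown> b \<in> bowen_ball X \<rho> (length c - 1) (c \<frown> a) \<delta>"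
      unfolding bowen_ball_def shift_funpow using ab by simp
  qed
  then show ?thesis using V(1) by blast
qed

definition V :: real where
  "V = (SOME V. V \<ge> 0 \<and> (\<forall>c a b. c \<noteq> [] \<longrightarrow> a \<in> X \<longrightarrow> b \<in> X \<longrightarrow> \<rho> a b < \<delta>\<^sub>1 \<longrightarrow>
     \<bar>\<phi> (c \<frown> a) - \<phi> (c \<frown> b)\<bar> \<le> V * r ^ (length c - 1)))"

lemma V_nonneg: "V \<ge> 0"
  and variation: "\<lbrakk>c \<noteq> []; a \<in> X; b \<in> X; \<rho> a b < \<delta>\<^sub>1\<rbrakk> \<Longrightarrow> \<bar>\<phi> (c \<frown> a) - \<phi> (c \<frown> b)\<bar> \<le> V * r ^ (length c - 1)"
  using someI_ex[OF variation_exists] unfolding V_def by blast+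

lemma foldr_branch_mem [simp]: "x \<in> Xc \<Longrightarrow> foldr branch c x \<in> Xc"
  by (induction c) auto

lemma foldr_branch_iota: "a \<in> X \<Longrightarrow> foldr branch c (\<iota> a) = \<iota> (c \<frown> a)"
  by (induction c) auto

lemma foldr_branch_continuous: "continuous_on Xc (foldr branch c)"
proof (induction c)
  case (Cons k c)
  have "continuous_on Xc (branch k \<circ> foldr branch c)"
    by (rule continuous_on_compose[OF Cons]) (rule continuous_on_subset[OF branch_continuous], auto)
  then show ?case by simp
qed (simp add: id_def)

lemma variation_completion:
  assumes c: "c \<noteq> []" and xy: "x \<in> Xc" "y \<in> Xc" "dist x y < \<delta>\<^sub>1"
  shows "\<bar>\<phi>c (foldr branch c x) - \<phi>c (foldr branch c y)\<bar> \<le> V * r ^ (length c - 1)"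
proof -
  obtain a where a: "\<And>n. a n \<in> X" "(\<lambda>n. \<iota> (a n)) \<longlonglongrightarrow> x" using Xc_seq[OF xy(1)] by blast
  obtain b where b: "\<And>n. b n \<in> X" "(\<lambda>n. \<iota> (b n)) \<longlonglongrightarrow> y" using Xc_seq[OF xy(2)] by blast
  have "(\<lambda>n. \<phi>c (foldr branch c (\<iota> (a n)))) \<longlonglongrightarrow> \<phi>c (foldr branch c x)"
    "(\<lambda>n. \<phi>c (foldr branch c (\<iota> (b n)))) \<longlonglongrightarrow> \<phi>c (foldr branch c y)"
    using a b xy
    by (auto intro!: tendsto_on_Xc[OF phic(1)] tendsto_on_Xc[OF foldr_branch_continuous])
  then have "(\<lambda>n. \<bar>\<phi>c (foldr branch c (\<iota> (a n))) - \<phi>c (foldr branch c (\<iota> (b n)))\<bar>)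
    \<longlonglongrightarrow> \<bar>\<phi>c (foldr branch c x) - \<phi>c (foldr branch c y)\<bar>"
    by (intro tendsto_rabs tendsto_diff)
  moreover have "\<forall>\<^sub>F n in sequentially. \<bar>\<phi>c (foldr branch c (\<iota> (a n))) - \<phi>c (foldr branch c (\<iota> (b n)))\<bar> \<le> V * r ^ (length c - 1)"
    using order_tendstoD(2)[OF tendsto_dist[OF a(2) b(2)] xy(3)]
  proof eventually_elim
    case (elim n)
    then have "\<rho> (a n) (b n) < \<delta>\<^sub>1" using a b by (simp add: iota_dist)
    then show ?case using variation[OF c a(1) b(1)] a b by (simp add: foldr_branch_iota phic)
  qed
  ultimately show ?thesis by (rule tendsto_upperbound) simp
qed

text \<open>Summation runs over branches rather than preimages, so a preimage on several branches
  counts with multiplicity and limits in \<open>x\<close> can be taken letter by letter. The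
  parameter \<open>A\<close> covers the operators of the full shifts (\<open>letters N\<close>) and
  the full operator (\<open>UNIV\<close>) at once.\<close>

definition transfer :: "int set \<Rightarrow> ('c \<Rightarrow> ennreal) \<Rightarrow> 'c \<Rightarrow> ennreal" where
  "transfer A f x = (\<integral>\<^sup>+k. ennreal (exp (\<phi>c (branch k x))) * f (branch k x) \<partial>count_space A)"

lemma transfer_mono: "(\<And>k. k \<in> A \<Longrightarrow> f (branch k x) \<le> g (branch k x)) \<Longrightarrow> transfer A f x \<le> transfer A g x"
  unfolding transfer_def by (intro nn_integral_mono) (auto intro: mult_left_mono)

lemma transfer_cmult: "transfer A (\<lambda>x. c * f x) x = c * transfer A f x"
  unfolding transfer_def by (subst nn_integral_cmult[symmetric]) (auto simp: ac_simps)

text \<open>Both sides expand along the same words and are compared term by term. One more iterate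
  lengthens the common word by one letter, hence \<open>c\<close> is arbitrary in the induction. The
  costs form a geometric series in \<open>r\<close>, which makes the resulting constant
  \<open>D\<close> independent of \<open>n\<close>.\<close>

lemma transfer_funpow_distortion_aux:
  assumes xy: "x \<in> Xc" "y \<in> Xc" "dist x y < \<delta>\<^sub>1"
  shows "(transfer A ^^ n) (\<lambda>_. 1) (foldr branch c x)
    \<le> ennreal (exp (V * (\<Sum>i<n. r ^ (length c + i)))) * (transfer A ^^ n) (\<lambda>_. 1) (foldr branch c y)"
proof (induction n arbitrary: c)
  case (Suc n)
  let ?T = "(transfer A ^^ n) (\<lambda>_. 1)"
  let ?E = "exp (V * (\<Sum>i<Suc n. r ^ (length c + i)))"
  have *: "ennreal (exp (\<phi>c (foldr branch (k # c) x))) * ?T (foldr branch (k # c) x)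
      \<le> ennreal ?E * (ennreal (exp (\<phi>c (foldr branch (k # c) y))) * ?T (foldr branch (k # c) y))" for k
  proof -
    let ?x = "foldr branch (k # c) x" and ?y = "foldr branch (k # c) y"
    have "\<phi>c ?x \<le> V * r ^ length c + \<phi>c ?y"
      using variation_completion[OF _ xy, of "k # c"] by simp
    then have "exp (\<phi>c ?x) \<le> exp (V * r ^ length c) * exp (\<phi>c ?y)" by (simp flip: exp_add)
    then have "ennreal (exp (\<phi>c ?x)) \<le> ennreal (exp (V * r ^ length c)) * ennreal (exp (\<phi>c ?y))"
      by (simp flip: ennreal_mult)
    then have "ennreal (exp (\<phi>c ?x)) * ?T ?x \<le> (ennreal (exp (V * r ^ length c)) * ennreal (exp (\<phi>c ?y)))
       * (ennreal (exp (V * (\<Sum>i<n. r ^ (length (k # c) + i)))) * ?T ?y)"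
      by (intro mult_mono Suc) auto
    also have "\<dots> = (ennreal (exp (V * r ^ length c)) * ennreal (exp (V * (\<Sum>i<n. r ^ (length (k # c) + i)))))
       * (ennreal (exp (\<phi>c ?y)) * ?T ?y)" by (simp only: ac_simps)
    also have "ennreal (exp (V * r ^ length c)) * ennreal (exp (V * (\<Sum>i<n. r ^ (length (k # c) + i)))) = ennreal ?E"
      by (simp add: sum.lessThan_Suc_shift distrib_left exp_add del: sum.lessThan_Suc flip: ennreal_mult)
    finally show ?thesis .
  qed
  have "(transfer A ^^ Suc n) (\<lambda>_. 1) (foldr branch c x) = transfer A ?T (foldr branch c x)" by simp
  also have "\<dots> \<le> (\<integral>\<^sup>+k. ennreal ?E * (ennreal (exp (\<phi>c (foldr branch (k # c) y))) * ?T (foldr branch (k # c) y)) \<partial>count_space A)"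
    by (subst transfer_def) (intro nn_integral_mono, use * in simp)
  also have "\<dots> = ennreal ?E * transfer A ?T (foldr branch c y)"
    by (subst transfer_def, subst nn_integral_cmult[symmetric]) auto
  finally show ?case by simp
qed simp

definition D :: real where "D = exp (V / (1 - r))"

lemma D_pos: "D > 0" by (simp add: D_def)

lemma transfer_funpow_distortion:
  assumes xy: "x \<in> Xc" "y \<in> Xc" "dist x y < \<delta>\<^sub>1"
  shows "(transfer A ^^ n) (\<lambda>_. 1) x \<le> ennreal D * (transfer A ^^ n) (\<lambda>_. 1) y"
proof -
  have "(\<Sum>i<n. r ^ i) \<le> 1 / (1 - r)"
    using r sum_gp_strict[of r n] by (simp add: divide_right_mono)
  then have "V * (\<Sum>i<n. r ^ i) \<le> V * (1 / (1 - r))" using V_nonneg by (rule mult_left_mono)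
  then have "exp (V * (\<Sum>i<n. r ^ i)) \<le> D" by (simp add: D_def)
  then have "ennreal (exp (V * (\<Sum>i<n. r ^ i))) * (transfer A ^^ n) (\<lambda>_. 1) y \<le> ennreal D * (transfer A ^^ n) (\<lambda>_. 1) y"
    by (intro mult_right_mono ennreal_leI) auto
  then show ?thesis using transfer_funpow_distortion_aux[OF xy, of n A "[]"] by (simp add: order_trans)
qed

subsection \<open>Summability and tails\<close>

text \<open>A point on branch \<open>k\<close> is a limit of points of cylinder \<open>k\<close>, so
  suprema over \<open>X\<close> control \<open>\<phi>c\<close> on the completion. In the tail
  version the strict inequality is an open condition and is therefore inherited by late
  approximants.\<close>

lemma exp_phi_branch_le:
  assumes x: "x \<in> Xc"
  shows "ennreal (exp (\<phi>c (branch k x))) \<le> exp_sup \<phi> (cylinder X k)"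
    "dist (\<iota> zero_seq) (branch k x) > R \<Longrightarrow> ennreal (exp (\<phi>c (branch k x))) \<le> exp_sup \<phi> (cylinder_outside X \<rho> k R)"
proof -
  obtain a where a: "\<And>n. a n \<in> X" "(\<lambda>n. \<iota> (a n)) \<longlonglongrightarrow> x" using Xc_seq[OF x] by blast
  have br: "(\<lambda>n. branch k (\<iota> (a n))) \<longlonglongrightarrow> branch k x"
    using a x by (intro tendsto_on_Xc[OF branch_continuous]) auto
  then have "(\<lambda>n. \<phi>c (branch k (\<iota> (a n)))) \<longlonglongrightarrow> \<phi>c (branch k x)"
    using a x by (intro tendsto_on_Xc[OF phic(1)]) auto
  then have lim: "(\<lambda>n. ennreal (exp (\<phi> (k ## a n)))) \<longlonglongrightarrow> ennreal (exp (\<phi>c (branch k x)))"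
    using a by (intro tendsto_ennrealI tendsto_exp) (simp add: phic)
  have mem: "k ## a n \<in> cylinder X k" for n using a by (simp add: cylinder_def)
  then show "ennreal (exp (\<phi>c (branch k x))) \<le> exp_sup \<phi> (cylinder X k)"
    using lim by (intro LIMSEQ_le_const2[OF lim]) (auto intro!: exp_le_exp_sup)
  assume "dist (\<iota> zero_seq) (branch k x) > R"
  then have "\<forall>\<^sub>F n in sequentially. dist (\<iota> zero_seq) (branch k (\<iota> (a n))) > R"
    using tendsto_dist[OF tendsto_const br] by (intro order_tendstoD(1))
  then have "\<forall>\<^sub>F n in sequentially. ennreal (exp (\<phi> (k ## a n))) \<le> exp_sup \<phi> (cylinder_outside X \<rho> k R)"
    by eventually_elim (use a mem in \<open>auto simp: cylinder_outside_def iota_dist intro!: exp_le_exp_sup\<close>)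
  then show "ennreal (exp (\<phi>c (branch k x))) \<le> exp_sup \<phi> (cylinder_outside X \<rho> k R)"
    using lim by (intro tendsto_upperbound[OF lim]) auto
qed

definition mass :: ennreal where "mass = (\<integral>\<^sup>+k. exp_sup \<phi> (cylinder X k) \<partial>count_space UNIV)"

definition tail_weight :: "real \<Rightarrow> ennreal" where
  "tail_weight R = (\<integral>\<^sup>+k. exp_sup \<phi> (cylinder_outside X \<rho> k R) \<partial>count_space UNIV)"

lemma mass_finite: "mass < \<infinity>"
  unfolding mass_def using nn_integral_count_space_le_infsum summ by (rule le_less_trans)

lemma tail_weight_tendsto: "(tail_weight \<longlongrightarrow> 0) at_top"
proof (rule tendsto_sandwich[OF _ _ tendsto_const tail])
  show "\<forall>\<^sub>F R in at_top. tail_weight R \<le> (\<Sum>\<^sub>\<infinity>k. exp_sup \<phi> (cylinder_outside X \<rho> k R))"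
    unfolding tail_weight_def using nn_integral_count_space_le_infsum by (intro always_eventually) blast
qed simp

lemma transfer_le_M:
  assumes x: "x \<in> Xc" and f: "\<And>k. f (branch k x) \<le> c"
  shows "transfer A f x \<le> mass * c"
proof -
  have "transfer A f x \<le> (\<integral>\<^sup>+k. exp_sup \<phi> (cylinder X k) * c \<partial>count_space A)"
    unfolding transfer_def by (intro nn_integral_mono mult_mono exp_phi_branch_le x f) auto
  also have "\<dots> \<le> (\<integral>\<^sup>+k. exp_sup \<phi> (cylinder X k) * c \<partial>count_space UNIV)"
    by (rule nn_integral_count_space_UNIV_ge)
  also have "\<dots> = mass * c" unfolding mass_def by (rule nn_integral_multc) simp
  finally show ?thesis .
qed

end

section \<open>Words, partition sums and pressure\<close>

definition words :: "'a set \<Rightarrow> nat \<Rightarrow> 'a list set" where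
  "words A n = {c. set c \<subseteq> A \<and> length c = n}"

lemma finite_words: "finite A \<Longrightarrow> finite (words A n)"
  unfolding words_def by (rule finite_lists_length_eq)

text \<open>The last letter is split off because the outermost transfer step prepends the letter
  next to the base point.\<close>

lemma sum_words_Suc:
  assumes "finite A"
  shows "(\<Sum>c\<in>words A (Suc n). g c) = (\<Sum>k\<in>A. \<Sum>c\<in>words A n. g (c @ [k]))"
proof -
  have eq: "words A (Suc n) = (\<lambda>(k, c). c @ [k]) ` (A \<times> words A n)"
  proof (intro equalityI subsetI)
    fix c assume "c \<in> words A (Suc n)"
    then show "c \<in> (\<lambda>(k, c). c @ [k]) ` (A \<times> words A n)"
      by (cases c rule: rev_cases) (auto simp: words_def image_iff)
  qed (auto simp: words_def)
  have "inj_on (\<lambda>(k, c). c @ [k]) (A \<times> words A n)" by (auto simp: inj_on_def)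
  then show ?thesis
    unfolding eq using assms by (simp add: sum.reindex sum.cartesian_product case_prod_unfold comp_def)
qed

lemma birkhoff_sum_append:
  "length c = n \<Longrightarrow> birkhoff_sum \<phi> (Suc n) ((c @ [k]) \<frown> a) = birkhoff_sum \<phi> n (c \<frown> k ## a) + \<phi> (k ## a)"
  by (auto simp: birkhoff_sum_def shift_funpow)

abbreviation letters :: "nat \<Rightarrow> int set" where "letters N \<equiv> {- int N..int N}"

lemma words_letters: "a \<in> full_shift N \<Longrightarrow> words (letters N) n = {c. length c = n \<and> c \<frown> a \<in> full_shift N}"
  by (auto simp: words_def full_shift_conc)

lemma partition_sum_words:
  "a \<in> full_shift N \<Longrightarrow> partition_sum \<phi> N n a = (\<Sum>c\<in>words (letters N) n. exp (birkhoff_sum \<phi> n (c \<frown> a)))"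
  by (simp add: partition_sum_def words_letters)

lemma partition_sum_pos: "a \<in> full_shift N \<Longrightarrow> partition_sum \<phi> N n a > 0"
proof -
  assume "a \<in> full_shift N"
  moreover have "replicate n 0 \<in> words (letters N) n" by (auto simp: words_def)
  then have "words (letters N) n \<noteq> {}" by blast
  ultimately show ?thesis
    unfolding partition_sum_words by (simp add: partition_sum_words sum_pos finite_words)
qed

lemma partition_sum_mono: "partition_sum \<phi> N n zero_seq \<le> partition_sum \<phi> (Suc N) n zero_seq"
  unfolding partition_sum_words[OF zero_full_shift]
  by (rule sum_mono2) (auto simp: finite_words, auto simp: words_def)

context conformal_setting
begin

lemma transfer_funpow_words:
  assumes A: "finite A" and a: "a \<in> X"
  shows "(transfer A ^^ n) f (\<iota> a) =
    (\<Sum>c\<in>words A n. ennreal (exp (birkhoff_sum \<phi> n (c \<frown> a))) * f (\<iota> (c \<frown> a)))"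
  using a
proof (induction n arbitrary: a)
  case 0
  have "words A 0 = {[]}" by (auto simp: words_def)
  then show ?case by (simp add: birkhoff_sum_def)
next
  case (Suc n)
  have "(transfer A ^^ Suc n) f (\<iota> a) = transfer A ((transfer A ^^ n) f) (\<iota> a)" by simp
  also have "\<dots> = (\<Sum>k\<in>A. ennreal (exp (\<phi> (k ## a))) * (transfer A ^^ n) f (\<iota> (k ## a)))"
    using A Suc.prems by (subst transfer_def) (simp add: nn_integral_count_space_finite phic)
  also have "\<dots> = (\<Sum>k\<in>A. \<Sum>c\<in>words A n. ennreal (exp (birkhoff_sum \<phi> (Suc n) ((c @ [k]) \<frown> a))) * f (\<iota> ((c @ [k]) \<frown> a)))"
  proof (intro sum.cong refl)
    fix k assume "k \<in> A"
    have "ennreal (exp (\<phi> (k ## a))) * (transfer A ^^ n) f (\<iota> (k ## a)) =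
      (\<Sum>c\<in>words A n. ennreal (exp (\<phi> (k ## a))) * (ennreal (exp (birkhoff_sum \<phi> n (c \<frown> k ## a))) * f (\<iota> (c \<frown> k ## a))))"
      using Suc by (simp add: sum_distrib_left)
    also have "\<dots> = (\<Sum>c\<in>words A n. ennreal (exp (birkhoff_sum \<phi> (Suc n) ((c @ [k]) \<frown> a))) * f (\<iota> ((c @ [k]) \<frown> a)))"
    proof (intro sum.cong refl)
      fix c assume "c \<in> words A n"
      then have "exp (birkhoff_sum \<phi> (Suc n) ((c @ [k]) \<frown> a)) = exp (\<phi> (k ## a)) * exp (birkhoff_sum \<phi> n (c \<frown> k ## a))"
        by (subst birkhoff_sum_append) (auto simp: words_def exp_add)
      then show "ennreal (exp (\<phi> (k ## a))) * (ennreal (exp (birkhoff_sum \<phi> n (c \<frown> k ## a))) * f (\<iota> (c \<frown> k ## a)))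
         = ennreal (exp (birkhoff_sum \<phi> (Suc n) ((c @ [k]) \<frown> a))) * f (\<iota> ((c @ [k]) \<frown> a))"
        by (simp add: ennreal_mult mult.assoc)
    qed
    finally show "ennreal (exp (\<phi> (k ## a))) * (transfer A ^^ n) f (\<iota> (k ## a)) = \<dots>" .
  qed
  also have "\<dots> = (\<Sum>c\<in>words A (Suc n). ennreal (exp (birkhoff_sum \<phi> (Suc n) (c \<frown> a))) * f (\<iota> (c \<frown> a)))"
    by (rule sum_words_Suc[symmetric, OF A])
  finally show ?case .
qed

lemma partition_sum_transfer:
  assumes "N \<ge> 1" "a \<in> full_shift N"
  shows "ennreal (partition_sum \<phi> N n a) = (transfer (letters N) ^^ n) (\<lambda>_. 1) (\<iota> a)"
  using assms full_shift_subset[OF assms(1)]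
  by (subst transfer_funpow_words) (auto simp: partition_sum_words sum_ennreal)

lemma transfer_funpow_le:
  assumes "x \<in> Xc" "\<And>y. y \<in> Xc \<Longrightarrow> f y \<le> c"
  shows "(transfer A ^^ n) f x \<le> mass ^ n * c"
  using assms(1)
proof (induction n arbitrary: x)
  case (Suc n)
  have "transfer A ((transfer A ^^ n) f) x \<le> mass * (mass ^ n * c)"
    using Suc.prems by (intro transfer_le_M Suc.IH) auto
  then show ?case by (simp add: mult.assoc)
qed (use assms in simp)

definition mass_real :: real where "mass_real = enn2real mass"

lemma mass_eq: "mass = ennreal mass_real" and mass_real_nonneg: "mass_real \<ge> 0"
  using mass_finite by (auto simp: mass_real_def)

lemma partition_sum_le_M:
  assumes "N \<ge> 1" "a \<in> full_shift N"
  shows "partition_sum \<phi> N n a \<le> mass_real ^ n"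
proof -
  have "ennreal (partition_sum \<phi> N n a) \<le> mass ^ n * 1"
    unfolding partition_sum_transfer[OF assms]
    using assms full_shift_subset[OF assms(1)] by (intro transfer_funpow_le) auto
  then show ?thesis using mass_real_nonneg by (simp add: mass_eq ennreal_power)
qed

lemma partition_sum_add:
  assumes N: "N \<ge> 1" and a: "a \<in> full_shift N"
  shows "partition_sum \<phi> N (m + n) a =
    (\<Sum>c\<in>words (letters N) m. exp (birkhoff_sum \<phi> m (c \<frown> a)) * partition_sum \<phi> N n (c \<frown> a))"
proof -
  have mem: "c \<frown> a \<in> full_shift N" if "c \<in> words (letters N) m" for c
    using that a by (auto simp: words_def full_shift_conc)
  have "ennreal (partition_sum \<phi> N (m + n) a) = (transfer (letters N) ^^ m) ((transfer (letters N) ^^ n) (\<lambda>_. 1)) (\<iota> a)"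
    unfolding partition_sum_transfer[OF N a] by (simp add: funpow_add)
  also have "\<dots> = (\<Sum>c\<in>words (letters N) m. ennreal (exp (birkhoff_sum \<phi> m (c \<frown> a))) * ennreal (partition_sum \<phi> N n (c \<frown> a)))"
    using a full_shift_subset[OF N] mem by (subst transfer_funpow_words) (auto intro!: sum.cong simp: partition_sum_transfer[OF N])
  also have "\<dots> = ennreal (\<Sum>c\<in>words (letters N) m. exp (birkhoff_sum \<phi> m (c \<frown> a)) * partition_sum \<phi> N n (c \<frown> a))"
    using mem partition_sum_pos by (subst sum_ennreal[symmetric]) (auto simp: ennreal_mult less_imp_le intro!: sum.cong mult_nonneg_nonneg)
  finally show ?thesis
    using partition_sum_pos[OF a] mem partition_sum_pos
    by (subst (asm) ennreal_inj) (auto intro!: sum_nonneg mult_nonneg_nonneg simp: less_imp_le)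
qed

lemma phic_bounded_below:
  assumes "compact K" "K \<subseteq> Xc"
  obtains B where "B \<ge> 0" "\<And>x. x \<in> K \<Longrightarrow> - B \<le> \<phi>c x"
proof -
  have "bounded (\<phi>c ` K)"
    using assms by (intro compact_imp_bounded compact_continuous_image continuous_on_subset[OF phic(1)])
  then obtain B where "\<And>x. x \<in> K \<Longrightarrow> \<bar>\<phi>c x\<bar> \<le> B" by (auto simp: bounded_iff)
  then have "- max 0 B \<le> \<phi>c x" if "x \<in> K" for x using that by fastforce
  then show thesis using that[of "max 0 B"] by simp
qed

text \<open>Let \<open>c\<close> be the first \<open>m\<close> letters of \<open>a\<close>. By
  \<open>full_shift_close\<close> the point \<open>c \<frown> b\<close> is within
  \<open>\<delta>\<^sub>1\<close> of \<open>a\<close>, so distortion compares these two base points.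
  Dropping \<open>c\<close> again costs a constant, since \<open>\<phi>\<close> is bounded below on
  the compact full shift and \<open>m\<close> further letters multiply the partition sum by at most
  \<open>mass_real ^ m\<close>. The constant depends on \<open>N\<close>, but not on
  \<open>n\<close>.\<close>

lemma partition_sum_comparable:
  assumes N: "N \<ge> 1"
  obtains K where "K \<ge> 1" "\<And>n a b. a \<in> full_shift N \<Longrightarrow> b \<in> full_shift N \<Longrightarrow>
    partition_sum \<phi> N n a \<le> K * partition_sum \<phi> N n b"
proof -
  have sub: "full_shift N \<subseteq> X" by (rule full_shift_subset[OF N])
  then have sub': "\<iota> ` full_shift N \<subseteq> Xc" by auto
  obtain m where m: "\<And>a b. a \<in> full_shift N \<Longrightarrow> b \<in> full_shift N \<Longrightarrow> (\<And>i. i < m \<Longrightarrow> a i = b i) \<Longrightarrow> \<rho> a b < \<delta>\<^sub>1"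
    using full_shift_close[OF N delta1_pos] by blast
  obtain B where B: "B \<ge> 0" "\<And>x. x \<in> \<iota> ` full_shift N \<Longrightarrow> - B \<le> \<phi>c x"
    using phic_bounded_below[OF compact_full_shift[OF N] sub'] by blast
  define K where "K = D * (exp (real m * B) * mass_real ^ m)"
  have le: "partition_sum \<phi> N n a \<le> K * partition_sum \<phi> N n b" if ab: "a \<in> full_shift N" "b \<in> full_shift N" for n a b
  proof -
    define c where "c = prefix m a"
    have c: "c \<in> words (letters N) m"
      using ab(1) unfolding full_shift_range by (auto simp: c_def words_def subsequence_def)
    then have len: "length c = m" and cb: "c \<frown> b \<in> full_shift N"
      using ab by (auto simp: words_def full_shift_conc)
    have "\<rho> a (c \<frown> b) < \<delta>\<^sub>1"
      by (rule m[OF ab(1) cb]) (simp add: c_def)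
    moreover have X: "a \<in> X" "c \<frown> b \<in> X" using ab(1) cb sub by blast+
    ultimately have "ennreal (partition_sum \<phi> N n a) \<le> ennreal D * ennreal (partition_sum \<phi> N n (c \<frown> b))"
      unfolding partition_sum_transfer[OF N ab(1)] partition_sum_transfer[OF N cb]
      by (intro transfer_funpow_distortion) (simp_all add: iota_dist del: conc_mem_X)
    then have 1: "partition_sum \<phi> N n a \<le> D * partition_sum \<phi> N n (c \<frown> b)"
      using D_pos partition_sum_pos[OF cb, of \<phi> n] by (simp flip: ennreal_mult)
    have "\<phi> (suffix j (c \<frown> b)) \<ge> - B" for j
    proof -
      have "suffix j (c \<frown> b) \<in> full_shift N" using cb by (auto simp: full_shift_def)
      then show ?thesis using B(2)[of "\<iota> (suffix j (c \<frown> b))"] sub by (auto simp: phic subset_iff)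
    qed
    then have "(\<Sum>j<m. - B) \<le> birkhoff_sum \<phi> m (c \<frown> b)"
      unfolding birkhoff_sum_def shift_funpow by (intro sum_mono) auto
    then have "1 \<le> exp (real m * B) * exp (birkhoff_sum \<phi> m (c \<frown> b))"
      by (simp flip: exp_add)
    then have "partition_sum \<phi> N n (c \<frown> b) \<le> (exp (real m * B) * exp (birkhoff_sum \<phi> m (c \<frown> b))) * partition_sum \<phi> N n (c \<frown> b)"
      using partition_sum_pos[OF cb, of \<phi> n] by simp
    also have "\<dots> = exp (real m * B) * (exp (birkhoff_sum \<phi> m (c \<frown> b)) * partition_sum \<phi> N n (c \<frown> b))" by simp
    also have "exp (birkhoff_sum \<phi> m (c \<frown> b)) * partition_sum \<phi> N n (c \<frown> b) \<le> partition_sum \<phi> N (m + n) b"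
      unfolding partition_sum_add[OF N ab(2)]
    proof (rule member_le_sum[where f = "\<lambda>c. exp (birkhoff_sum \<phi> m (c \<frown> b)) * partition_sum \<phi> N n (c \<frown> b)"])
      fix w assume "w \<in> words (letters N) m - {c}"
      then have "w \<frown> b \<in> full_shift N" using ab(2) by (auto simp: words_def full_shift_conc)
      then show "0 \<le> exp (birkhoff_sum \<phi> m (w \<frown> b)) * partition_sum \<phi> N n (w \<frown> b)"
        using partition_sum_pos[of "w \<frown> b" N \<phi> n] by simp
    qed (use c in \<open>simp_all add: finite_words\<close>)
    \<comment> \<open>The same sum with the two word lengths exchanged: now the \<open>n\<close>
      letters adjoin \<open>b\<close> and the \<open>m\<close> extra ones are outermost.\<close>
    also have "partition_sum \<phi> N (m + n) b = (\<Sum>c\<in>words (letters N) n. exp (birkhoff_sum \<phi> n (c \<frown> b)) * partition_sum \<phi> N m (c \<frown> b))"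
      unfolding add.commute[of m n] by (rule partition_sum_add[OF N ab(2)])
    also have "\<dots> \<le> (\<Sum>c\<in>words (letters N) n. exp (birkhoff_sum \<phi> n (c \<frown> b)) * mass_real ^ m)"
      using ab by (intro sum_mono mult_left_mono partition_sum_le_M N) (auto simp: words_def full_shift_conc)
    also have "\<dots> = mass_real ^ m * partition_sum \<phi> N n b"
      using ab by (simp only: partition_sum_words sum_distrib_left mult.commute)
    finally have "partition_sum \<phi> N n (c \<frown> b) \<le> exp (real m * B) * (mass_real ^ m * partition_sum \<phi> N n b)" by simp
    then have "D * partition_sum \<phi> N n (c \<frown> b) \<le> D * (exp (real m * B) * (mass_real ^ m * partition_sum \<phi> N n b))"
      using D_pos by simp
    then show ?thesis using 1 by (simp add: K_def mult.assoc)
  qed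
  show thesis
  proof (rule that[of "max 1 K"])
    fix n a b assume ab: "a \<in> full_shift N" "b \<in> full_shift N"
    have "K * partition_sum \<phi> N n b \<le> max 1 K * partition_sum \<phi> N n b"
      using partition_sum_pos[OF ab(2), of \<phi> n] by (intro mult_right_mono) auto
    then show "partition_sum \<phi> N n a \<le> max 1 K * partition_sum \<phi> N n b" using le[OF ab, of n] by linarith
  qed simp
qed

text \<open>Comparability of base points makes the logarithms of the partition sums almost additive
  with error \<open>ln K\<close>. Independence of the base point justifies the \<open>THE\<close> in
  \<open>top_pressure\<close>; the two-sided bound is the normalisation that keeps the Cesaro
  averages from degenerating.\<close>

lemma top_pressure_properties:
  assumes N: "N \<ge> 1"
  shows "(\<lambda>n. ln (partition_sum \<phi> N n zero_seq) / real n) \<longlonglongrightarrow> top_pressure \<phi> N"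
    "\<exists>K\<ge>1. \<forall>n. exp (real n * top_pressure \<phi> N) \<le> K * partition_sum \<phi> N n zero_seq \<and>
       partition_sum \<phi> N n zero_seq \<le> K * exp (real n * top_pressure \<phi> N)"
proof -
  obtain K where K: "K \<ge> 1" "\<And>n a b. a \<in> full_shift N \<Longrightarrow> b \<in> full_shift N \<Longrightarrow>
    partition_sum \<phi> N n a \<le> K * partition_sum \<phi> N n b"
    using partition_sum_comparable[OF N] by blast
  let ?z = zero_seq and ?Z = "\<lambda>n. partition_sum \<phi> N n zero_seq"
  note z = zero_full_shift[of N]
  have pos: "?Z n > 0" for n by (rule partition_sum_pos[OF z])
  have cz: "c \<frown> ?z \<in> full_shift N" if "c \<in> words (letters N) m" for c m
    using that z by (auto simp: words_def full_shift_conc)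
  have Zm: "?Z m = (\<Sum>c\<in>words (letters N) m. exp (birkhoff_sum \<phi> m (c \<frown> ?z)))" for m
    by (rule partition_sum_words[OF z])
  have up: "?Z (m + n) \<le> K * (?Z m * ?Z n)" for m n
  proof -
    have "?Z (m + n) \<le> (\<Sum>c\<in>words (letters N) m. exp (birkhoff_sum \<phi> m (c \<frown> ?z)) * (K * ?Z n))"
      unfolding partition_sum_add[OF N z] by (intro sum_mono mult_left_mono K cz z) auto
    also have "\<dots> = ?Z m * (K * ?Z n)" unfolding Zm[of m] by (rule sum_distrib_right[symmetric])
    finally show ?thesis by (simp add: ac_simps)
  qed
  have low: "?Z m * ?Z n \<le> K * ?Z (m + n)" for m n
  proof -
    have "?Z m * ?Z n \<le> (\<Sum>c\<in>words (letters N) m. exp (birkhoff_sum \<phi> m (c \<frown> ?z)) * (K * partition_sum \<phi> N n (c \<frown> ?z)))"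
      unfolding Zm[of m] sum_distrib_right by (intro sum_mono mult_left_mono K cz z) auto
    also have "\<dots> = K * ?Z (m + n)"
      unfolding partition_sum_add[OF N z] by (simp add: sum_distrib_left ac_simps)
    finally show ?thesis .
  qed
  have "\<bar>ln (?Z (m + n)) - ln (?Z m) - ln (?Z n)\<bar> \<le> ln K" for m n
  proof -
    have "ln (?Z (m + n)) \<le> ln (K * (?Z m * ?Z n))" "ln (?Z m * ?Z n) \<le> ln (K * ?Z (m + n))"
      using up[of m n] low[of m n] pos[of m] pos[of n] pos[of "m+n"] K(1) by (auto intro!: ln_mono)
    then show ?thesis using pos[of m] pos[of n] pos[of "m+n"] K(1) by (simp add: ln_mult)
  qed
  from almost_additive_convergent[of "\<lambda>n. ln (?Z n)", OF this]
  obtain p where p: "(\<lambda>n. ln (?Z n) / real n) \<longlonglongrightarrow> p" "\<And>n. \<bar>ln (?Z n) - real n * p\<bar> \<le> ln K" by blast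
  have "(\<lambda>n. ln (partition_sum \<phi> N n a) / real n) \<longlonglongrightarrow> p" if a: "a \<in> full_shift N" for a
  proof -
    have "(\<lambda>n. ln K / real n) \<longlonglongrightarrow> 0" by (rule lim_const_over_n)
    then have "(\<lambda>n. ln (partition_sum \<phi> N n a) / real n - ln (?Z n) / real n) \<longlonglongrightarrow> 0"
    proof (rule Lim_null_comparison[rotated], intro always_eventually allI)
      fix n
      have pa: "partition_sum \<phi> N n a > 0" by (rule partition_sum_pos[OF a])
      have "ln (partition_sum \<phi> N n a) \<le> ln (K * ?Z n)" "ln (?Z n) \<le> ln (K * partition_sum \<phi> N n a)"
        using K(2)[OF a z, of n] K(2)[OF z a, of n] pos[of n] pa K(1) by (auto intro!: ln_mono)
      then have "\<bar>ln (partition_sum \<phi> N n a) - ln (?Z n)\<bar> \<le> ln K"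
        using pos[of n] pa K(1) by (simp add: ln_mult)
      then show "norm (ln (partition_sum \<phi> N n a) / real n - ln (?Z n) / real n) \<le> ln K / real n"
        by (simp add: diff_divide_distrib[symmetric] abs_divide divide_right_mono)
    qed
    from tendsto_add[OF this p(1)] show ?thesis by simp
  qed
  moreover have "q = p" if "\<forall>a\<in>full_shift N. (\<lambda>n. ln (partition_sum \<phi> N n a) / real n) \<longlonglongrightarrow> q" for q
    using that z p(1) LIMSEQ_unique by blast
  ultimately have tp: "top_pressure \<phi> N = p"
    unfolding top_pressure_def by (intro the_equality) blast+
  show "(\<lambda>n. ln (?Z n) / real n) \<longlonglongrightarrow> top_pressure \<phi> N" using p(1) tp by simp
  have "exp (real n * p) \<le> K * ?Z n \<and> ?Z n \<le> K * exp (real n * p)" for n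
  proof -
    have "real n * p \<le> ln (K * ?Z n)" "ln (?Z n) \<le> ln (K * exp (real n * p))"
      using p(2)[of n] pos[of n] K(1) by (auto simp: ln_mult)
    then have "exp (real n * p) \<le> exp (ln (K * ?Z n))" "exp (ln (?Z n)) \<le> exp (ln (K * exp (real n * p)))"
      by simp_all
    then show ?thesis using pos[of n] K(1) by simp
  qed
  then show "\<exists>K\<ge>1. \<forall>n. exp (real n * top_pressure \<phi> N) \<le> K * ?Z n \<and> ?Z n \<le> K * exp (real n * top_pressure \<phi> N)"
    using K(1) tp by blast
qed

text \<open>More letters give more words, hence monotonicity; \<open>ln mass_real\<close> bounds all
  terms, so the real supremum in \<open>pressure\<close> is genuine.\<close>

lemma pressure_limit: "(\<lambda>N. top_pressure \<phi> (Suc N)) \<longlonglongrightarrow> pressure \<phi>"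
  and top_pressure_mono: "incseq (\<lambda>N. top_pressure \<phi> (Suc N))"
proof -
  let ?Z = "\<lambda>N n. partition_sum \<phi> N n zero_seq"
  have pos: "?Z N n > 0" for N n by (rule partition_sum_pos[OF zero_full_shift])
  show inc: "incseq (\<lambda>N. top_pressure \<phi> (Suc N))"
  proof (rule incseq_SucI)
    fix N
    have "ln (?Z (Suc N) n) / real n \<le> ln (?Z (Suc (Suc N)) n) / real n" for n
      using pos partition_sum_mono[of \<phi> "Suc N" n] by (intro divide_right_mono) auto
    then show "top_pressure \<phi> (Suc N) \<le> top_pressure \<phi> (Suc (Suc N))"
      by (intro LIMSEQ_le[OF top_pressure_properties(1) top_pressure_properties(1)]) auto
  qed
  have Mr_pos: "mass_real > 0"
    using partition_sum_le_M[of 1 zero_seq 1] pos[of 1 1] zero_full_shift[of 1] by simp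
  have "top_pressure \<phi> (Suc N) \<le> ln mass_real" for N
  proof (rule LIMSEQ_le_const2[OF top_pressure_properties(1)])
    have "ln (?Z (Suc N) n) / real n \<le> ln mass_real" if "n \<ge> 1" for n
    proof -
      have "ln (?Z (Suc N) n) \<le> ln (mass_real ^ n)"
        using partition_sum_le_M[of "Suc N" zero_seq n] pos[of "Suc N" n] zero_full_shift[of "Suc N"] by (intro ln_mono) auto
      then show ?thesis using Mr_pos that by (simp add: ln_realpow field_simps)
    qed
    then show "\<exists>N'. \<forall>n\<ge>N'. ln (?Z (Suc N) n) / real n \<le> ln mass_real" by blast
  qed simp
  then have bdd: "bdd_above (range (\<lambda>N. top_pressure \<phi> (Suc N)))" by (auto simp: bdd_above_def)
  have "{1::nat..} = range Suc" by (auto simp: image_iff Suc_le_eq gr0_conv_Suc)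
  then have "pressure \<phi> = (SUP N. top_pressure \<phi> (Suc N))"
    unfolding pressure_def by (simp add: image_image)
  then show "(\<lambda>N. top_pressure \<phi> (Suc N)) \<longlonglongrightarrow> pressure \<phi>"
    using LIMSEQ_incseq_SUP[OF bdd inc] by simp
qed

end

section \<open>Approximate eigenmeasures of the full shifts\<close>

lemma borel_measurable_nn_integral_count_space:
  assumes A: "countable A" and g: "\<And>k. k \<in> A \<Longrightarrow> g k \<in> borel_measurable N"
  shows "(\<lambda>x. \<integral>\<^sup>+k. g k x \<partial>count_space A) \<in> borel_measurable N"
proof -
  interpret sigma_finite_measure "count_space A"
    by (rule sigma_finite_measure_count_space_countable[OF A])
  have "(\<lambda>z. g (snd z) (fst z)) \<in> borel_measurable (N \<Otimes>\<^sub>M count_space A)"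
  proof (rule measurable_compose_countable'[where f = "\<lambda>k z. g k (fst z)" and g = snd and I = A])
    show "(\<lambda>z. g k (fst z)) \<in> borel_measurable (N \<Otimes>\<^sub>M count_space A)" if "k \<in> A" for k
      by (rule measurable_compose[OF measurable_fst g[OF that]])
  qed (use A in simp_all)
  then show ?thesis
    by (rule borel_measurable_nn_integral[of "\<lambda>x k. g k x" N, unfolded case_prod_beta'])
qed

text \<open>The weights live on the index set because \<open>g\<close> need not be injective: words
  that differ by trailing zeros yield the same sequence once \<open>zero_seq\<close> is
  appended.\<close>

lemma pmf_of_finite_weights:
  fixes w :: "'i \<Rightarrow> real" and g :: "'i \<Rightarrow> 'a"
  assumes I: "finite I" and w: "\<And>i. i \<in> I \<Longrightarrow> w i \<ge> 0" "(\<Sum>i\<in>I. w i) = 1"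
  obtains p where "set_pmf p \<subseteq> g ` I" "\<And>f. (\<integral>\<^sup>+x. f x \<partial>measure_pmf p) = (\<Sum>i\<in>I. ennreal (w i) * f (g i))"
proof -
  define v where "v i = (if i \<in> I then w i else 0)" for i
  have v0: "\<And>i. 0 \<le> v i" using w by (simp add: v_def)
  have "(\<integral>\<^sup>+i. ennreal (v i) \<partial>count_space UNIV) = (\<Sum>i\<in>I. ennreal (v i))"
    using I by (intro nn_integral_count_space') (auto simp: v_def)
  also have "\<dots> = ennreal (\<Sum>i\<in>I. w i)" using w by (simp add: v_def sum_ennreal)
  finally have v1: "(\<integral>\<^sup>+i. ennreal (v i) \<partial>count_space UNIV) = 1" using w by simp
  define q where "q = embed_pmf v"
  have q: "pmf q i = v i" for i unfolding q_def by (rule pmf_embed_pmf[OF v0 v1])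
  have supp: "set_pmf q \<subseteq> I" by (auto simp: set_pmf_iff q v_def split: if_splits)
  show thesis
  proof (rule that[of "map_pmf g q"])
    show "set_pmf (map_pmf g q) \<subseteq> g ` I" using supp by auto
    fix f
    have "(\<integral>\<^sup>+x. f x \<partial>measure_pmf (map_pmf g q)) = (\<integral>\<^sup>+i. ennreal (v i) * f (g i) \<partial>count_space UNIV)"
      unfolding nn_integral_map_pmf by (subst nn_integral_measure_pmf) (simp add: q)
    also have "\<dots> = (\<Sum>i\<in>I. ennreal (v i) * f (g i))"
      using I by (intro nn_integral_count_space') (auto simp: v_def)
    also have "\<dots> = (\<Sum>i\<in>I. ennreal (w i) * f (g i))" by (simp add: v_def)
    finally show "(\<integral>\<^sup>+x. f x \<partial>measure_pmf (map_pmf g q)) = (\<Sum>i\<in>I. ennreal (w i) * f (g i))" .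
  qed
qed

context conformal_setting
begin

definition far :: "real \<Rightarrow> 'c set" where "far R = {x. dist (\<iota> zero_seq) x > R}"

lemma transfer_far_le:
  assumes x: "x \<in> Xc" and f: "\<And>y. y \<in> Xc \<Longrightarrow> f y \<le> c"
  shows "transfer A (\<lambda>y. f y * indicator (far R) y) x \<le> tail_weight R * c"
proof -
  have "transfer A (\<lambda>y. f y * indicator (far R) y) x \<le> (\<integral>\<^sup>+k. exp_sup \<phi> (cylinder_outside X \<rho> k R) * c \<partial>count_space A)"
    unfolding transfer_def
  proof (intro nn_integral_mono)
    fix k
    show "ennreal (exp (\<phi>c (branch k x))) * (f (branch k x) * indicator (far R) (branch k x))
      \<le> exp_sup \<phi> (cylinder_outside X \<rho> k R) * c"
    proof (cases "branch k x \<in> far R")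
      case True
      then have 1: "ennreal (exp (\<phi>c (branch k x))) \<le> exp_sup \<phi> (cylinder_outside X \<rho> k R)"
        by (intro exp_phi_branch_le(2)[OF x]) (simp add: far_def)
      have 2: "f (branch k x) \<le> c" using x by (intro f) simp
      show ?thesis using mult_mono[OF 1 2] True by simp
    qed simp
  qed
  also have "\<dots> \<le> (\<integral>\<^sup>+k. exp_sup \<phi> (cylinder_outside X \<rho> k R) * c \<partial>count_space UNIV)"
    by (rule nn_integral_count_space_UNIV_ge)
  also have "\<dots> = tail_weight R * c" unfolding tail_weight_def by (rule nn_integral_multc) simp
  finally show ?thesis .
qed

text \<open>
  Cesaro averages of the normalised iterates of the dual transfer operator of a full shift,
  started at the Dirac mass at \<open>\<iota> zero_seq\<close>.
\<close>

lemma approximate_eigenmeasure: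
  assumes N: "N \<ge> 1" and e: "e > 0"
  obtains p where "set_pmf p \<subseteq> \<iota> ` X"
    "\<And>R. R > 0 \<Longrightarrow> emeasure (measure_pmf p) (far R) \<le> ennreal (exp (- top_pressure \<phi> N)) * tail_weight R"
    "\<And>f. (\<And>x. f x \<le> 1) \<Longrightarrow> (\<integral>\<^sup>+x. transfer (letters N) f x \<partial>measure_pmf p)
        \<le> ennreal (exp (top_pressure \<phi> N)) * (\<integral>\<^sup>+x. f x \<partial>measure_pmf p) + ennreal e"
    "\<And>f. (\<And>x. f x \<le> 1) \<Longrightarrow> ennreal (exp (top_pressure \<phi> N)) * (\<integral>\<^sup>+x. f x \<partial>measure_pmf p)
        \<le> (\<integral>\<^sup>+x. transfer (letters N) f x \<partial>measure_pmf p) + ennreal e"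
proof -
  let ?T = "transfer (letters N)" and ?P = "top_pressure \<phi> N" and ?z = zero_seq
  let ?Z = "\<lambda>n. partition_sum \<phi> N n zero_seq"
  have z: "?z \<in> full_shift N" by (rule zero_full_shift)
  obtain K where K: "K \<ge> 1" "\<And>n. exp (real n * ?P) \<le> K * ?Z n" "\<And>n. ?Z n \<le> K * exp (real n * ?P)"
    using top_pressure_properties(2)[OF N] by blast
  \<comment> \<open>The integral of \<open>f\<close> against the normalised \<open>j\<close>-th dual
    iterate of the Dirac mass at zero. Replacing \<open>f\<close> by its transfer raises
    \<open>j\<close> by one and costs the factor \<open>exp ?P\<close>, so sums over
    \<open>j\<close> telescope.\<close>
  define t where "t j f = ennreal (exp (- (real j * ?P))) * (?T ^^ j) f (\<iota> ?z)" for j f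
  have t_words: "t j f = (\<Sum>c\<in>words (letters N) j. ennreal (exp (- (real j * ?P)) * exp (birkhoff_sum \<phi> j (c \<frown> ?z))) * f (\<iota> (c \<frown> ?z)))" for j f
    unfolding t_def by (subst transfer_funpow_words) (auto simp: sum_distrib_left ennreal_mult mult.assoc)
  have t_mono: "t j f \<le> c * t j (\<lambda>_. 1)" if "\<And>a. a \<in> X \<Longrightarrow> f (\<iota> a) \<le> c" for j f c
  proof -
    have "t j f \<le> (\<Sum>w\<in>words (letters N) j. ennreal (exp (- (real j * ?P)) * exp (birkhoff_sum \<phi> j (w \<frown> ?z))) * c)"
      unfolding t_words by (intro sum_mono mult_left_mono) (auto intro!: that)
    also have "\<dots> = c * t j (\<lambda>_. 1)"
      unfolding t_words sum_distrib_left by (intro sum.cong refl) (simp add: mult.commute)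
    finally show ?thesis .
  qed
  have t_one: "t j (\<lambda>_. 1) = ennreal (exp (- (real j * ?P)) * ?Z j)" for j
    unfolding t_def using partition_sum_transfer[OF N z, of j] partition_sum_pos[OF z, of \<phi> j] by (simp add: ennreal_mult)
  have t_one_le: "t j (\<lambda>_. 1) \<le> ennreal K" for j
  proof -
    have "exp (- (real j * ?P)) * ?Z j \<le> exp (- (real j * ?P)) * (K * exp (real j * ?P))"
      by (intro mult_left_mono K) auto
    also have "\<dots> = K" by (simp add: exp_minus)
    finally show ?thesis unfolding t_one by (intro ennreal_leI)
  qed
  have t_Suc: "t j (?T f) = ennreal (exp ?P) * t (Suc j) f" for j f
  proof -
    have "exp (- (real j * ?P)) = exp ?P * exp (- (real (Suc j) * ?P))"
      by (simp add: exp_add[symmetric] algebra_simps)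
    moreover have "(?T ^^ j) (?T f) = (?T ^^ Suc j) f" by (simp add: funpow_swap1)
    ultimately show ?thesis unfolding t_def by (simp add: ennreal_mult mult.assoc del: funpow.simps)
  qed
  \<comment> \<open>The two sides of the eigenvalue estimates differ by boundary terms of size at
    most \<open>exp ?P * K\<close>. The total mass \<open>m\<close> of the unnormalised average is
    at least \<open>n / K\<close>, so this \<open>n\<close> makes their quotient at most
    \<open>e\<close>.\<close>
  obtain n where n: "exp ?P * K * K / e < real n" using reals_Archimedean2 by blast
  have "0 < exp ?P * K * K / e" using K(1) e by simp
  then have "real n > 0" using n by linarith
  then have n0: "n > 0" by simp
  define m where "m = (\<Sum>j<n. exp (- (real j * ?P)) * ?Z j)"
  have m: "m \<ge> real n / K"
  proof -
    have "1 / K \<le> exp (- (real j * ?P)) * ?Z j" for j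
      using K(2)[of j] K(1) by (simp add: exp_minus field_simps)
    then have "(\<Sum>j<n. 1 / K) \<le> m" unfolding m_def by (intro sum_mono) auto
    then show ?thesis by simp
  qed
  moreover have "real n / K > 0" using n0 K(1) by simp
  ultimately have m0: "m > 0" by linarith
  have err: "exp ?P * K \<le> e * m"
  proof -
    have "exp ?P * K < e * (real n / K)" using n K(1) e by (simp add: field_simps)
    also have "\<dots> \<le> e * m" using m e by (intro mult_left_mono) auto
    finally show ?thesis by simp
  qed
  define I where "I = (\<Union>j<n. words (letters N) j)"
  define w where "w c = exp (- (real (length c) * ?P)) * exp (birkhoff_sum \<phi> (length c) (c \<frown> ?z)) / m" for c
  have sum_I: "(\<Sum>c\<in>I. g c) = (\<Sum>j<n. \<Sum>c\<in>words (letters N) j. g c)" for g :: "int list \<Rightarrow> 'x::comm_monoid_add"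
    unfolding I_def by (rule sum.UNION_disjoint) (auto simp: finite_words, auto simp: words_def)
  have len: "length c = j" if "c \<in> words (letters N) j" for c j using that by (simp add: words_def)
  have "(\<Sum>c\<in>I. w c) = (\<Sum>j<n. exp (- (real j * ?P)) * ?Z j) / m"
    unfolding sum_I sum_divide_distrib partition_sum_words[OF z] sum_distrib_left
    by (intro sum.cong refl) (simp add: w_def len sum_divide_distrib)
  then have w1: "(\<Sum>c\<in>I. w c) = 1" using m0 by (simp add: m_def)
  have finI: "finite I" by (simp add: I_def finite_words)
  have w0: "w c \<ge> 0" for c using m0 by (simp add: w_def)
  obtain p where p: "set_pmf p \<subseteq> (\<lambda>c. \<iota> (c \<frown> ?z)) ` I"
    "\<And>f. (\<integral>\<^sup>+x. f x \<partial>measure_pmf p) = (\<Sum>c\<in>I. ennreal (w c) * f (\<iota> (c \<frown> ?z)))"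
    using pmf_of_finite_weights[OF finI w0 w1, where g = "\<lambda>c. \<iota> (c \<frown> ?z)"] by blast
  have pint: "ennreal m * (\<integral>\<^sup>+x. f x \<partial>measure_pmf p) = (\<Sum>j<n. t j f)" for f
    unfolding p(2) sum_I sum_distrib_left t_words
  proof (intro sum.cong refl)
    fix j c assume "c \<in> words (letters N) j"
    then have "m * w c = exp (- (real j * ?P)) * exp (birkhoff_sum \<phi> j (c \<frown> ?z))"
      using m0 by (simp add: w_def len)
    then show "ennreal m * (ennreal (w c) * f (\<iota> (c \<frown> ?z))) =
      ennreal (exp (- (real j * ?P)) * exp (birkhoff_sum \<phi> j (c \<frown> ?z))) * f (\<iota> (c \<frown> ?z))"
      using m0 w0[of c] by (simp add: mult.assoc[symmetric] ennreal_mult[symmetric])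
  qed
  have cancel: "a \<le> b" if "ennreal m * a \<le> ennreal m * b" for a b
    using that m0 by (subst (asm) ennreal_mult_le_mult_iff) auto
  have tele: "(\<Sum>j<n. t (Suc j) f) + t 0 f = (\<Sum>j<n. t j f) + t n f" for f
    using sum.lessThan_Suc_shift[of "\<lambda>j. t j f" n] by (simp add: add.commute)
  show thesis
  proof (rule that[of p])
    show "set_pmf p \<subseteq> \<iota> ` X" using p(1) by auto
    show "emeasure (measure_pmf p) (far R) \<le> ennreal (exp (- ?P)) * tail_weight R" if "R > 0" for R
    proof (rule cancel)
      let ?f = "indicator (far R) :: 'c \<Rightarrow> ennreal"
      have "ennreal m * emeasure (measure_pmf p) (far R) = (\<Sum>j<n. t j ?f)"
        using pint[of ?f] by simp
      also have "\<dots> \<le> (\<Sum>j<n. t (Suc j) ?f) + t 0 ?f" unfolding tele by simp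
      \<comment> \<open>The starting Dirac mass does not charge \<open>far R\<close>, since
        \<open>R > 0\<close>; every later iterate is covered by the one-step tail estimate.\<close>
      also have "t 0 ?f = 0" using that by (simp add: t_def far_def)
      also have "(\<Sum>j<n. t (Suc j) ?f) + 0 \<le> (\<Sum>j<n. ennreal (exp (- ?P)) * tail_weight R * t j (\<lambda>_. 1))"
      proof (simp only: add_0_right, intro sum_mono)
        fix j
        have "t (Suc j) ?f = ennreal (exp (- ?P)) * t j (?T ?f)"
          unfolding t_Suc by (simp add: mult.assoc[symmetric] ennreal_mult[symmetric] exp_minus)
        also have "t j (?T ?f) \<le> tail_weight R * t j (\<lambda>_. 1)"
          using transfer_far_le[of _ "\<lambda>_. 1" 1 "letters N" R] by (intro t_mono) simp
        finally show "t (Suc j) ?f \<le> ennreal (exp (- ?P)) * tail_weight R * t j (\<lambda>_. 1)"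
          by (simp add: mult.assoc mult_left_mono)
      qed
      also have "\<dots> = ennreal (exp (- ?P)) * tail_weight R * (ennreal m * (\<integral>\<^sup>+x. 1 \<partial>measure_pmf p))"
        unfolding pint by (simp add: sum_distrib_left)
      finally show "ennreal m * emeasure (measure_pmf p) (far R) \<le> ennreal m * (ennreal (exp (- ?P)) * tail_weight R)"
        by (simp add: measure_pmf.emeasure_space_1 ac_simps)
    qed
    fix f :: "'c \<Rightarrow> ennreal" assume f: "\<And>x. f x \<le> 1"
    have tK: "t j f \<le> ennreal K" for j
      using t_mono[of f 1 j] f t_one_le[of j] by (simp add: order_trans)
    have t0: "t 0 f \<le> 1" using f by (simp add: t_def)
    have Te: "ennreal m * (\<integral>\<^sup>+x. ?T f x \<partial>measure_pmf p) = ennreal (exp ?P) * (\<Sum>j<n. t (Suc j) f)"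
      unfolding pint t_Suc by (simp add: sum_distrib_left)
    have errK: "ennreal (exp ?P) * ennreal K \<le> ennreal m * ennreal e"
      using err m0 e K(1) by (simp add: ennreal_mult[symmetric] mult.commute)
    show "(\<integral>\<^sup>+x. ?T f x \<partial>measure_pmf p) \<le> ennreal (exp ?P) * (\<integral>\<^sup>+x. f x \<partial>measure_pmf p) + ennreal e"
    proof (rule cancel)
      have "ennreal m * (\<integral>\<^sup>+x. ?T f x \<partial>measure_pmf p) \<le> ennreal (exp ?P) * ((\<Sum>j<n. t j f) + t n f)"
        unfolding Te tele[symmetric] by (intro mult_left_mono) auto
      also have "\<dots> \<le> ennreal (exp ?P) * (\<Sum>j<n. t j f) + ennreal (exp ?P) * ennreal K"
        unfolding distrib_left by (intro add_left_mono mult_left_mono tK) auto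
      also have "\<dots> \<le> ennreal (exp ?P) * (\<Sum>j<n. t j f) + ennreal m * ennreal e"
        by (intro add_left_mono errK)
      finally show "ennreal m * (\<integral>\<^sup>+x. ?T f x \<partial>measure_pmf p) \<le> ennreal m * (ennreal (exp ?P) * (\<integral>\<^sup>+x. f x \<partial>measure_pmf p) + ennreal e)"
        unfolding pint[symmetric] by (simp add: distrib_left ac_simps)
    qed
    show "ennreal (exp ?P) * (\<integral>\<^sup>+x. f x \<partial>measure_pmf p) \<le> (\<integral>\<^sup>+x. ?T f x \<partial>measure_pmf p) + ennreal e"
    proof (rule cancel)
      have "ennreal m * (ennreal (exp ?P) * (\<integral>\<^sup>+x. f x \<partial>measure_pmf p)) = ennreal (exp ?P) * (\<Sum>j<n. t j f)"
        unfolding pint[symmetric] by (simp add: ac_simps)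
      also have "\<dots> \<le> ennreal (exp ?P) * ((\<Sum>j<n. t (Suc j) f) + t 0 f)"
        unfolding tele by (intro mult_left_mono) auto
      also have "\<dots> \<le> ennreal (exp ?P) * (\<Sum>j<n. t (Suc j) f) + ennreal (exp ?P) * ennreal K"
        unfolding distrib_left using tK by (intro add_left_mono mult_left_mono) auto
      also have "\<dots> \<le> ennreal m * (\<integral>\<^sup>+x. ?T f x \<partial>measure_pmf p) + ennreal m * ennreal e"
        unfolding Te by (intro add_left_mono errK)
      finally show "ennreal m * (ennreal (exp ?P) * (\<integral>\<^sup>+x. f x \<partial>measure_pmf p)) \<le> ennreal m * ((\<integral>\<^sup>+x. ?T f x \<partial>measure_pmf p) + ennreal e)"
        by (simp add: distrib_left)
    qed
  qed
qed

section \<open>The eigenmeasure on the completion\<close>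

abbreviation (input) "BX \<equiv> restrict_space borel Xc"

lemma borel_measurable_continuous_on_Xc: "continuous_on Xc f \<Longrightarrow> f \<in> borel_measurable BX"
  by (rule borel_measurable_continuous_on_restrict)

lemma branch_measurable: "branch k \<in> BX \<rightarrow>\<^sub>M BX"
  by (intro measurable_restrict_space2 borel_measurable_continuous_on_Xc branch_continuous)
     (auto simp: space_restrict_space)

lemma exp_phic_measurable: "(\<lambda>x. ennreal (exp (\<phi>c x))) \<in> borel_measurable BX"
  using borel_measurable_continuous_on_Xc[OF phic(1)] by simp

lemma transfer_measurable:
  assumes f: "f \<in> borel_measurable BX"
  shows "transfer A f \<in> borel_measurable BX"
proof -
  have "(\<lambda>x. ennreal (exp (\<phi>c (branch k x))) * f (branch k x)) \<in> borel_measurable BX" for k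
    by (intro borel_measurable_times_ennreal measurable_compose[OF branch_measurable exp_phic_measurable]
        measurable_compose[OF branch_measurable f])
  then have "(\<lambda>x. \<integral>\<^sup>+k. ennreal (exp (\<phi>c (branch k x))) * f (branch k x) \<partial>count_space A) \<in> borel_measurable BX"
    by (intro borel_measurable_nn_integral_count_space) auto
  then show ?thesis by (simp add: transfer_def[abs_def])
qed

lemma transfer_cong: "x \<in> Xc \<Longrightarrow> (\<And>y. y \<in> Xc \<Longrightarrow> f y = g y) \<Longrightarrow> transfer A f x = transfer A g x"
  unfolding transfer_def by (intro nn_integral_cong) auto

lemma transfer_add: "transfer A (\<lambda>y. f y + g y) x = transfer A f x + transfer A g x"
  unfolding transfer_def by (subst nn_integral_add[symmetric]) (auto simp: distrib_left)

lemma transfer_suminf: "transfer A (\<lambda>y. \<Sum>i. f i y) x = (\<Sum>i. transfer A (f i) x)"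
  unfolding transfer_def
  by (subst nn_integral_suminf[symmetric]) (auto simp: ennreal_suminf_cmult)

lemma transfer_SUP:
  assumes "incseq U"
  shows "transfer A (\<lambda>y. SUP i. U i y) x = (SUP i. transfer A (U i) x)"
  unfolding transfer_def
proof (subst nn_integral_monotone_convergence_SUP[symmetric])
  show "incseq (\<lambda>i k. ennreal (exp (\<phi>c (branch k x))) * U i (branch k x))"
    using assms by (auto simp: incseq_def le_fun_def intro!: mult_left_mono)
qed (auto simp: SUP_mult_left_ennreal)

text \<open>
  The suprema over the cylinders, which are summable over all letters, dominate.
\<close>

lemma transfer_dominated_convergence:
  assumes x: "\<And>n. x n \<in> Xc" "y \<in> Xc" and f: "\<And>n z. f n z \<le> 1"
    and A: "\<And>k. \<forall>\<^sub>F n in sequentially. k \<in> A n"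
    and lim: "\<And>k. (\<lambda>n. ennreal (exp (\<phi>c (branch k (x n)))) * f n (branch k (x n)))
        \<longlonglongrightarrow> ennreal (exp (\<phi>c (branch k y))) * g (branch k y)"
  shows "(\<lambda>n. transfer (A n) (f n) (x n)) \<longlonglongrightarrow> transfer UNIV g y"
proof -
  let ?h = "\<lambda>n k. ennreal (exp (\<phi>c (branch k (x n)))) * f n (branch k (x n))"
  have "(\<lambda>n. \<integral>\<^sup>+k. ?h n k * indicator (A n) k \<partial>count_space UNIV) \<longlonglongrightarrow> transfer UNIV g y"
    unfolding transfer_def
  proof (rule nn_integral_dominated_convergence[where w = "\<lambda>k. exp_sup \<phi> (cylinder X k)"])
    show "AE k in count_space UNIV. ?h n k * indicator (A n) k \<le> exp_sup \<phi> (cylinder X k)" for n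
    proof (rule AE_I2)
      fix k
      have "?h n k \<le> exp_sup \<phi> (cylinder X k) * 1"
        using x f by (intro mult_mono exp_phi_branch_le) auto
      then show "?h n k * indicator (A n) k \<le> exp_sup \<phi> (cylinder X k)"
        by (auto split: split_indicator)
    qed
    show "(\<integral>\<^sup>+k. exp_sup \<phi> (cylinder X k) \<partial>count_space UNIV) < \<infinity>"
      using mass_finite by (simp add: mass_def)
    show "AE k in count_space UNIV. (\<lambda>n. ?h n k * indicator (A n) k) \<longlonglongrightarrow> ennreal (exp (\<phi>c (branch k y))) * g (branch k y)"
    proof (rule AE_I2)
      fix k
      have "\<forall>\<^sub>F n in sequentially. ?h n k = ?h n k * indicator (A n) k"
        using A[of k] by eventually_elim simp
      from Lim_transform_eventually[OF lim[of k] this]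
      show "(\<lambda>n. ?h n k * indicator (A n) k) \<longlonglongrightarrow> ennreal (exp (\<phi>c (branch k y))) * g (branch k y)" .
    qed
  qed simp_all
  moreover have "transfer (A n) (f n) (x n) = (\<integral>\<^sup>+k. ?h n k * indicator (A n) k \<partial>count_space UNIV)" for n
    unfolding transfer_def by (rule nn_integral_count_space_indicator) simp
  ultimately show ?thesis by simp
qed

lemma transfer_le_M_one: "x \<in> Xc \<Longrightarrow> (\<And>z. f z \<le> 1) \<Longrightarrow> transfer A f x \<le> mass"
  using transfer_le_M[of x f 1 A] by simp

definition P :: real where "P = pressure \<phi>"

text \<open>The alphabet grows together with the index of the measures, so the operators vary along
  the sequence and weak convergence against one fixed test function would not suffice. Along an
  almost surely convergent representation both limits become dominated convergence, over the letters
  and over \<open>\<Omega>\<close>.\<close>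

lemma limit_eigenmeasure:
  "\<exists>\<nu>. prob_space \<nu> \<and> sets \<nu> = sets BX \<and>
    (\<forall>f. continuous_on UNIV f \<longrightarrow> (\<forall>x. 0 \<le> f x \<and> f x \<le> 1) \<longrightarrow>
      (\<integral>\<^sup>+x. transfer UNIV (\<lambda>y. ennreal (f y)) x \<partial>\<nu>) = ennreal (exp P) * (\<integral>\<^sup>+x. ennreal (f x) \<partial>\<nu>))"
proof -
  define Q where "Q N = top_pressure \<phi> (Suc N)" for N
  have Q: "Q \<longlonglongrightarrow> P" "incseq Q"
    using pressure_limit top_pressure_mono by (simp_all add: Q_def[abs_def] P_def)
  have "\<exists>p. set_pmf p \<subseteq> \<iota> ` X \<and>
    (\<forall>R>0. emeasure (measure_pmf p) (far R) \<le> ennreal (exp (- Q N)) * tail_weight R) \<and>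
    (\<forall>f. (\<forall>x. f x \<le> 1) \<longrightarrow> (\<integral>\<^sup>+x. transfer (letters (Suc N)) f x \<partial>measure_pmf p)
        \<le> ennreal (exp (Q N)) * (\<integral>\<^sup>+x. f x \<partial>measure_pmf p) + ennreal (1 / real (Suc N)) \<and>
      ennreal (exp (Q N)) * (\<integral>\<^sup>+x. f x \<partial>measure_pmf p)
        \<le> (\<integral>\<^sup>+x. transfer (letters (Suc N)) f x \<partial>measure_pmf p) + ennreal (1 / real (Suc N)))" for N
    unfolding Q_def by (rule approximate_eigenmeasure[of "Suc N" "1 / real (Suc N)"]) (simp, simp, blast)
  then obtain p where p: "\<And>N. set_pmf (p N) \<subseteq> \<iota> ` X"
    and p_far: "\<And>N R. R > 0 \<Longrightarrow> emeasure (measure_pmf (p N)) (far R) \<le> ennreal (exp (- Q N)) * tail_weight R"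
    and p_le: "\<And>N f. (\<And>x. f x \<le> 1) \<Longrightarrow> (\<integral>\<^sup>+x. transfer (letters (Suc N)) f x \<partial>measure_pmf (p N))
        \<le> ennreal (exp (Q N)) * (\<integral>\<^sup>+x. f x \<partial>measure_pmf (p N)) + ennreal (1 / real (Suc N))"
    and p_ge: "\<And>N f. (\<And>x. f x \<le> 1) \<Longrightarrow> ennreal (exp (Q N)) * (\<integral>\<^sup>+x. f x \<partial>measure_pmf (p N))
        \<le> (\<integral>\<^sup>+x. transfer (letters (Suc N)) f x \<partial>measure_pmf (p N)) + ennreal (1 / real (Suc N))"
    by metis
  have tight: "\<exists>K. compact K \<and> (\<forall>n. measure (p n) K \<ge> 1 - e)" if e: "e > 0" for e
  proof -
    have "((\<lambda>R. ennreal (exp (- Q 0)) * tail_weight R) \<longlongrightarrow> ennreal (exp (- Q 0)) * 0) at_top"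
      by (intro tendsto_mult_ennreal tendsto_const tail_weight_tendsto) auto
    then have "\<forall>\<^sub>F R in at_top. ennreal (exp (- Q 0)) * tail_weight R < ennreal e"
      using e by (intro order_tendstoD(2)) auto
    then have "\<forall>\<^sub>F R in at_top. R > 0 \<and> ennreal (exp (- Q 0)) * tail_weight R < ennreal e"
      using eventually_gt_at_top[of "0::real"] by eventually_elim simp
    then obtain R where R: "R > 0" "ennreal (exp (- Q 0)) * tail_weight R < ennreal e"
      by (auto dest!: eventually_happens)
    let ?K = "{b \<in> Xc. dist (\<iota> zero_seq) b \<le> R}"
    have "measure (p n) ?K \<ge> 1 - e" for n
    proof -
      \<comment> \<open>The pressures increase with the alphabet, so the factor
        \<open>exp (- Q n)\<close> is largest for \<open>n = 0\<close> and one radius serves all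
        \<open>n\<close>.\<close>
      have "Q 0 \<le> Q n" using Q(2) by (simp add: incseq_def)
      then have "ennreal (exp (- Q n)) * tail_weight R \<le> ennreal (exp (- Q 0)) * tail_weight R"
        by (intro mult_right_mono ennreal_leI) auto
      then have "emeasure (measure_pmf (p n)) (far R) \<le> ennreal e"
        using p_far[OF R(1), of n] R(2) by (meson less_imp_le order_trans)
      then have "measure (p n) (far R) \<le> e"
        using e by (simp add: measure_pmf.emeasure_eq_measure)
      moreover have "measure (p n) ?K = measure (p n) (- far R)"
        using p[of n] by (intro measure_pmf.finite_measure_eq_AE)
          (auto simp: AE_measure_pmf_iff far_def subset_iff)
      ultimately show ?thesis
        using measure_pmf.prob_compl[of "far R" "p n"] by (simp add: Compl_eq_Diff_UNIV)
    qed
    then show ?thesis using proper[OF R(1)] by blast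
  qed
  obtain s \<Omega> Y Z where s: "strict_mono (s :: nat \<Rightarrow> nat)" and \<Omega>: "prob_space (\<Omega> :: real measure)"
    and Y: "\<And>n. Y n \<in> measurable \<Omega> (count_space UNIV)"
      "\<And>n. distr \<Omega> (count_space UNIV) (Y n) = measure_pmf (p (s n))"
    and Z: "Z \<in> borel_measurable \<Omega>" "AE \<omega> in \<Omega>. (\<lambda>n. Y n \<omega>) \<longlonglongrightarrow> Z \<omega>"
    using tight_pmf_imp_convergent_representation[OF tight] by blast
  interpret prob_space \<Omega> by fact
  have AE_Y: "AE \<omega> in \<Omega>. \<forall>n. Y n \<omega> \<in> \<iota> ` X"
    unfolding AE_all_countable
  proof
    fix n
    have "AE y in distr \<Omega> (count_space UNIV) (Y n). y \<in> \<iota> ` X"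
      unfolding Y(2) using p by (auto simp: AE_measure_pmf_iff)
    then show "AE \<omega> in \<Omega>. Y n \<omega> \<in> \<iota> ` X"
      by (subst (asm) AE_distr_iff) (use Y(1) in auto)
  qed
  have Yint: "(\<integral>\<^sup>+x. f x \<partial>measure_pmf (p (s n))) = (\<integral>\<^sup>+\<omega>. f (Y n \<omega>) \<partial>\<Omega>)" for n f
    unfolding Y(2)[symmetric] by (rule nn_integral_distr[OF Y(1)]) simp
  \<comment> \<open>The limit lies in the closed set \<open>Xc\<close> only almost surely; the
    correction makes \<open>Z'\<close> map into \<open>Xc\<close> everywhere.\<close>
  define Z' where "Z' \<omega> = (if Z \<omega> \<in> Xc then Z \<omega> else \<iota> zero_seq)" for \<omega>
  have Z'_Xc: "Z' \<omega> \<in> Xc" for \<omega> by (simp add: Z'_def)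
  have "Z' \<in> borel_measurable \<Omega>"
    unfolding Z'_def
  proof (rule measurable_If)
    show "{\<omega> \<in> space \<Omega>. Z \<omega> \<in> Xc} \<in> sets \<Omega>"
      using measurable_sets[OF Z(1), of Xc] by (simp add: vimage_def Int_def conj_commute)
  qed (use Z(1) in simp_all)
  then have Z': "Z' \<in> \<Omega> \<rightarrow>\<^sub>M BX"
    using Z'_Xc by (intro measurable_restrict_space2) auto
  have conv: "AE \<omega> in \<Omega>. (\<forall>n. Y n \<omega> \<in> Xc) \<and> (\<lambda>n. Y n \<omega>) \<longlonglongrightarrow> Z' \<omega>"
    using AE_Y Z(2)
  proof eventually_elim
    case (elim \<omega>)
    moreover have "\<iota> ` X \<subseteq> Xc" by auto
    ultimately have YX: "\<forall>n. Y n \<omega> \<in> Xc" by blast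
    then have "Z \<omega> \<in> Xc" using closed_sequentially[OF closed_Xc, of "\<lambda>n. Y n \<omega>"] elim(2) by blast
    then show ?case using YX elim by (simp add: Z'_def)
  qed
  define \<nu> where "\<nu> = distr \<Omega> BX Z'"
  have nu_int: "(\<integral>\<^sup>+x. f x \<partial>\<nu>) = (\<integral>\<^sup>+\<omega>. f (Z' \<omega>) \<partial>\<Omega>)" if "f \<in> borel_measurable BX" for f
    unfolding \<nu>_def by (rule nn_integral_distr[OF Z']) (use that in simp)
  have letters_ev: "\<forall>\<^sub>F n in sequentially. k \<in> letters (Suc (s n))" for k
  proof -
    have "k \<in> letters (Suc (s n))" if "n \<ge> nat \<bar>k\<bar>" for n
      using that seq_suble[OF s, of n] by auto
    then show ?thesis by (auto simp: eventually_sequentially)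
  qed
  show ?thesis
  proof (intro exI[of _ \<nu>] conjI allI impI)
    show "prob_space \<nu>" unfolding \<nu>_def by (rule prob_space_distr[OF Z'])
    show "sets \<nu> = sets BX" by (simp add: \<nu>_def)
    fix f :: "'c \<Rightarrow> real" assume f: "continuous_on UNIV f" "\<forall>x. 0 \<le> f x \<and> f x \<le> 1"
    let ?f = "\<lambda>x. ennreal (f x)"
    have f1: "?f x \<le> 1" for x using f(2) by simp
    have fm: "?f \<in> borel_measurable BX"
      using borel_measurable_continuous_on_Xc[OF continuous_on_subset[OF f(1)]] by simp
    have limf: "(\<lambda>n. ?f (x n)) \<longlonglongrightarrow> ?f y" if "x \<longlonglongrightarrow> y" for x y
      by (intro tendsto_ennrealI continuous_on_tendsto_compose[OF f(1) that]) auto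
    have "(\<lambda>n. \<integral>\<^sup>+\<omega>. ?f (Y n \<omega>) \<partial>\<Omega>) \<longlonglongrightarrow> (\<integral>\<^sup>+\<omega>. ?f (Z' \<omega>) \<partial>\<Omega>)"
    proof (rule nn_integral_dominated_convergence[where w = "\<lambda>_. 1"])
      show "(\<lambda>\<omega>. ?f (Y n \<omega>)) \<in> borel_measurable \<Omega>" for n
        by (rule measurable_compose[OF Y(1)]) simp
      show "(\<lambda>\<omega>. ?f (Z' \<omega>)) \<in> borel_measurable \<Omega>" by (rule measurable_compose[OF Z' fm])
      show "AE \<omega> in \<Omega>. (\<lambda>n. ?f (Y n \<omega>)) \<longlonglongrightarrow> ?f (Z' \<omega>)"
        using conv by eventually_elim (auto intro: limf)
    qed (use f1 in \<open>auto simp: emeasure_space_1\<close>)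
    then have limL: "(\<lambda>n. ennreal (exp (Q (s n))) * (\<integral>\<^sup>+x. ?f x \<partial>measure_pmf (p (s n))))
       \<longlonglongrightarrow> ennreal (exp P) * (\<integral>\<^sup>+x. ?f x \<partial>\<nu>)"
      unfolding Yint nu_int[OF fm]
      using LIMSEQ_subseq_LIMSEQ[OF Q(1) s]
      by (intro tendsto_mult_ennreal tendsto_ennrealI tendsto_exp) (auto simp: comp_def)
    have "(\<lambda>n. \<integral>\<^sup>+\<omega>. transfer (letters (Suc (s n))) ?f (Y n \<omega>) \<partial>\<Omega>) \<longlonglongrightarrow> (\<integral>\<^sup>+\<omega>. transfer UNIV ?f (Z' \<omega>) \<partial>\<Omega>)"
    proof (rule nn_integral_dominated_convergence[where w = "\<lambda>_. mass"])
      show "(\<lambda>\<omega>. transfer (letters (Suc (s n))) ?f (Y n \<omega>)) \<in> borel_measurable \<Omega>" for n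
        by (rule measurable_compose[OF Y(1)]) simp
      show "(\<lambda>\<omega>. transfer UNIV ?f (Z' \<omega>)) \<in> borel_measurable \<Omega>"
        by (rule measurable_compose[OF Z' transfer_measurable[OF fm]])
      show "AE \<omega> in \<Omega>. transfer (letters (Suc (s n))) ?f (Y n \<omega>) \<le> mass" for n
        using conv by eventually_elim (rule transfer_le_M_one, use f1 in auto)
      show "AE \<omega> in \<Omega>. (\<lambda>n. transfer (letters (Suc (s n))) ?f (Y n \<omega>)) \<longlonglongrightarrow> transfer UNIV ?f (Z' \<omega>)"
        using conv
      proof eventually_elim
        case (elim \<omega>)
        have br: "(\<lambda>n. branch k (Y n \<omega>)) \<longlonglongrightarrow> branch k (Z' \<omega>)" for k
          using elim Z'_Xc by (intro tendsto_on_Xc[OF branch_continuous]) auto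
        have "(\<lambda>n. \<phi>c (branch k (Y n \<omega>))) \<longlonglongrightarrow> \<phi>c (branch k (Z' \<omega>))" for k
          using elim Z'_Xc by (intro tendsto_on_Xc[OF phic(1)] br) auto
        then have "(\<lambda>n. ennreal (exp (\<phi>c (branch k (Y n \<omega>)))) * ?f (branch k (Y n \<omega>)))
           \<longlonglongrightarrow> ennreal (exp (\<phi>c (branch k (Z' \<omega>)))) * ?f (branch k (Z' \<omega>))" for k
          by (intro tendsto_mult_ennreal tendsto_ennrealI[OF tendsto_exp] limf br) auto
        then show ?case
          using elim Z'_Xc f1 letters_ev by (intro transfer_dominated_convergence) auto
      qed
    qed (use mass_finite in \<open>auto simp: emeasure_space_1\<close>)
    then have limR: "(\<lambda>n. \<integral>\<^sup>+x. transfer (letters (Suc (s n))) ?f x \<partial>measure_pmf (p (s n))) \<longlonglongrightarrow> (\<integral>\<^sup>+x. transfer UNIV ?f x \<partial>\<nu>)"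
      unfolding Yint nu_int[OF transfer_measurable[OF fm]] .
    have "(\<lambda>n. 1 / real (Suc n)) \<longlonglongrightarrow> 0" by (rule LIMSEQ_Suc[OF lim_1_over_n])
    then have "(\<lambda>n. ennreal (1 / real (Suc (s n)))) \<longlonglongrightarrow> ennreal 0"
      using LIMSEQ_subseq_LIMSEQ[OF _ s] by (intro tendsto_ennrealI) (auto simp: comp_def)
    then have lim0: "(\<lambda>n. ennreal (1 / real (Suc (s n)))) \<longlonglongrightarrow> 0" by simp
    show "(\<integral>\<^sup>+x. transfer UNIV ?f x \<partial>\<nu>) = ennreal (exp P) * (\<integral>\<^sup>+x. ?f x \<partial>\<nu>)"
    proof (rule antisym)
      show "(\<integral>\<^sup>+x. transfer UNIV ?f x \<partial>\<nu>) \<le> ennreal (exp P) * (\<integral>\<^sup>+x. ?f x \<partial>\<nu>)"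
        using LIMSEQ_le[OF limR tendsto_add[OF limL lim0]] p_le[of ?f, OF f1] by auto
      show "ennreal (exp P) * (\<integral>\<^sup>+x. ?f x \<partial>\<nu>) \<le> (\<integral>\<^sup>+x. transfer UNIV ?f x \<partial>\<nu>)"
        using LIMSEQ_le[OF limL tendsto_add[OF limR lim0]] p_ge[of ?f, OF f1] by auto
    qed
  qed
qed

lemma indicator_le_one: "(indicator A x :: ennreal) \<le> 1"
  by (simp add: indicator_def)

text \<open>For indicators both sides are finite measures. They agree on closed sets, whose
  indicators are limits of continuous functions with values between 0 and 1, hence on Borel sets by
  a Dynkin argument in which finiteness (\<open>M_int\<close>) permits complements, and then on all
  nonnegative measurable functions by monotone approximation.\<close>

lemma eigenmeasure_exists:
  obtains \<nu> where "prob_space \<nu>" "sets \<nu> = sets BX"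
    "\<And>f. f \<in> borel_measurable BX \<Longrightarrow> (\<integral>\<^sup>+x. transfer UNIV f x \<partial>\<nu>) = ennreal (exp P) * (\<integral>\<^sup>+x. f x \<partial>\<nu>)"
proof -
  obtain \<nu> where \<nu>: "prob_space \<nu>" "sets \<nu> = sets BX"
    and eq: "\<forall>f. continuous_on UNIV f \<longrightarrow> (\<forall>x. 0 \<le> f x \<and> f x \<le> 1) \<longrightarrow>
      (\<integral>\<^sup>+x. transfer UNIV (\<lambda>y. ennreal (f y)) x \<partial>\<nu>) = ennreal (exp P) * (\<integral>\<^sup>+x. ennreal (f x) \<partial>\<nu>)"
    using limit_eigenmeasure by blast
  interpret prob_space \<nu> by fact
  have sp: "space \<nu> = Xc" using sets_eq_imp_space_eq[OF \<nu>(2)] by (simp add: space_restrict_space)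
  note bm = measurable_cong_sets[OF \<nu>(2) refl]
  let ?L = "\<lambda>f. \<integral>\<^sup>+x. transfer UNIV f x \<partial>\<nu>" and ?R = "\<lambda>f. ennreal (exp P) * (\<integral>\<^sup>+x. f x \<partial>\<nu>)"
  let ?eq = "\<lambda>A. ?L (indicator A) = ?R (indicator A)"
  have ind: "indicator A \<in> borel_measurable BX" if "A \<in> sets borel" for A :: "'c set"
    using that by (intro measurable_restrict_space1) auto
  have tm: "transfer UNIV f \<in> borel_measurable \<nu>" if "f \<in> borel_measurable BX" for f
    using transfer_measurable[OF that] by (simp add: bm)
  have closed_case: "?eq C" if C: "closed C" for C
  proof (cases "C = {}")
    case True
    then show ?thesis by (simp add: transfer_def)
  next
    case ne: False
    define f where "f n x = max 0 (1 - real n * infdist x C)" for n :: nat and x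
    have f_cont: "continuous_on UNIV (f n)" for n
      unfolding f_def by (intro continuous_intros continuous_on_infdist)
    have f01: "0 \<le> f n x \<and> f n x \<le> 1" for n x by (simp add: f_def infdist_nonneg)
    have f1: "ennreal (f n x) \<le> 1" for n x using f01[of n x] by simp
    have fm: "(\<lambda>x. ennreal (f n x)) \<in> borel_measurable BX" for n
      using borel_measurable_continuous_on_Xc[OF continuous_on_subset[OF f_cont]] by simp
    have lim: "(\<lambda>n. ennreal (f n x)) \<longlonglongrightarrow> indicator C x" for x
    proof (cases "x \<in> C")
      case True
      then show ?thesis by (simp add: f_def)
    next
      case False
      then have pos: "infdist x C > 0" using C ne by (simp add: in_closed_iff_infdist_zero infdist_pos_not_in_closed)
      obtain n0 where n0: "1 / infdist x C < real n0" using reals_Archimedean2 by blast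
      have "f n x = 0" if "n \<ge> n0" for n
      proof -
        have "1 / infdist x C < real n" using n0 that by linarith
        then have "1 < real n * infdist x C" using pos by (simp add: field_simps)
        then show ?thesis by (simp add: f_def)
      qed
      then have "\<forall>\<^sub>F n in sequentially. ennreal (f n x) = indicator C x"
        using False by (intro eventually_sequentiallyI[of n0]) simp
      then show ?thesis by (rule tendsto_eventually)
    qed
    have "(\<lambda>n. \<integral>\<^sup>+x. ennreal (f n x) \<partial>\<nu>) \<longlonglongrightarrow> (\<integral>\<^sup>+x. indicator C x \<partial>\<nu>)"
    proof (rule nn_integral_dominated_convergence[where w = "\<lambda>_. 1"])
      show "(\<lambda>x. ennreal (f n x)) \<in> borel_measurable \<nu>" for n using fm by (simp add: bm)
      show "indicator C \<in> borel_measurable \<nu>" using ind[of C] C by (simp add: bm)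
    qed (use f1 lim in \<open>auto simp: emeasure_space_1\<close>)
    then have "(\<lambda>n. ?R (\<lambda>x. ennreal (f n x))) \<longlonglongrightarrow> ?R (indicator C)"
      by (intro tendsto_mult_ennreal tendsto_const) auto
    moreover have "(\<lambda>n. ?L (\<lambda>x. ennreal (f n x))) \<longlonglongrightarrow> ?L (indicator C)"
    proof (rule nn_integral_dominated_convergence[where w = "\<lambda>_. mass"])
      show "AE x in \<nu>. transfer UNIV (\<lambda>x. ennreal (f n x)) x \<le> mass" for n
        using f1 by (intro AE_I2 transfer_le_M_one) (auto simp: sp)
      show "AE x in \<nu>. (\<lambda>n. transfer UNIV (\<lambda>x. ennreal (f n x)) x) \<longlonglongrightarrow> transfer UNIV (indicator C) x"
        using f1 lim by (intro AE_I2 transfer_dominated_convergence tendsto_mult_ennreal tendsto_const) (auto simp: sp)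
    qed (use fm ind[of C] C tm mass_finite in \<open>auto simp: emeasure_space_1\<close>)
    moreover have "?L (\<lambda>x. ennreal (f n x)) = ?R (\<lambda>x. ennreal (f n x))" for n
      using eq f_cont[of n] f01[of n] by blast
    ultimately show ?thesis using LIMSEQ_unique by simp
  qed
  have M_int: "?L (indicator A) \<noteq> top" for A
  proof -
    have "?L (indicator A) \<le> (\<integral>\<^sup>+x. mass \<partial>\<nu>)"
      by (intro nn_integral_mono transfer_le_M_one) (auto simp: sp indicator_le_one)
    then show ?thesis using mass_finite by (auto simp: emeasure_space_1 top_unique)
  qed
  have sets_case: "?eq A" if "A \<in> sets borel" for A
  proof -
    have "Int_stable (Collect closed :: 'c set set)" "Collect closed \<subseteq> Pow (UNIV :: 'c set)"
      "A \<in> sigma_sets UNIV (Collect closed)"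
      using that by (auto simp: borel_eq_closed Int_stable_def)
    then show ?thesis
    proof (induction rule: sigma_sets_induct_disjoint)
      case (basic A)
      then show ?case by (intro closed_case) auto
    next
      case empty
      show ?case by (rule closed_case) simp
    next
      case (compl A)
      have A: "A \<in> sets borel" using compl by (simp add: borel_eq_closed)
      have split: "(\<lambda>y. indicator (UNIV - A) y + indicator A y) = (indicator UNIV :: 'c \<Rightarrow> ennreal)"
        by (auto simp: indicator_def)
      have "?L (indicator (UNIV - A)) + ?L (indicator A) = ?L (\<lambda>y. indicator (UNIV - A) y + indicator A y)"
        unfolding transfer_add using A by (intro nn_integral_add[symmetric] tm ind) auto
      also have "\<dots> = ?R (\<lambda>y. indicator (UNIV - A) y + indicator A y)"
        unfolding split by (rule closed_case) simp
      also have "\<dots> = ?R (indicator (UNIV - A)) + ?R (indicator A)"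
        using ind[OF A] ind[of "UNIV - A"] A
        by (subst nn_integral_add) (auto simp: bm distrib_left)
      also have "?R (indicator A) = ?L (indicator A)" using compl.IH by simp
      finally show ?case using M_int[of A] by simp
    next
      case (union A)
      have A: "A i \<in> sets borel" for i using union by (auto simp: borel_eq_closed)
      have split: "indicator (\<Union>i. A i) = (\<lambda>y. \<Sum>i. indicator (A i) y :: ennreal)"
        using union(1) by (auto simp: suminf_indicator)
      have "?L (indicator (\<Union>i. A i)) = (\<Sum>i. ?L (indicator (A i)))"
        unfolding split transfer_suminf using A by (intro nn_integral_suminf tm ind) auto
      also have "\<dots> = (\<Sum>i. ?R (indicator (A i)))" using union.IH by simp
      also have "\<dots> = ?R (indicator (\<Union>i. A i))"
        unfolding split using ind[OF A] by (subst nn_integral_suminf) (auto simp: bm ennreal_suminf_cmult)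
      finally show ?case .
    qed
  qed
  have "?L f = ?R f" if "f \<in> borel_measurable BX" for f
    using that
  proof (induction rule: borel_measurable_induct)
    case (cong f g)
    then have *: "\<And>x. x \<in> Xc \<Longrightarrow> f x = g x" by (simp add: space_restrict_space)
    have "?L g = ?L f" "?R g = ?R f"
      using * by (auto intro!: nn_integral_cong transfer_cong arg_cong[where f = "(*) (ennreal (exp P))"] simp: sp)
    then show ?case using cong by simp
  next
    case (set A)
    then obtain A' where "A' \<in> sets borel" "A = Xc \<inter> A'" by (auto simp: sets_restrict_space)
    then have "A \<in> sets borel" by auto
    then show ?case by (rule sets_case)
  next
    case (mult u c)
    have "?L (\<lambda>x. c * u x) = c * ?L u"
      unfolding transfer_cmult by (rule nn_integral_cmult[OF tm[OF mult(2)]])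
    also have "\<dots> = ?R (\<lambda>x. c * u x)"
      using mult by (subst nn_integral_cmult) (auto simp: bm ac_simps)
    finally show ?case .
  next
    case (add u v)
    have "?L (\<lambda>x. v x + u x) = ?L v + ?L u"
      unfolding transfer_add using add by (intro nn_integral_add tm) auto
    also have "\<dots> = ?R (\<lambda>x. v x + u x)"
      using add by (subst nn_integral_add) (auto simp: bm distrib_left)
    finally show ?case .
  next
    case (seq U)
    have inc: "incseq (\<lambda>i. transfer UNIV (U i))"
      using seq by (auto simp: incseq_def le_fun_def intro!: transfer_mono)
    have S: "Sup (range U) = (\<lambda>y. SUP i. U i y)" by (auto simp: image_image)
    have "?L (\<lambda>y. SUP i. U i y) = (SUP i. ?L (U i))"
      unfolding transfer_SUP[OF \<open>incseq U\<close>] using seq by (intro nn_integral_monotone_convergence_SUP inc tm) auto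
    also have "\<dots> = (SUP i. ?R (U i))" using seq by simp
    also have "\<dots> = ?R (\<lambda>y. SUP i. U i y)"
      using seq by (subst nn_integral_monotone_convergence_SUP) (auto simp: bm SUP_mult_left_ennreal)
    finally show ?case by (simp add: S image_image)
  qed
  then show thesis using that \<nu> by blast
qed

end

section \<open>Iterates of the dual eigenvalue equation\<close>

locale conformal_eigenmeasure = conformal_setting X \<rho> \<delta>\<^sub>0 C\<^sub>E\<^sub>S L\<^sub>E\<^sub>S \<delta> r \<phi> \<iota> Xc \<sigma>c \<phi>c
  for X \<rho> \<delta>\<^sub>0 C\<^sub>E\<^sub>S L\<^sub>E\<^sub>S \<delta> r \<phi> and \<iota> :: "(nat \<Rightarrow> int) \<Rightarrow> 'c::complete_space" and Xc \<sigma>c \<phi>c +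
  fixes \<nu> :: "'c measure"
  assumes prob_nu: "prob_space \<nu>"
    and sets_nu: "sets \<nu> = sets (restrict_space borel Xc)"
    and eigen: "\<And>f. f \<in> borel_measurable (restrict_space borel Xc) \<Longrightarrow>
      (\<integral>\<^sup>+x. transfer UNIV f x \<partial>\<nu>) = ennreal (exp P) * (\<integral>\<^sup>+x. f x \<partial>\<nu>)"
begin

sublocale prob_space \<nu> by (rule prob_nu)

lemma space_nu: "space \<nu> = Xc"
  using sets_eq_imp_space_eq[OF sets_nu] by (simp add: space_restrict_space)

lemma sets_nu_iff: "A \<in> sets \<nu> \<longleftrightarrow> A \<in> sets borel \<and> A \<subseteq> Xc"
  by (subst sets_nu, subst sets_restrict_space_iff) auto

lemma measurable_nu: "f \<in> borel_measurable \<nu> \<longleftrightarrow> f \<in> borel_measurable BX"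
  by (subst measurable_cong_sets[OF sets_nu refl]) (rule refl)

abbreviation "L \<equiv> transfer UNIV"

lemma L_funpow_measurable: "f \<in> borel_measurable BX \<Longrightarrow> (L ^^ n) f \<in> borel_measurable BX"
  by (induction n) (auto intro: transfer_measurable)

lemma eigen_funpow:
  assumes "f \<in> borel_measurable BX"
  shows "(\<integral>\<^sup>+x. (L ^^ n) f x \<partial>\<nu>) = ennreal (exp (real n * P)) * (\<integral>\<^sup>+x. f x \<partial>\<nu>)"
proof (induction n)
  case (Suc n)
  have "(\<integral>\<^sup>+x. (L ^^ Suc n) f x \<partial>\<nu>) = ennreal (exp P) * (\<integral>\<^sup>+x. (L ^^ n) f x \<partial>\<nu>)"
    using eigen[OF L_funpow_measurable[OF assms]] by simp
  also have "\<dots> = ennreal (exp (real (Suc n) * P)) * (\<integral>\<^sup>+x. f x \<partial>\<nu>)"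
  proof -
    have "exp (real (Suc n) * P) = exp P * exp (real n * P)"
      by (simp add: exp_add[symmetric] algebra_simps)
    then show ?thesis unfolding Suc by (simp add: ennreal_mult mult.assoc)
  qed
  finally show ?case .
qed simp

lemma L_funpow_cong:
  "x \<in> Xc \<Longrightarrow> (\<And>y. y \<in> Xc \<Longrightarrow> f y = g y) \<Longrightarrow> (L ^^ n) f x = (L ^^ n) g x"
proof (induction n arbitrary: x)
  case (Suc n)
  then show ?case by (auto intro!: transfer_cong)
qed simp

lemma L_comp_sigma: "x \<in> Xc \<Longrightarrow> L (\<lambda>y. g (\<sigma>c y) * f y) x = g x * L f x"
  unfolding transfer_def
  by (subst nn_integral_cmult[symmetric]) (auto intro!: nn_integral_cong simp: ac_simps)

text \<open>Since \<open>\<sigma>c\<close> undoes every branch, a factor composed with its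
  \<open>n\<close>-th iterate comes out of \<open>L ^^ n\<close>. With \<open>eigen_funpow\<close>
  this identifies \<open>(L ^^ n) (\<lambda>_. 1)\<close> divided by \<open>exp (real n * P)\<close>
  as the density of the image of \<open>\<nu>\<close> under the \<open>n\<close>-th iterate.\<close>

lemma L_funpow_comp_sigma: "x \<in> Xc \<Longrightarrow> (L ^^ n) (\<lambda>y. g ((\<sigma>c ^^ n) y) * f y) x = g x * (L ^^ n) f x"
proof (induction n arbitrary: f)
  case (Suc n)
  have "(L ^^ Suc n) (\<lambda>y. g ((\<sigma>c ^^ Suc n) y) * f y) x = (L ^^ n) (L (\<lambda>y. g ((\<sigma>c ^^ n) (\<sigma>c y)) * f y)) x"
    by (simp add: funpow_swap1)
  also have "\<dots> = (L ^^ n) (\<lambda>y. g ((\<sigma>c ^^ n) y) * L f y) x"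
    using Suc.prems by (intro L_funpow_cong L_comp_sigma)
  also have "\<dots> = g x * (L ^^ Suc n) f x"
    using Suc by (simp add: funpow_swap1)
  finally show ?case .
qed simp

text \<open>Of the sum over all words of length \<open>p\<close> only the prefix of \<open>a\<close>
  is kept.\<close>

lemma L_iota_ge:
  assumes "a \<in> X"
  shows "ennreal (exp (birkhoff_sum \<phi> p a)) * f (\<iota> a) \<le> (L ^^ p) f (\<iota> (suffix p a))"
proof (induction p)
  case 0
  then show ?case by (simp add: birkhoff_sum_def)
next
  case (Suc p)
  let ?b = "suffix p a"
  have b: "?b \<in> X" using assms by simp
  have k: "?b 0 ## suffix (Suc p) a = ?b" using build_shift[of ?b] by (simp add: shift_def suffix_def)
  have bS: "suffix (Suc p) a \<in> X" using assms by simp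
  have "branch (?b 0) (\<iota> (suffix (Suc p) a)) = \<iota> ?b" by (simp only: branch_iota[OF bS] k)
  then have "ennreal (exp (\<phi> ?b)) * (L ^^ p) f (\<iota> ?b)
      = ennreal (exp (\<phi>c (branch (?b 0) (\<iota> (suffix (Suc p) a))))) * (L ^^ p) f (branch (?b 0) (\<iota> (suffix (Suc p) a)))"
    by (simp only: phic(2)[OF b])
  also have "\<dots> \<le> L ((L ^^ p) f) (\<iota> (suffix (Suc p) a))"
    unfolding transfer_def[of UNIV "(L ^^ p) f"]
    by (rule nn_integral_ge_point[of "?b 0" UNIV "\<lambda>k. ennreal (exp (\<phi>c (branch k (\<iota> (suffix (Suc p) a)))))
        * (L ^^ p) f (branch k (\<iota> (suffix (Suc p) a)))"]) simp
  finally have ge: "ennreal (exp (\<phi> ?b)) * (L ^^ p) f (\<iota> ?b) \<le> L ((L ^^ p) f) (\<iota> (suffix (Suc p) a))" .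
  have "ennreal (exp (birkhoff_sum \<phi> (Suc p) a)) * f (\<iota> a)
      = ennreal (exp (\<phi> ?b)) * (ennreal (exp (birkhoff_sum \<phi> p a)) * f (\<iota> a))"
    by (simp add: birkhoff_sum_def shift_funpow exp_add ennreal_mult ac_simps)
  also have "\<dots> \<le> ennreal (exp (\<phi> ?b)) * (L ^^ p) f (\<iota> ?b)"
    by (intro mult_left_mono Suc) simp
  also have "\<dots> \<le> (L ^^ Suc p) f (\<iota> (suffix (Suc p) a))"
    unfolding funpow.simps comp_apply by (rule ge)
  finally show ?case .
qed

subsection \<open>Bounded iterates\<close>

text \<open>Two points of a ball are compared through an orbit segment joining them. Starting from
  \<open>a\<close> near \<open>x\<close>, keep its first \<open>k\<close> letters and continue with
  a point \<open>e\<close>, provided by the connection property, that is shifted to some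
  \<open>b\<close> near \<open>y\<close>. The resulting \<open>a'\<close> is near \<open>a\<close>
  and arrives at \<open>b\<close> after \<open>p = k + n1\<close> shifts, so
  \<open>L_iota_ge\<close> bounds the iterate at \<open>a'\<close> by a later iterate at
  \<open>b\<close>.\<close>

lemma L_funpow_connect:
  assumes R: "R > 0"
  obtains c p where "c > 0" "\<And>n x y. \<lbrakk>x \<in> Xc; y \<in> Xc; dist (\<iota> zero_seq) x \<le> R; dist (\<iota> zero_seq) y \<le> R\<rbrakk>
     \<Longrightarrow> (L ^^ n) (\<lambda>_. 1) x \<le> ennreal c * (L ^^ (n + p)) (\<lambda>_. 1) y"
proof -
  define K where "K s = {b \<in> Xc. dist (\<iota> zero_seq) b \<le> s}" for s
  have K: "compact (K s)" if "s > 0" for s unfolding K_def by (rule proper[OF that])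
  have KX: "K s \<subseteq> Xc" for s by (auto simp: K_def)
  \<comment> \<open>The bound 1 keeps \<open>a\<close> and \<open>b\<close> within
    \<open>R + 1\<close> and the joining point \<open>a'\<close> within
    \<open>R + 2\<close>.\<close>
  define d where "d = min \<delta>\<^sub>1 1"
  have d: "d > 0" "d \<le> \<delta>\<^sub>1" "d \<le> 1" using delta1_pos by (auto simp: d_def)
  have "(\<lambda>k. C\<^sub>E\<^sub>S * (1 / L\<^sub>E\<^sub>S) ^ k * \<delta>\<^sub>0) \<longlonglongrightarrow> C\<^sub>E\<^sub>S * 0 * \<delta>\<^sub>0"
    using L_ES_gt_1 by (intro tendsto_mult tendsto_const LIMSEQ_power_zero) simp
  then have "\<forall>\<^sub>F k in sequentially. C\<^sub>E\<^sub>S * (1 / L\<^sub>E\<^sub>S) ^ k * \<delta>\<^sub>0 < d"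
    using d by (intro order_tendstoD(2)) auto
  \<comment> \<open>The connection property only yields a distance below
    \<open>\<delta>\<^sub>0\<close>; \<open>k\<close> common letters contract this below the scale
    \<open>d\<close> of the distortion estimate.\<close>
  then obtain k where k: "C\<^sub>E\<^sub>S * (1 / L\<^sub>E\<^sub>S) ^ k * \<delta>\<^sub>0 < d" by (auto simp: eventually_sequentially)
  have "compact ((\<sigma>c ^^ k) ` K (R + 1))"
    using R by (intro compact_continuous_image K continuous_on_subset[OF sigma_funpow_continuous KX]) simp
  then have "bounded ((\<sigma>c ^^ k) ` K (R + 1))" by (rule compact_imp_bounded)
  then obtain R' where R': "\<And>x. x \<in> K (R + 1) \<Longrightarrow> dist (\<iota> zero_seq) ((\<sigma>c ^^ k) x) \<le> R'"
    unfolding bounded_any_center[where a = "\<iota> zero_seq"] by auto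
  \<comment> \<open>The \<open>k\<close>-th image of \<open>a\<close> may leave the ball, so the
    connection property is applied to an open ball that contains these images as well.\<close>
  define S where "S = max R' (R + 1) + 1"
  have "S > 0" using R by (simp add: S_def)
  then obtain n1 where n1: "\<And>a. a \<in> mball zero_seq S \<Longrightarrow> mball zero_seq S \<subseteq> (shift ^^ n1) ` mball a \<delta>\<^sub>0"
    using connection by blast
  define p where "p = k + n1"
  have "continuous_on Xc (\<lambda>x. \<Sum>j<p. \<phi>c ((\<sigma>c ^^ j) x))"
    by (intro continuous_on_sum continuous_on_compose2[OF phic(1) sigma_funpow_continuous]) auto
  then have "bounded ((\<lambda>x. \<Sum>j<p. \<phi>c ((\<sigma>c ^^ j) x)) ` K (R + 2))"
    using R by (intro compact_imp_bounded compact_continuous_image K continuous_on_subset[OF _ KX]) auto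
  then obtain B where B: "\<And>x. x \<in> K (R + 2) \<Longrightarrow> \<bar>\<Sum>j<p. \<phi>c ((\<sigma>c ^^ j) x)\<bar> \<le> B"
    by (auto simp: bounded_iff)
  have le: "(L ^^ n) (\<lambda>_. 1) x \<le> ennreal (D * D * exp B * D) * (L ^^ (n + p)) (\<lambda>_. 1) y"
    if x: "x \<in> Xc" "dist (\<iota> zero_seq) x \<le> R" and y: "y \<in> Xc" "dist (\<iota> zero_seq) y \<le> R" for n x y
  proof -
    obtain a where a: "a \<in> X" "dist (\<iota> a) x < d"
      using x(1) d(1) unfolding Xc_eq closure_approachable by auto
    obtain b where b: "b \<in> X" "dist (\<iota> b) y < d"
      using y(1) d(1) unfolding Xc_eq closure_approachable by auto
    have aK: "\<iota> a \<in> K (R + 1)" "\<iota> b \<in> K (R + 1)"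
      using a b x(2) y(2) d(3) dist_triangle2[of "\<iota> zero_seq" "\<iota> a" x] dist_triangle2[of "\<iota> zero_seq" "\<iota> b" y]
      by (auto simp: K_def)
    have "dist (\<iota> zero_seq) (\<iota> (suffix k a)) \<le> R'"
      using R'[OF aK(1)] a(1) by (simp add: sigma_funpow_iota)
    then have "suffix k a \<in> mball zero_seq S" using a(1) by (simp add: S_def iota_dist)
    moreover have "b \<in> mball zero_seq S" using aK(2) b(1) by (simp add: S_def K_def iota_dist)
    ultimately obtain e where e: "e \<in> mball (suffix k a) \<delta>\<^sub>0" "(shift ^^ n1) e = b" using n1 by blast
    define a' where "a' = prefix k a \<frown> e"
    have eX: "e \<in> X" "\<rho> (suffix k a) e < \<delta>\<^sub>0" using e by auto
    have a'X: "a' \<in> X" using eX by (simp add: a'_def)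
    have "\<rho> a a' \<le> C\<^sub>E\<^sub>S * (1 / L\<^sub>E\<^sub>S) ^ k * \<rho> (suffix k a) e"
      using expansion_le(1)[OF _ eX, of "prefix k a"] a(1) prefix_suffix[of a k] by (simp add: a'_def)
    also have "\<dots> \<le> C\<^sub>E\<^sub>S * (1 / L\<^sub>E\<^sub>S) ^ k * \<delta>\<^sub>0"
      using eX C_ES_pos L_ES_gt_1 by (intro mult_left_mono) auto
    finally have aa': "dist (\<iota> a) (\<iota> a') < d" using k a(1) a'X by (simp add: iota_dist)
    have "\<iota> a' \<in> K (R + 2)"
      using aK(1) a'X aa' d(3) dist_triangle[of "\<iota> zero_seq" "\<iota> a'" "\<iota> a"] by (auto simp: K_def)
    then have "\<bar>birkhoff_sum \<phi> p a'\<bar> \<le> B"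
      using B[of "\<iota> a'"] a'X by (simp add: birkhoff_sum_def sigma_funpow_iota shift_funpow phic)
    then have "1 \<le> exp B * exp (birkhoff_sum \<phi> p a')" by (simp flip: exp_add)
    then have one: "1 \<le> ennreal (exp B) * ennreal (exp (birkhoff_sum \<phi> p a'))"
      by (simp flip: ennreal_mult)
    have sa': "suffix p a' = b"
    proof -
      have "suffix k a' = e" unfolding a'_def using suffix_conc_length[of "prefix k a" e] by simp
      then have "suffix n1 (suffix k a') = b" using e(2) by (simp add: shift_funpow)
      then show ?thesis by (simp add: p_def)
    qed
    let ?I = "\<lambda>n x. (L ^^ n) (\<lambda>_. 1) x"
    \<comment> \<open>One factor \<open>D\<close> for each of the moves from \<open>x\<close> to
      \<open>a\<close>, from \<open>a\<close> to \<open>a'\<close> and from \<open>b\<close> to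
      \<open>y\<close>; \<open>exp B\<close> pays for the orbit segment from \<open>a'\<close> to
      \<open>b\<close>.\<close>
    have "?I n x \<le> ennreal D * ?I n (\<iota> a)"
      using x a d by (intro transfer_funpow_distortion) (auto simp: dist_commute)
    also have "?I n (\<iota> a) \<le> ennreal D * ?I n (\<iota> a')"
      using a a'X aa' d by (intro transfer_funpow_distortion) auto
    also have "?I n (\<iota> a') \<le> ennreal (exp B) * (ennreal (exp (birkhoff_sum \<phi> p a')) * ?I n (\<iota> a'))"
      using mult_right_mono[OF one, of "?I n (\<iota> a')"] by (simp add: mult.assoc)
    also have "ennreal (exp (birkhoff_sum \<phi> p a')) * ?I n (\<iota> a') \<le> ?I (n + p) (\<iota> b)"
      using L_iota_ge[OF a'X, of p "?I n"] sa' by (simp add: funpow_add add.commute[of n])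
    also have "?I (n + p) (\<iota> b) \<le> ennreal D * ?I (n + p) y"
      using y b d by (intro transfer_funpow_distortion) auto
    finally have "?I n x \<le> ennreal D * (ennreal D * (ennreal (exp B) * (ennreal D * ?I (n + p) y)))"
      by (simp add: mult_left_mono)
    then show ?thesis using D_pos by (simp add: ennreal_mult mult.assoc)
  qed
  show thesis
    by (rule that[of "D * D * exp B * D" p]) (use D_pos le in auto)
qed

lemma far_measurable [measurable]: "far R \<in> sets borel"
proof -
  have "open (far R)" unfolding far_def by (intro open_Collect_less continuous_intros)
  then show ?thesis by simp
qed

lemma measurable_restrict_borel: "A \<in> sets borel \<Longrightarrow> indicator A \<in> borel_measurable BX"
  by (intro measurable_restrict_space1) auto

lemma emeasure_far_le: "emeasure \<nu> (far R \<inter> Xc) \<le> ennreal (exp (- P)) * tail_weight R"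
proof -
  have "ennreal (exp P) * emeasure \<nu> (far R \<inter> Xc) = ennreal (exp P) * (\<integral>\<^sup>+x. indicator (far R \<inter> Xc) x \<partial>\<nu>)"
    by (subst nn_integral_indicator) (auto simp: sets_nu_iff)
  also have "(\<integral>\<^sup>+x. indicator (far R \<inter> Xc) x \<partial>\<nu>) = (\<integral>\<^sup>+x. indicator (far R) x \<partial>\<nu>)"
    by (intro nn_integral_cong) (auto simp: space_nu indicator_def)
  also have "ennreal (exp P) * \<dots> = (\<integral>\<^sup>+x. L (indicator (far R)) x \<partial>\<nu>)"
    by (rule eigen[symmetric]) (rule measurable_restrict_borel[OF far_measurable])
  also have "\<dots> \<le> (\<integral>\<^sup>+x. tail_weight R \<partial>\<nu>)"
    using transfer_far_le[of _ "\<lambda>_. 1" 1 UNIV R] by (intro nn_integral_mono) (auto simp: space_nu)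
  also have "\<dots> = tail_weight R" by (simp add: emeasure_space_1)
  finally have "ennreal (exp (- P)) * (ennreal (exp P) * emeasure \<nu> (far R \<inter> Xc)) \<le> ennreal (exp (- P)) * tail_weight R"
    by (rule mult_left_mono) simp
  then show ?thesis by (simp add: mult.assoc[symmetric] ennreal_mult[symmetric] exp_minus)
qed

lemma emeasure_far_tendsto: "((\<lambda>R. emeasure \<nu> (far R \<inter> Xc)) \<longlongrightarrow> 0) at_top"
proof (rule tendsto_sandwich[OF _ _ tendsto_const])
  show "((\<lambda>R. ennreal (exp (- P)) * tail_weight R) \<longlongrightarrow> 0) at_top"
    using tendsto_mult_ennreal[OF tendsto_const tail_weight_tendsto, of "ennreal (exp (- P))"] by simp
qed (auto intro!: always_eventually emeasure_far_le)

text \<open>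
  Near \<open>zero_seq\<close> the normalised iterates of \<open>1\<close> are comparable and have \<open>\<nu>\<close>-integral \<open>1\<close>;
  far away, the branches that stay far carry at most half of the weight.
\<close>

lemma L_funpow_one_bounded:
  obtains C where "C > 0" "\<And>n x. x \<in> Xc \<Longrightarrow> (L ^^ n) (\<lambda>_. 1) x \<le> ennreal (C * exp (real n * P))"
proof -
  have "\<forall>\<^sub>F R in at_top. tail_weight R < ennreal (exp P / 2)"
    using tail_weight_tendsto by (rule order_tendstoD(2)) simp
  then have "\<forall>\<^sub>F R in at_top. R > 0 \<and> tail_weight R < ennreal (exp P / 2)"
    using eventually_gt_at_top[of "0::real"] by eventually_elim simp
  \<comment> \<open>This choice serves twice: by the eigenvalue equation the closed ball has mass at
    least 1/2, and in the induction the branches that end far away contribute at most half of the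
    growth \<open>exp P\<close>.\<close>
  then obtain R where R: "R > 0" "tail_weight R < ennreal (exp P / 2)"
    by (auto dest!: eventually_happens)
  let ?K = "{b \<in> Xc. dist (\<iota> zero_seq) b \<le> R}"
  let ?I = "\<lambda>n x. (L ^^ n) (\<lambda>_. 1) x"
  have K: "?K \<in> sets \<nu>"
    using compact_imp_closed[OF proper[OF R(1)]] by (auto simp: sets_nu_iff)
  have "emeasure \<nu> (far R \<inter> Xc) \<le> ennreal (exp (- P)) * ennreal (exp P / 2)"
    by (rule order_trans[OF emeasure_far_le mult_left_mono[OF less_imp_le[OF R(2)]]]) simp
  also have "\<dots> = ennreal (1 / 2)" by (simp add: ennreal_mult[symmetric] exp_minus)
  finally have "ennreal (prob (far R \<inter> Xc)) \<le> ennreal (1 / 2)" by (simp only: emeasure_eq_measure)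
  then have "prob (far R \<inter> Xc) \<le> 1 / 2" by (subst (asm) ennreal_le_iff) auto
  moreover have "?K = space \<nu> - far R \<inter> Xc" by (auto simp: space_nu far_def)
  ultimately have half: "prob ?K \<ge> 1 / 2" by (simp add: prob_compl sets_nu_iff)
  obtain c p where c: "c > 0" and cp: "\<And>n x y. \<lbrakk>x \<in> Xc; y \<in> Xc; dist (\<iota> zero_seq) x \<le> R; dist (\<iota> zero_seq) y \<le> R\<rbrakk>
     \<Longrightarrow> ?I n x \<le> ennreal c * ?I (n + p) y"
    using L_funpow_connect[OF R(1)] by blast
  define A where "A = 2 * c * exp (real p * P)"
  have A: "A > 0" using c by (simp add: A_def)
  \<comment> \<open>Average the comparison with the iterate of order \<open>n + p\<close> at
    \<open>y\<close> over \<open>y\<close> in the ball. The ball has mass at least 1/2, and the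
    later iterate has total integral \<open>exp (real (n + p) * P)\<close>; this is the origin of
    \<open>A\<close>.\<close>
  have near: "?I n x \<le> ennreal (A * exp (real n * P))" if x: "x \<in> ?K" for n x
  proof -
    have "ennreal (1 / 2) \<le> emeasure \<nu> ?K"
      unfolding emeasure_eq_measure using half by (rule ennreal_leI)
    then have "?I n x * ennreal (1 / 2) \<le> ?I n x * emeasure \<nu> ?K"
      by (rule mult_left_mono) simp
    also have "\<dots> = (\<integral>\<^sup>+y. ?I n x * indicator ?K y \<partial>\<nu>)"
      using K by (subst nn_integral_cmult_indicator) auto
    also have "\<dots> \<le> (\<integral>\<^sup>+y. ennreal c * ?I (n + p) y \<partial>\<nu>)"
      using x by (intro nn_integral_mono) (auto simp: indicator_def intro!: cp)
    also have "\<dots> = ennreal c * (\<integral>\<^sup>+y. ?I (n + p) y \<partial>\<nu>)"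
      by (intro nn_integral_cmult) (simp add: measurable_nu L_funpow_measurable)
    also have "\<dots> = ennreal (c * exp (real (n + p) * P))"
      using c by (subst eigen_funpow) (auto simp: emeasure_space_1 ennreal_mult)
    finally have "ennreal 2 * (?I n x * ennreal (1 / 2)) \<le> ennreal 2 * ennreal (c * exp (real (n + p) * P))"
      by (rule mult_left_mono) simp
    moreover have "ennreal 2 * (?I n x * ennreal (1 / 2)) = ?I n x"
      by (subst mult.left_commute, subst ennreal_mult[symmetric]) auto
    moreover have "ennreal 2 * ennreal (c * exp (real (n + p) * P)) = ennreal (A * exp (real n * P))"
      using c by (subst ennreal_mult[symmetric]) (auto simp: A_def exp_add[symmetric] algebra_simps)
    ultimately show ?thesis by simp
  qed
  \<comment> \<open>Chosen so that \<open>C * exp P / 2 + mass_real * A\<close> is at most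
    \<open>C * exp P\<close>, which is the inequality of the induction step; the maximum with 1
    starts the induction.\<close>
  define C where "C = max 1 (2 * exp (- P) * mass_real * A)"
  have C: "C \<ge> 1" "mass_real * A \<le> C * exp P / 2"
  proof -
    have "2 * exp (- P) * mass_real * A \<le> C" by (simp add: C_def)
    then show "mass_real * A \<le> C * exp P / 2" by (simp add: exp_minus field_simps)
  qed (simp add: C_def)
  have "?I n x \<le> ennreal (C * exp (real n * P))" if "x \<in> Xc" for n x
    using that
  proof (induction n arbitrary: x)
    case 0
    then show ?case using C by simp
  next
    case (Suc n)
    let ?E = "exp (real n * P)"
    have "?I (Suc n) x = L (\<lambda>y. ?I n y * indicator (far R) y + ?I n y * indicator (- far R) y) x"
      by (auto simp: indicator_def intro!: arg_cong[where f = "\<lambda>f. L f x"])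
    also have "\<dots> = L (\<lambda>y. ?I n y * indicator (far R) y) x + L (\<lambda>y. ?I n y * indicator (- far R) y) x"
      by (rule transfer_add)
    also have "L (\<lambda>y. ?I n y * indicator (far R) y) x \<le> tail_weight R * ennreal (C * ?E)"
      by (intro transfer_far_le Suc)
    also have "L (\<lambda>y. ?I n y * indicator (- far R) y) x \<le> mass * ennreal (A * ?E)"
      using Suc.prems near[of "branch _ x" n] by (intro transfer_le_M) (auto simp: indicator_def far_def)
    also have "tail_weight R * ennreal (C * ?E) \<le> ennreal (exp P / 2) * ennreal (C * ?E)"
      using R(2) by (intro mult_right_mono) auto
    also have "ennreal (exp P / 2) * ennreal (C * ?E) + mass * ennreal (A * ?E) = ennreal (exp P / 2 * (C * ?E) + mass_real * (A * ?E))"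
    proof -
      have 1: "ennreal (exp P / 2) * ennreal (C * ?E) = ennreal (exp P / 2 * (C * ?E))"
        using C(1) by (intro ennreal_mult[symmetric]) auto
      have 2: "mass * ennreal (A * ?E) = ennreal (mass_real * (A * ?E))"
        unfolding mass_eq using A mass_real_nonneg by (intro ennreal_mult[symmetric]) auto
      show ?thesis unfolding 1 2 using C(1) A mass_real_nonneg by (intro ennreal_plus[symmetric]) auto
    qed
    also have "\<dots> \<le> ennreal (C * exp (real (Suc n) * P))"
    proof (rule ennreal_leI)
      have "mass_real * (A * ?E) \<le> (C * exp P / 2) * ?E"
        using mult_right_mono[OF C(2), of ?E] by (simp add: mult.assoc)
      moreover have "exp (real (Suc n) * P) = exp P * ?E" by (simp add: exp_add[symmetric] algebra_simps)
      then have "C * exp (real (Suc n) * P) = C * exp P / 2 * ?E + C * exp P / 2 * ?E"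
        "exp P / 2 * (C * ?E) = C * exp P / 2 * ?E" by simp_all
      ultimately show "exp P / 2 * (C * ?E) + mass_real * (A * ?E) \<le> C * exp (real (Suc n) * P)"
        by linarith
    qed
    finally show ?case by (simp add: add_mono)
  qed
  then show thesis using that[of C] C(1) by simp
qed

text \<open>The image of \<open>\<nu>\<close> under every iterate has a density bounded by the same
  \<open>C\<close>, so all these images are tight together. This takes the place of
  invariance.\<close>

lemma emeasure_sigma_far_le:
  obtains C where "C > 0"
    "\<And>n R. emeasure \<nu> {x \<in> Xc. (\<sigma>c ^^ n) x \<in> far R} \<le> ennreal C * emeasure \<nu> (far R \<inter> Xc)"
proof -
  obtain C where C: "C > 0" "\<And>n x. x \<in> Xc \<Longrightarrow> (L ^^ n) (\<lambda>_. 1) x \<le> ennreal (C * exp (real n * P))"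
    using L_funpow_one_bounded by blast
  have "emeasure \<nu> {x \<in> Xc. (\<sigma>c ^^ n) x \<in> far R} \<le> ennreal C * emeasure \<nu> (far R \<inter> Xc)" for n R
  proof -
    let ?g = "\<lambda>x. indicator (far R) ((\<sigma>c ^^ n) x) :: ennreal"
    have sm: "(\<sigma>c ^^ n) \<in> BX \<rightarrow>\<^sub>M borel"
      by (rule borel_measurable_continuous_on_Xc[OF sigma_funpow_continuous])
    have gm: "?g \<in> borel_measurable BX"
      by (rule measurable_compose[OF sm]) simp
    have set: "{x \<in> Xc. (\<sigma>c ^^ n) x \<in> far R} \<in> sets \<nu>"
      using measurable_sets[OF sm far_measurable[of R]] unfolding sets_nu
      by (simp add: space_restrict_space vimage_def Int_def conj_commute)
    have "emeasure \<nu> {x \<in> Xc. (\<sigma>c ^^ n) x \<in> far R} = (\<integral>\<^sup>+x. indicator {x \<in> Xc. (\<sigma>c ^^ n) x \<in> far R} x \<partial>\<nu>)"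
      using set by (rule nn_integral_indicator[symmetric])
    also have "\<dots> = (\<integral>\<^sup>+x. ?g x \<partial>\<nu>)"
      by (intro nn_integral_cong) (simp add: space_nu indicator_def)
    finally have "ennreal (exp (real n * P)) * emeasure \<nu> {x \<in> Xc. (\<sigma>c ^^ n) x \<in> far R}
      = ennreal (exp (real n * P)) * (\<integral>\<^sup>+x. ?g x \<partial>\<nu>)"
      by simp
    also have "\<dots> = (\<integral>\<^sup>+x. (L ^^ n) (\<lambda>x. ?g x * 1) x \<partial>\<nu>)"
      using gm by (simp add: eigen_funpow)
    also have "\<dots> = (\<integral>\<^sup>+x. indicator (far R) x * (L ^^ n) (\<lambda>_. 1) x \<partial>\<nu>)"
      by (intro nn_integral_cong L_funpow_comp_sigma) (simp add: space_nu)
    also have "\<dots> \<le> (\<integral>\<^sup>+x. ennreal (C * exp (real n * P)) * indicator (far R \<inter> Xc) x \<partial>\<nu>)"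
      by (intro nn_integral_mono) (auto simp: space_nu indicator_def C)
    also have "\<dots> = ennreal (exp (real n * P)) * (ennreal C * emeasure \<nu> (far R \<inter> Xc))"
      using C(1) by (subst nn_integral_cmult_indicator) (auto simp: sets_nu_iff ennreal_mult ac_simps)
    finally show ?thesis
      by (subst (asm) ennreal_mult_le_mult_iff) auto
  qed
  then show thesis using that C(1) by blast
qed

subsection \<open>Recurrence\<close>

definition visits :: "real \<Rightarrow> 'c \<Rightarrow> nat set" where
  "visits R x = {j. (\<sigma>c ^^ j) x \<notin> far R}"

definition frequency :: "real \<Rightarrow> nat \<Rightarrow> 'c \<Rightarrow> ennreal" where
  "frequency R n x = ennreal (1 / real n) * (\<Sum>j<n. indicator (- far R) ((\<sigma>c ^^ j) x))"

lemma frequency_eq: "frequency R n x = ennreal (real (card (visits R x \<inter> {..<n})) / real n)"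
proof -
  have "(\<Sum>j<n. indicator (- far R) ((\<sigma>c ^^ j) x) :: ennreal) = (\<Sum>j\<in>visits R x \<inter> {..<n}. 1)"
    by (rule sum.mono_neutral_cong_right) (auto simp: visits_def)
  also have "\<dots> = ennreal (real (card (visits R x \<inter> {..<n})))" by (simp add: ennreal_of_nat_eq_real_of_nat)
  finally show ?thesis unfolding frequency_def by (simp add: ennreal_mult[symmetric])
qed

lemma frequency_le_1: "frequency R n x \<le> 1"
proof -
  have "card (visits R x \<inter> {..<n}) \<le> card {..<n}" by (intro card_mono) auto
  then have "real (card (visits R x \<inter> {..<n})) / real n \<le> 1" by (cases "n = 0") auto
  then show ?thesis unfolding frequency_eq by simp
qed

lemma sigma_funpow_measurable_nu: "(\<sigma>c ^^ n) \<in> borel_measurable \<nu>"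
  unfolding measurable_nu by (rule borel_measurable_continuous_on_Xc[OF sigma_funpow_continuous])

lemma indicator_sigma_measurable:
  "A \<in> sets borel \<Longrightarrow> (\<lambda>x. indicator A ((\<sigma>c ^^ n) x) :: ennreal) \<in> borel_measurable \<nu>"
  by (rule measurable_compose[OF sigma_funpow_measurable_nu]) simp

lemma frequency_measurable: "frequency R n \<in> borel_measurable \<nu>"
  unfolding frequency_def[abs_def]
  by (intro borel_measurable_times_ennreal borel_measurable_const borel_measurable_sum indicator_sigma_measurable) simp

text \<open>The mean frequency of visits to a large ball is close to 1 uniformly in time, and the
  reverse Fatou lemma with dominating function 1 moves this to the limsup. The limsup is at most 1
  and vanishes off \<open>E m\<close>, so its integral is at most \<open>prob (E m)\<close>.\<close>

lemma AE_positive_frequency: "AE x in \<nu>. \<exists>R>0. 0 < limsup (\<lambda>n. frequency R n x)"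
proof -
  obtain C where C: "C > 0"
    "\<And>n R. emeasure \<nu> {x \<in> Xc. (\<sigma>c ^^ n) x \<in> far R} \<le> ennreal C * emeasure \<nu> (far R \<inter> Xc)"
    using emeasure_sigma_far_le by blast
  define E where "E m = {x \<in> space \<nu>. 0 < limsup (\<lambda>n. frequency (real (Suc m)) n x)}" for m
  have lim_meas: "(\<lambda>x. limsup (\<lambda>n. frequency R n x)) \<in> borel_measurable \<nu>" for R
    by (rule borel_measurable_limsup[OF frequency_measurable])
  have E: "E m \<in> events" for m
    unfolding E_def using lim_meas[of "real (Suc m)"] by measurable
  have prob_E: "prob (E m) \<ge> 1 - C * prob (far (real (Suc m)) \<inter> Xc)" for m
  proof -
    let ?R = "real (Suc m)"
    let ?e = "C * prob (far ?R \<inter> Xc)"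
    have one: "ennreal (1 - ?e) \<le> (\<integral>\<^sup>+x. indicator (- far ?R) ((\<sigma>c ^^ j) x) \<partial>\<nu>)" for j
    proof -
      let ?S = "{x \<in> space \<nu>. (\<sigma>c ^^ j) x \<in> far ?R}"
      have S: "?S \<in> events"
        using measurable_sets[OF sigma_funpow_measurable_nu far_measurable, of j ?R]
        by (simp add: vimage_def Int_def conj_commute)
      have "ennreal (prob ?S) \<le> ennreal C * ennreal (prob (far ?R \<inter> Xc))"
        using C(2)[of j ?R] by (simp add: emeasure_eq_measure space_nu)
      then have "prob ?S \<le> ?e" using C(1) by (simp add: ennreal_mult[symmetric])
      then have "1 - ?e \<le> prob (space \<nu> - ?S)" using S by (simp add: prob_compl)
      then have "ennreal (1 - ?e) \<le> emeasure \<nu> (space \<nu> - ?S)"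
        unfolding emeasure_eq_measure by (rule ennreal_leI)
      also have "\<dots> = (\<integral>\<^sup>+x. indicator (space \<nu> - ?S) x \<partial>\<nu>)" using S by simp
      also have "\<dots> = (\<integral>\<^sup>+x. indicator (- far ?R) ((\<sigma>c ^^ j) x) \<partial>\<nu>)"
        by (intro nn_integral_cong) (auto simp: indicator_def)
      finally show ?thesis .
    qed
    have avg: "ennreal (1 - ?e) \<le> (\<integral>\<^sup>+x. frequency ?R n x \<partial>\<nu>)" if "n \<ge> 1" for n
    proof -
      have "ennreal (1 - ?e) = ennreal (1 / real n) * (\<Sum>j<n. ennreal (1 - ?e))"
        using that by (simp add: ennreal_of_nat_eq_real_of_nat mult.assoc[symmetric] ennreal_mult[symmetric])
      also have "\<dots> \<le> ennreal (1 / real n) * (\<Sum>j<n. \<integral>\<^sup>+x. indicator (- far ?R) ((\<sigma>c ^^ j) x) \<partial>\<nu>)"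
        by (intro mult_left_mono sum_mono one) simp
      also have "\<dots> = (\<integral>\<^sup>+x. frequency ?R n x \<partial>\<nu>)"
        unfolding frequency_def
        by (subst nn_integral_cmult, intro borel_measurable_sum indicator_sigma_measurable, simp,
            subst nn_integral_sum, intro indicator_sigma_measurable, simp, rule refl)
      finally show ?thesis .
    qed
    have "ennreal (1 - ?e) \<le> liminf (\<lambda>n. \<integral>\<^sup>+x. frequency ?R n x \<partial>\<nu>)"
      by (rule Liminf_bounded) (use avg in \<open>auto intro!: eventually_sequentiallyI[of 1]\<close>)
    also have "\<dots> \<le> limsup (\<lambda>n. \<integral>\<^sup>+x. frequency ?R n x \<partial>\<nu>)"
      by (rule Liminf_le_Limsup) simp
    also have "\<dots> \<le> (\<integral>\<^sup>+x. limsup (\<lambda>n. frequency ?R n x) \<partial>\<nu>)"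
      by (rule nn_integral_limsup[where w = "\<lambda>_. 1"])
         (auto simp: frequency_le_1 emeasure_space_1 intro: frequency_measurable)
    also have "\<dots> \<le> (\<integral>\<^sup>+x. indicator (E m) x \<partial>\<nu>)"
    proof (intro nn_integral_mono)
      fix x assume x: "x \<in> space \<nu>"
      have "limsup (\<lambda>n. frequency ?R n x) \<le> 1"
        by (rule Limsup_bounded) (auto simp: frequency_le_1)
      then show "limsup (\<lambda>n. frequency ?R n x) \<le> indicator (E m) x"
        using x by (cases "0 < limsup (\<lambda>n. frequency ?R n x)") (auto simp: E_def)
    qed
    also have "\<dots> = ennreal (prob (E m))" using E by (simp add: emeasure_eq_measure)
    finally show ?thesis by (cases "1 - ?e \<ge> 0") (auto simp: measure_nonneg intro: order_trans)
  qed
  \<comment> \<open>The index \<open>n\<close> is a dummy here; what counts is that the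
    \<open>E k\<close> exhaust almost the whole space.\<close>
  have "AE x in \<nu>. \<exists>k. \<exists>\<^sub>\<infinity>n::nat. x \<in> E k"
  proof (rule AE_infinitely_often)
    fix e :: real assume e: "e > 0"
    have "\<forall>\<^sub>F R in at_top. emeasure \<nu> (far R \<inter> Xc) < ennreal (e / C)"
      using emeasure_far_tendsto e C(1) by (intro order_tendstoD(2)) auto
    then obtain R where R: "\<And>s. s \<ge> R \<Longrightarrow> emeasure \<nu> (far s \<inter> Xc) < ennreal (e / C)"
      by (auto simp: eventually_at_top_linorder)
    obtain m where "R \<le> real m" using real_arch_simple by blast
    then have "emeasure \<nu> (far (real (Suc m)) \<inter> Xc) < ennreal (e / C)" by (intro R) simp
    then have "prob (far (real (Suc m)) \<inter> Xc) < e / C"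
      unfolding emeasure_eq_measure by (subst (asm) ennreal_less_iff) auto
    then have "C * prob (far (real (Suc m)) \<inter> Xc) < e" using C(1) by (simp add: field_simps)
    then have "1 - e \<le> prob (E m)" using prob_E[of m] by linarith
    then show "\<exists>k. \<forall>n::nat. 1 - e \<le> prob (E k)" by blast
  qed (rule E)
  then show ?thesis
  proof eventually_elim
    case (elim x)
    then obtain m where "x \<in> E m" by (auto dest: INFM_EX)
    then show ?case by (intro exI[of _ "real (Suc m)"]) (simp add: E_def)
  qed
qed

lemma positive_frequency_visits:
  assumes "0 < limsup (\<lambda>n. frequency R n x)"
  obtains c where "c > 0" "\<exists>\<^sub>\<infinity>n. real (card (visits R x \<inter> {..<n})) > 2 * c * real n"
proof -
  obtain y where y: "0 < y" "y < limsup (\<lambda>n. frequency R n x)" using dense[OF assms] by blast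
  have "y < top" by (rule less_le_trans[OF y(2) top_greatest])
  then obtain c where c: "y = ennreal c" "c > 0"
    using y(1) by (cases y) auto
  have "\<exists>n\<ge>m. real (card (visits R x \<inter> {..<n})) > c * real n" for m
  proof (rule ccontr)
    assume "\<not> ?thesis"
    then have *: "real (card (visits R x \<inter> {..<n})) \<le> c * real n" if "n \<ge> m" for n using that by force
    have "\<forall>\<^sub>F n in sequentially. frequency R n x \<le> y"
    proof (rule eventually_sequentiallyI[of m])
      fix n assume "n \<ge> m"
      have "real (card (visits R x \<inter> {..<n})) / real n \<le> c"
        using *[OF \<open>n \<ge> m\<close>] c(2) by (cases "n = 0") (auto simp: field_simps)
      then show "frequency R n x \<le> y" unfolding frequency_eq c(1) by (rule ennreal_leI)
    qed
    then have "limsup (\<lambda>n. frequency R n x) \<le> y" by (rule Limsup_bounded)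
    then show False using y(2) by simp
  qed
  then have "\<exists>\<^sub>\<infinity>n. real (card (visits R x \<inter> {..<n})) > 2 * (c / 2) * real n"
    by (simp add: INFM_nat_le)
  then show thesis using that[of "c / 2"] c(2) by simp
qed

lemma escape_far:
  assumes "y \<in> Xc - \<iota> ` X" "R > 0"
  obtains N where "\<And>n. n \<ge> N \<Longrightarrow> (\<sigma>c ^^ n) y \<in> far R"
proof -
  obtain N where N: "\<forall>n\<ge>N. (\<sigma>c ^^ n) y \<in> Xc - {b \<in> Xc. dist (\<iota> zero_seq) b \<le> R}"
    using escape[OF assms(2,1)] by blast
  have "(\<sigma>c ^^ n) y \<in> far R" if "n \<ge> N" for n
    using N[rule_format, OF that] by (simp add: far_def not_le)
  then show thesis by (rule that)
qed

lemma infinite_visits: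
  assumes "R > 0" "0 < limsup (\<lambda>n. frequency R n x)"
  shows "infinite (visits R x)"
proof
  assume fin: "finite (visits R x)"
  obtain c where c: "c > 0" "\<exists>\<^sub>\<infinity>n. real (card (visits R x \<inter> {..<n})) > 2 * c * real n"
    using positive_frequency_visits[OF assms(2)] by blast
  obtain m where m: "real (card (visits R x)) / (2 * c) < real m" using reals_Archimedean2 by blast
  obtain n where n: "n \<ge> m" "real (card (visits R x \<inter> {..<n})) > 2 * c * real n"
    using c(2) by (auto simp: INFM_nat_le)
  have "real (card (visits R x \<inter> {..<n})) \<le> real (card (visits R x))"
    using fin by (intro of_nat_mono card_mono) auto
  also have "\<dots> < 2 * c * real m" using m c(1) by (simp add: field_simps)
  also have "\<dots> \<le> 2 * c * real n" using n(1) c(1) by simp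
  finally show False using n(2) by simp
qed

text \<open>
  By density, some accumulation point of the orbit itself returns to the ball infinitely often;
  points outside \<open>\<iota> ` X\<close> do not.
\<close>

lemma positive_frequency_radial:
  assumes x: "x \<in> Xc" and R: "R > 0" and freq: "0 < limsup (\<lambda>n. frequency R n x)"
  shows "x \<in> radial_set X \<iota> Xc \<sigma>c"
proof -
  let ?T = "visits R x"
  obtain c where c: "c > 0" "\<exists>\<^sub>\<infinity>n. real (card (?T \<inter> {..<n})) > 2 * c * real n"
    using positive_frequency_visits[OF freq] by blast
  \<comment> \<open>The index \<open>m\<close> is both the lower bound for the starting time and the
    length up to which the windows are dense, so a limit of the starting points sees dense windows
    of every length.\<close>
  have "\<forall>m. \<exists>j. j \<ge> m \<and> j \<in> ?T \<and> (\<forall>L. 1 \<le> L \<longrightarrow> L \<le> m \<longrightarrow> real (card (?T \<inter> {j..<j + L})) \<ge> c * real L)"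
    using positive_frequency_imp_dense_windows[OF c] by simp
  from choice[OF this] obtain j where j0: "\<forall>m. j m \<ge> m \<and> j m \<in> ?T \<and>
      (\<forall>L. 1 \<le> L \<longrightarrow> L \<le> m \<longrightarrow> real (card (?T \<inter> {j m..<j m + L})) \<ge> c * real L)" by blast
  then have j: "\<And>m. j m \<ge> m" "\<And>m. j m \<in> ?T"
    "\<And>m L. 1 \<le> L \<Longrightarrow> L \<le> m \<Longrightarrow> real (card (?T \<inter> {j m..<j m + L})) \<ge> c * real L"
    by simp_all
  define y where "y m = (\<sigma>c ^^ j m) x" for m
  let ?K = "{b \<in> Xc. dist (\<iota> zero_seq) b \<le> R}"
  have yK: "\<forall>m. y m \<in> ?K" using j(2) x by (auto simp: y_def visits_def far_def not_less)
  obtain z s where zs: "z \<in> ?K" "strict_mono s" "(y \<circ> s) \<longlonglongrightarrow> z"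
    by (rule seq_compactE[OF compact_imp_seq_compact[OF proper[OF R]] yK])
  have lim: "(\<lambda>m. y (s m)) \<longlonglongrightarrow> z" using zs(3) by (simp add: comp_def)
  have zX: "z \<in> Xc" using zs(1) by simp
  have "z \<in> closure {(\<sigma>c ^^ k) x |k. k \<ge> n}" for n
  proof (rule Lim_in_closed_set[OF closed_closure _ _ lim])
    show "\<forall>\<^sub>F m in sequentially. y (s m) \<in> closure {(\<sigma>c ^^ k) x |k. k \<ge> n}"
    proof (rule eventually_sequentiallyI[of n])
      fix m assume "m \<ge> n"
      then have "j (s m) \<ge> n" using seq_suble[OF zs(2), of m] j(1)[of "s m"] by linarith
      then have "y (s m) \<in> {(\<sigma>c ^^ k) x |k. k \<ge> n}" unfolding y_def by blast
      then show "y (s m) \<in> closure {(\<sigma>c ^^ k) x |k. k \<ge> n}" by (rule subsetD[OF closure_subset])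
    qed
  qed simp
  then have omega: "z \<in> omega_limit_set \<sigma>c x" by (simp add: omega_limit_set_def)
  have "z \<in> \<iota> ` X"
  proof (rule ccontr)
    assume "z \<notin> \<iota> ` X"
    then obtain N where N: "\<And>n. n \<ge> N \<Longrightarrow> (\<sigma>c ^^ n) z \<in> far R"
      using escape_far[of z R] zX R by blast
    \<comment> \<open>If \<open>z\<close> stayed far from time \<open>N\<close> on, nearby windows
      of length \<open>l\<close> would contain at most \<open>N\<close> visits, whereas density
      demands at least \<open>c * l > N\<close>.\<close>
    obtain l where l: "real N / c < real l" using reals_Archimedean2 by blast
    then have cl: "real N < c * real l" using c(1) by (simp add: field_simps)
    then have l1: "1 \<le> l" using c(1) by (cases l) auto
    \<comment> \<open>Openness of \<open>far R\<close> makes \<open>y (s m)\<close> follow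
      \<open>z\<close> at the finitely many times from \<open>N\<close> to
      \<open>l - 1\<close>.\<close>
    have "\<forall>\<^sub>F m in sequentially. (\<sigma>c ^^ i) (y (s m)) \<in> far R" if "i \<in> {N..<l}" for i
    proof -
      have "(\<lambda>m. (\<sigma>c ^^ i) (y (s m))) \<longlonglongrightarrow> (\<sigma>c ^^ i) z"
        using yK zX by (intro tendsto_on_Xc[OF sigma_funpow_continuous] lim) auto
      moreover have "open (far R)" unfolding far_def by (intro open_Collect_less continuous_intros)
      ultimately show ?thesis using N that by (intro topological_tendstoD) auto
    qed
    then have "\<forall>\<^sub>F m in sequentially. \<forall>i\<in>{N..<l}. (\<sigma>c ^^ i) (y (s m)) \<in> far R"
      by (intro eventually_ball_finite) auto
    moreover have "\<forall>\<^sub>F m in sequentially. m \<ge> l" by (rule eventually_ge_at_top)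
    ultimately have "\<forall>\<^sub>F m in sequentially. (\<forall>i\<in>{N..<l}. (\<sigma>c ^^ i) (y (s m)) \<in> far R) \<and> m \<ge> l"
      by eventually_elim blast
    from eventually_happens'[OF sequentially_bot this]
    obtain m where m: "\<forall>i\<in>{N..<l}. (\<sigma>c ^^ i) (y (s m)) \<in> far R" "m \<ge> l" by blast
    define q where "q = j (s m)"
    have "?T \<inter> {q..<q + l} \<subseteq> {q..<q + N}"
    proof
      fix k assume k: "k \<in> ?T \<inter> {q..<q + l}"
      show "k \<in> {q..<q + N}"
      proof (rule ccontr)
        assume "k \<notin> {q..<q + N}"
        then have "k - q \<in> {N..<l}" using k by auto
        then have "(\<sigma>c ^^ (k - q)) ((\<sigma>c ^^ q) x) \<in> far R" using m(1) by (simp add: y_def q_def)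
        moreover have "(\<sigma>c ^^ (k - q)) ((\<sigma>c ^^ q) x) = (\<sigma>c ^^ k) x"
          using k funpow_add[of "k - q" q \<sigma>c] by simp
        ultimately show False using k by (simp add: visits_def)
      qed
    qed
    then have "card (?T \<inter> {q..<q + l}) \<le> card {q..<q + N}" by (intro card_mono) auto
    moreover have "real (card (?T \<inter> {q..<q + l})) \<ge> c * real l"
      using j(3)[OF l1, of "s m"] m(2) seq_suble[OF zs(2), of m] by (simp add: q_def)
    ultimately show False using cl by simp
  qed
  then show ?thesis using omega x by (auto simp: radial_set_def)
qed

lemma AE_radial: "AE x in \<nu>. x \<in> radial_set X \<iota> Xc \<sigma>c"
  using AE_positive_frequency AE_space
proof eventually_elim
  case (elim x)
  then obtain R where "R > 0" "0 < limsup (\<lambda>n. frequency R n x)" by blast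
  then show ?case using elim(2) by (intro positive_frequency_radial) (simp_all add: space_nu)
qed

lemma emeasure_radial: "emeasure (completion \<nu>) (radial_set X \<iota> Xc \<sigma>c) = 1"
proof -
  let ?rad = "radial_set X \<iota> Xc \<sigma>c"
  obtain N where N: "N \<in> null_sets \<nu>" "{x \<in> space \<nu>. x \<notin> ?rad} \<subseteq> N"
    using AE_radial by (auto simp: eventually_ae_filter)
  have "Xc - ?rad \<subseteq> N" using N(2) by (auto simp: space_nu)
  then have null: "Xc - ?rad \<in> null_sets (completion \<nu>)"
    using null_sets_completion_subset[OF _ null_sets_completionI[OF N(1)]] by blast
  have Xc: "Xc \<in> sets \<nu>" by (simp add: sets_nu_iff)
  have "?rad = Xc - (Xc - ?rad)" by (auto simp: radial_set_def)
  then have "emeasure (completion \<nu>) ?rad = emeasure (completion \<nu>) Xc"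
    using emeasure_Diff_null_set[OF null, of Xc] Xc by simp
  also have "\<dots> = 1" using Xc emeasure_space_1 by (simp add: space_nu)
  finally show ?thesis .
qed

subsection \<open>Conformality\<close>

text \<open>A point outside the image of \<open>X\<close> has a whole orbit tail in
  \<open>far R\<close>, and each of its images shares this tail; infinitely many visits rule that
  out.\<close>

lemma recurrent_not_escaping:
  assumes R: "R > 0" and inf: "infinite (visits R x)" and y: "y \<in> Xc" "(\<sigma>c ^^ n) y = x"
  shows "y \<in> \<iota> ` X"
proof (rule ccontr)
  assume "y \<notin> \<iota> ` X"
  then obtain N where N: "\<And>m. m \<ge> N \<Longrightarrow> (\<sigma>c ^^ m) y \<in> far R"
    using escape_far[of y R] y(1) R by blast
  have "visits R x \<subseteq> {..<N}"
  proof
    fix m assume m: "m \<in> visits R x"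
    have "(\<sigma>c ^^ m) x = (\<sigma>c ^^ (m + n)) y" unfolding y(2)[symmetric] by (simp add: funpow_add)
    then have "(\<sigma>c ^^ (m + n)) y \<notin> far R" using m by (simp add: visits_def)
    then have "\<not> N \<le> m + n" using N by blast
    then show "m \<in> {..<N}" by simp
  qed
  then show False using inf finite_subset by blast
qed

text \<open>The eigenvalue equation is applied to \<open>f\<close>, for which the weights in
  \<open>L\<close> cancel, so that \<open>L f x\<close> counts the letters \<open>k\<close> with
  \<open>branch k x\<close> in \<open>A\<close>. Almost everywhere this count is the indicator of
  the image of \<open>A\<close>: a recurrent \<open>x\<close> has preimages only in the image of
  \<open>X\<close>, where a point determines its letter, and injectivity leaves at most one preimage
  in \<open>A\<close>.\<close>

lemma conformal: "conformal_measure \<nu> \<sigma>c (\<lambda>x. exp (pressure \<phi> - \<phi>c x))"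
  unfolding conformal_measure_def
proof (intro ballI impI, elim conjE)
  fix A assume A: "A \<in> sets \<nu>" and TA: "\<sigma>c ` A \<in> sets \<nu>" and inj: "inj_on \<sigma>c A"
  have AX: "A \<subseteq> Xc" using A by (simp add: sets_nu_iff)
  define f where "f y = ennreal (exp (- \<phi>c y)) * indicator A y" for y
  have fm: "f \<in> borel_measurable BX"
    using borel_measurable_continuous_on_Xc[OF phic(1)] A unfolding f_def sets_nu
    by (intro borel_measurable_times_ennreal) auto
  have Lf: "L f x = (\<integral>\<^sup>+k. indicator {k. branch k x \<in> A} k \<partial>count_space UNIV)" for x
    unfolding transfer_def f_def
    by (intro nn_integral_cong) (simp add: mult.assoc[symmetric] ennreal_mult[symmetric] exp_minus indicator_def)
  have "AE x in \<nu>. L f x = indicator (\<sigma>c ` A) x"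
    using AE_positive_frequency AE_space
  proof eventually_elim
    case (elim x)
    then obtain R where R: "R > 0" "infinite (visits R x)" using infinite_visits by blast
    have x: "x \<in> Xc" using elim by (simp add: space_nu)
    show ?case
    proof (cases "x \<in> \<sigma>c ` A")
      case False
      have "branch k x \<notin> A" for k
      proof
        assume "branch k x \<in> A"
        then have "\<sigma>c (branch k x) \<in> \<sigma>c ` A" by blast
        then show False using False x by simp
      qed
      then have "{k. branch k x \<in> A} = {}" by blast
      then show ?thesis unfolding Lf using False by simp
    next
      case True
      then obtain y where y: "y \<in> A" "x = \<sigma>c y" by blast
      then have "y \<in> \<iota> ` X" using recurrent_not_escaping[OF R, of y 1] AX by auto
      then obtain b where b: "b \<in> X" "y = \<iota> b" by blast
      have xb: "x = \<iota> (shift b)" using y b sigma(3) by simp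
      \<comment> \<open>A branch value in \<open>A\<close> is sent to \<open>x\<close> by
        \<open>\<sigma>c\<close>, hence equals \<open>y\<close> by injectivity; as \<open>y\<close>
        comes from \<open>X\<close>, its first letter forces \<open>k\<close>.\<close>
      have "branch k x \<in> A \<longleftrightarrow> k = b 0" for k
      proof
        assume k: "branch k x \<in> A"
        have "branch k x = y" by (rule inj_onD[OF inj _ k y(1)]) (use y x in simp)
        then have "\<iota> (k ## shift b) = \<iota> b" using b xb by simp
        then have "k ## shift b = b" using b by (subst (asm) iota_eq_iff) auto
        then have "b 0 = (k ## shift b) 0" by (rule arg_cong[OF sym])
        then show "k = b 0" by simp
      next
        assume "k = b 0"
        then show "branch k x \<in> A" using b y(1) by (simp add: xb build_shift)
      qed
      then have "{k. branch k x \<in> A} = {b 0}" by blast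
      then show ?thesis unfolding Lf using True by simp
    qed
  qed
  then have "(\<integral>\<^sup>+x. L f x \<partial>\<nu>) = (\<integral>\<^sup>+x. indicator (\<sigma>c ` A) x \<partial>\<nu>)" by (rule nn_integral_cong_AE)
  then have "emeasure \<nu> (\<sigma>c ` A) = ennreal (exp P) * (\<integral>\<^sup>+x. f x \<partial>\<nu>)"
    using TA eigen[OF fm] by simp
  also have "\<dots> = (\<integral>\<^sup>+x. ennreal (exp P) * f x \<partial>\<nu>)"
    using fm by (intro nn_integral_cmult[symmetric]) (simp add: measurable_nu)
  also have "\<dots> = (\<integral>\<^sup>+x\<in>A. ennreal (exp (pressure \<phi> - \<phi>c x)) \<partial>\<nu>)"
    by (intro nn_integral_cong)
       (simp add: f_def P_def mult.assoc[symmetric] ennreal_mult[symmetric] exp_add[symmetric])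
  finally show "emeasure \<nu> (\<sigma>c ` A) = (\<integral>\<^sup>+x\<in>A. ennreal (exp (pressure \<phi> - \<phi>c x)) \<partial>\<nu>)" .
qed

end

theorem theorem3:
  fixes X :: "(nat \<Rightarrow> int) set" and \<rho> :: "(nat \<Rightarrow> int) \<Rightarrow> (nat \<Rightarrow> int) \<Rightarrow> real"
    and \<delta>\<^sub>0 C\<^sub>E\<^sub>S L\<^sub>E\<^sub>S \<delta> r :: real
    and \<phi> :: "(nat \<Rightarrow> int) \<Rightarrow> real"
    and \<iota> :: "(nat \<Rightarrow> int) \<Rightarrow> 'c::complete_space" and Xc :: "'c set"
    and \<sigma>c :: "'c \<Rightarrow> 'c" and \<phi>c :: "'c \<Rightarrow> real"
  assumes "expanding_shift X \<rho> \<delta>\<^sub>0 C\<^sub>E\<^sub>S L\<^sub>E\<^sub>S"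
    and "0 < \<delta>" "\<delta> \<le> \<delta>\<^sub>0" "0 < r" "r < 1"
    and Delta: "\<And>\<psi>. weakly_Hoelder X \<rho> (min \<delta> (\<delta> / C\<^sub>E\<^sub>S)) r \<psi> \<Longrightarrow> weakly_Hoelder X \<rho> \<delta> r \<psi>"
    and "\<phi> \<in> BV X \<rho> \<delta> r"
    and "completion_of X \<rho> \<iota> Xc"
    and i: "\<sigma>c \<in> Xc \<rightarrow> Xc" "continuous_on Xc \<sigma>c" "\<And>a. a \<in> X \<Longrightarrow> \<sigma>c (\<iota> a) = \<iota> (shift a)"
    and ii: "\<And>R. R > 0 \<Longrightarrow> compact {b \<in> Xc. dist (\<iota> zero_seq) b \<le> R}"
    and iii: "\<And>R b. \<lbrakk>R > 0; b \<in> Xc - \<iota> ` X\<rbrakk> \<Longrightarrow>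
                \<exists>N\<ge>1. \<forall>n\<ge>N. (\<sigma>c ^^ n) b \<in> Xc - {b \<in> Xc. dist (\<iota> zero_seq) b \<le> R}"
    and iv: "(\<Sum>\<^sub>\<infinity>k::int. exp_sup \<phi> (cylinder X k)) < \<infinity>"
            "((\<lambda>R. \<Sum>\<^sub>\<infinity>k::int. exp_sup \<phi> (cylinder_outside X \<rho> k R)) \<longlongrightarrow> 0) at_top"
    and v: "continuous_on Xc \<phi>c" "\<And>a. a \<in> X \<Longrightarrow> \<phi>c (\<iota> a) = \<phi> a"
  shows "\<exists>\<nu> :: 'c measure.
           sets \<nu> = sets (restrict_space borel Xc) \<and>
           conformal_measure \<nu> \<sigma>c (\<lambda>x. exp (pressure \<phi> - \<phi>c x)) \<and>
           emeasure (completion \<nu>) (radial_set X \<iota> Xc \<sigma>c) = 1"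
proof -
  interpret expanding_shift X \<rho> \<delta>\<^sub>0 C\<^sub>E\<^sub>S L\<^sub>E\<^sub>S by fact
  interpret conformal_setting X \<rho> \<delta>\<^sub>0 C\<^sub>E\<^sub>S L\<^sub>E\<^sub>S \<delta> r \<phi> \<iota> Xc \<sigma>c \<phi>c
    by unfold_locales (fact assms)+
  obtain \<nu> where \<nu>: "prob_space \<nu>" "sets \<nu> = sets (restrict_space borel Xc)"
    "\<And>f. f \<in> borel_measurable (restrict_space borel Xc) \<Longrightarrow>
      (\<integral>\<^sup>+x. transfer UNIV f x \<partial>\<nu>) = ennreal (exp P) * (\<integral>\<^sup>+x. f x \<partial>\<nu>)"
    using eigenmeasure_exists by blast
  interpret conformal_eigenmeasure X \<rho> \<delta>\<^sub>0 C\<^sub>E\<^sub>S L\<^sub>E\<^sub>S \<delta> r \<phi> \<iota> Xc \<sigma>c \<phi>c \<nu>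
    by (intro conformal_eigenmeasure.intro conformal_eigenmeasure_axioms.intro conformal_setting_axioms \<nu>)
  show ?thesis using \<nu>(2) conformal emeasure_radial by blast
qed

end
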